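(* Let $d\ge 1$, $1<r<\infty$, $s\ge 0$ with $\frac 1r+\frac sd=\frac 12$. Then there exists a constant $C>0$, depending only on $d,r,s$ (and the fixed Littlewood–Paley cutoff), such that for all $f\in\dot H^s_x(\mathbf{R}^d)$, $$\|f\|_{L^r_x(\mathbf{R}^d)}\le C\,\|D^sf\|_{L^2_x(\mathbf{R}^d)}^{1-2s/d}\;\Big(\sup_{k\in\mathbf{Z}}\|f_k\|_{L^r_x(\mathbf{R}^d)}\Big)^{2s/d}.$$
   Context: $\hat f(\xi)=\int_{\mathbf{R}^d}e^{-ix\cdot\xi}f(x)\,dx$. $D^s$ is the Fourier multiplier operator $\widehat{D^sf}(\xi)=|\xi|^s\hat f(\xi)$, and $\dot H^s_x(\mathbf{R}^d)$ is the homogeneous Sobolev space of $f$ with $\|f\|_{\dot H^s_x}:=\|D^sf\|_{L^2_x}<\infty$. Here $f_k$ is the $k$-th Littlewood–Paley piece of $f$: fix a radial function $\eta\in C_c^\infty(\mathbf{R}^d)$ with $0\le\eta\le1$, $\eta=1$ on $|\xi|\le 1$ and $\eta=0$ for $|\xi|\ge 2$, and set $\hat f_k(\xi):=\big(\eta(2^{-k}\xi)-\eta(2^{-k+1}\xi)\big)\hat f(\xi)$. When $s=0$ the factor with exponent $0$ is read as $1$. *)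

theory Defs
  imports "HOL-Analysis.Analysis"
begin

text \<open>Functions on \<open>\<real>\<^sup>d\<close> are functions on a type of class \<open>euclidean_space\<close>, with
  \<open>d = DIM('a)\<close>. The elements of the homogeneous Sobolev space are taken to be tempered
  distributions, that is, functionals on Schwartz functions. The value of such a functional at a
  function that is not Schwartz is irrelevant.\<close>

type_synonym 'a dist = "('a \<Rightarrow> complex) \<Rightarrow> complex"

fun iter_deriv :: "'a list \<Rightarrow> ('a::euclidean_space \<Rightarrow> 'b::real_normed_vector) \<Rightarrow> 'a \<Rightarrow> 'b" where
  "iter_deriv [] f = f"
| "iter_deriv (b # bs) f = (\<lambda>x. frechet_derivative (iter_deriv bs f) (at x) b)"

definition smooth :: "('a::euclidean_space \<Rightarrow> 'b::real_normed_vector) \<Rightarrow> bool" where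
  "smooth f \<longleftrightarrow> (\<forall>bs \<in> lists Basis. iter_deriv bs f differentiable_on UNIV)"

definition schwartz :: "('a::euclidean_space \<Rightarrow> complex) set" where
  "schwartz = {\<phi>. smooth \<phi> \<and>
     (\<forall>N::nat. \<forall>bs \<in> lists Basis. bounded (range (\<lambda>x. (1 + norm x) ^ N *\<^sub>R iter_deriv bs \<phi> x)))}"

definition schwartz_seminorm :: "nat \<Rightarrow> ('a::euclidean_space \<Rightarrow> complex) \<Rightarrow> real" where
  "schwartz_seminorm N \<phi> =
     (\<Sum>bs | bs \<in> lists Basis \<and> length bs \<le> N. SUP x. (1 + norm x) ^ N * norm (iter_deriv bs \<phi> x))"

definition tempered :: "'a::euclidean_space dist \<Rightarrow> bool" where
  "tempered T \<longleftrightarrow>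
     (\<forall>\<phi>\<in>schwartz. \<forall>\<psi>\<in>schwartz. T (\<lambda>x. \<phi> x + \<psi> x) = T \<phi> + T \<psi>) \<and>
     (\<forall>c. \<forall>\<phi>\<in>schwartz. T (\<lambda>x. c * \<phi> x) = c * T \<phi>) \<and>
     (\<exists>N C. \<forall>\<phi>\<in>schwartz. norm (T \<phi>) \<le> C * schwartz_seminorm N \<phi>)"

definition represents :: "('a::euclidean_space \<Rightarrow> complex) \<Rightarrow> 'a dist \<Rightarrow> bool" where
  "represents u T \<longleftrightarrow> u \<in> borel_measurable borel \<and>
     (\<forall>\<phi>\<in>schwartz. integrable lborel (\<lambda>x. u x * \<phi> x) \<and> T \<phi> = (LINT x|lborel. u x * \<phi> x))"

definition fourier :: "('a::euclidean_space \<Rightarrow> complex) \<Rightarrow> 'a \<Rightarrow> complex" where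
  "fourier \<phi> \<xi> = (LINT x|lborel. exp (- (\<i> * of_real (x \<bullet> \<xi>))) * \<phi> x)"

definition inv_fourier :: "('a::euclidean_space \<Rightarrow> complex) \<Rightarrow> 'a \<Rightarrow> complex" where
  "inv_fourier \<phi> x =
     (LINT \<xi>|lborel. exp (\<i> * of_real (x \<bullet> \<xi>)) * \<phi> \<xi>) / of_real ((2 * pi) ^ DIM('a))"

definition dist_fourier :: "'a::euclidean_space dist \<Rightarrow> 'a dist" where
  "dist_fourier T = (\<lambda>\<phi>. T (fourier \<phi>))"

text \<open>The function representing the Fourier transform of \<open>T\<close>, if there is one. It is
  determined up to a null set, so the choice does not matter below.\<close>

definition fourier_fun :: "'a::euclidean_space dist \<Rightarrow> 'a \<Rightarrow> complex" where
  "fourier_fun T = (SOME F. represents F (dist_fourier T))"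

text \<open>The distribution whose Fourier transform is the function \<open>m * fourier_fun T\<close>, as one sees
  by putting \<open>\<psi> = fourier \<phi>\<close>. It is only meaningful if the Fourier transform of \<open>T\<close> is a
  function.\<close>

definition fourier_multiplier :: "('a::euclidean_space \<Rightarrow> real) \<Rightarrow> 'a dist \<Rightarrow> 'a dist" where
  "fourier_multiplier m T =
     (\<lambda>\<psi>. LINT \<xi>|lborel. of_real (m \<xi>) * fourier_fun T \<xi> * inv_fourier \<psi> \<xi>)"

text \<open>For \<open>s = 0\<close> the symbol is \<open>1\<close> off the origin (and \<open>0 powr 0 = 0\<close> at the origin, a null
  set), so \<open>Dpow 0\<close> is the identity.\<close>

definition Dpow :: "real \<Rightarrow> 'a::euclidean_space dist \<Rightarrow> 'a dist" where
  "Dpow s = fourier_multiplier (\<lambda>\<xi>. norm \<xi> powr s)"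

definition lp_cutoff :: "('a::euclidean_space \<Rightarrow> real) \<Rightarrow> bool" where
  "lp_cutoff \<eta> \<longleftrightarrow> smooth \<eta> \<and> compact (closure {\<xi>. \<eta> \<xi> \<noteq> 0}) \<and>
     (\<forall>\<xi> \<zeta>. norm \<xi> = norm \<zeta> \<longrightarrow> \<eta> \<xi> = \<eta> \<zeta>) \<and>
     (\<forall>\<xi>. 0 \<le> \<eta> \<xi> \<and> \<eta> \<xi> \<le> 1) \<and>
     (\<forall>\<xi>. norm \<xi> \<le> 1 \<longrightarrow> \<eta> \<xi> = 1) \<and>
     (\<forall>\<xi>. norm \<xi> \<ge> 2 \<longrightarrow> \<eta> \<xi> = 0)"

definition lp_piece :: "('a::euclidean_space \<Rightarrow> real) \<Rightarrow> int \<Rightarrow> 'a dist \<Rightarrow> 'a dist" where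
  "lp_piece \<eta> k =
     fourier_multiplier (\<lambda>\<xi>. \<eta> ((2 powi (- k)) *\<^sub>R \<xi>) - \<eta> ((2 powi (- k + 1)) *\<^sub>R \<xi>))"

text \<open>Powers with exponent \<open>a \<ge> 0\<close> of extended nonnegative reals; the zeroth power is always
  \<open>1\<close>.\<close>

definition epowr :: "ennreal \<Rightarrow> real \<Rightarrow> ennreal" where
  "epowr x a = (if a = 0 then 1 else if x = top then top else ennreal (enn2real x powr a))"

definition Lnorm :: "real \<Rightarrow> ('a::euclidean_space \<Rightarrow> complex) \<Rightarrow> ennreal" where
  "Lnorm p u = epowr (\<integral>\<^sup>+x. ennreal (norm (u x) powr p) \<partial>lborel) (1 / p)"

text \<open>A function representing \<open>T\<close> is unique up to a null set, so the infimum is over at most one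
  value; it is \<open>\<infinity>\<close> if \<open>T\<close> is not a function.\<close>

definition dist_Lnorm :: "real \<Rightarrow> 'a::euclidean_space dist \<Rightarrow> ennreal" where
  "dist_Lnorm p T = (INF u \<in> {u. represents u T}. Lnorm p u)"

text \<open>Tempered distributions \<open>f\<close> whose Fourier transform is a function and for which
  \<open>D\<^sup>s f\<close> is in \<open>L\<^sup>2\<close>. Requiring the Fourier transform to be a function (so that multiplication by
  \<open>|\<xi>|\<^sup>s\<close> makes sense) excludes nonzero polynomials. For \<open>0 \<le> s < d/2\<close> this is the standard
  realization of the homogeneous Sobolev space as a Hilbert space.\<close>

definition Hdot :: "real \<Rightarrow> 'a::euclidean_space dist set" where
  "Hdot s = {f. tempered f \<and> (\<exists>F. represents F (dist_fourier f)) \<and> dist_Lnorm 2 (Dpow s f) < \<infinity>}"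

end

theory Submission
  imports Defs "HOL-Probability.Characteristic_Functions" "HOL-Probability.Sinc_Integral"
begin

text \<open>Let \<open>B\<close> be the supremum of the norms \<open>\<parallel>f\<^sub>k\<parallel>\<^sub>r\<close>. By Bernstein's inequality the part of \<open>f\<close> with
  frequencies up to \<open>2\<^sup>j\<close> is bounded by a constant times \<open>2 powr (j * d / r) * B\<close>. Hence where
  \<open>|f|\<close> exceeds the level \<open>\<lambda>\<^sub>j\<close>, twice this bound, the part with frequencies above \<open>2\<^sup>j\<close> exceeds
  \<open>\<lambda>\<^sub>j / 2\<close>, and Chebyshev's inequality and Plancherel bound the measure of this set by the
  \<open>L\<^sup>2\<close> mass of the Fourier transform on \<open>|\<xi>| > 2\<^sup>j\<close>. Summing over the levels, with weights
  \<open>\<lambda>\<^sub>j powr r\<close>, gives a geometric series in \<open>j\<close> under the frequency integral, with value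
  comparable to \<open>B powr (r - 2) * |\<xi>| powr (2 * s)\<close>. The estimate is first proved for
  frequencies up to \<open>2\<^sup>n\<close>, where \<open>f\<close> is a bounded function, uniformly in \<open>n\<close>; Fatou's lemma
  removes the truncation.\<close>

subsection \<open>Schwartz functions\<close>

text \<open>The levels fit the exponents: the hypothesis says (d / r) * (r - 2) = 2 * s, so
  Chebyshev's bound, weighted by the r-th power of the level, leaves the level to the power r - 2, a
  multiple of B^(r - 2) * 2^(2 * s * j). For fixed \<xi> only the j with 2^j < |\<xi>| contribute,
  and their sum is finite because s > 0. The case s = 0, where r = 2, is separate. The obstacle is
  that f, D^s f and the pieces are functionals, known only through functions representing them.
  Differences of consecutive truncations are evaluated at every point by testing a representative of
  the piece against a translated Schwartz kernel. The norm of D^s f controls the integral of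
  |\<xi>|^(2 * s) * |F|^2, where F represents the Fourier transform of f, by duality: the decisive
  test function is the conjugate of |\<xi>|^s * F on a bounded set. Finally, the infimum in
  \<open>dist_Lnorm\<close> is bounded by exhibiting one function representing f, the almost
  everywhere limit of the truncations. It exists because their increments decay geometrically in
  L^2, again by s > 0. That F is a function also makes the truncations vanish in the limit of low
  frequencies, so telescoping leaves no remainder.\<close>

lemma iter_deriv_append: "iter_deriv (bs @ cs) f = iter_deriv bs (iter_deriv cs f)"
  by (induction bs) auto

text \<open>Decay of the function alone, without its derivatives. Together with the coinduction rule
  below it reduces membership in \<open>schwartz\<close> to statements about one function and its
  first derivatives.\<close>

definition rapid :: "('a::euclidean_space \<Rightarrow> 'b::real_normed_vector) \<Rightarrow> bool" where
  "rapid g \<longleftrightarrow> (\<forall>N. \<exists>C. \<forall>x. (1 + norm x) ^ N * norm (g x) \<le> C)"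

lemma rapid_iff_bounded:
  "rapid g \<longleftrightarrow> (\<forall>N::nat. bounded (range (\<lambda>x. (1 + norm x) ^ N *\<^sub>R g x)))"
  unfolding rapid_def bounded_iff by (auto simp: abs_of_nonneg)

text \<open>The Schwartz class is the largest class of differentiable, rapidly decreasing functions
  closed under coordinate derivatives. Closure properties then follow by exhibiting an invariant
  family, without a Leibniz formula for iterated derivatives.\<close>

lemma schwartz_coinduct [consumes 1, case_names differentiable rapid deriv]:
  assumes "\<phi> \<in> S"
    and "\<And>\<phi>. \<phi> \<in> S \<Longrightarrow> \<phi> differentiable_on UNIV"
    and "\<And>\<phi>. \<phi> \<in> S \<Longrightarrow> rapid \<phi>"
    and step: "\<And>\<phi> b. \<phi> \<in> S \<Longrightarrow> b \<in> Basis \<Longrightarrow> (\<lambda>x. frechet_derivative \<phi> (at x) b) \<in> S"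
  shows "\<phi> \<in> schwartz"
proof -
  have "iter_deriv bs \<phi> \<in> S" if "bs \<in> lists Basis" for bs
    using that by (induction bs) (auto simp: assms(1) step)
  with assms(2,3) show ?thesis
    by (auto simp: schwartz_def smooth_def rapid_iff_bounded)
qed

lemma schwartz_differentiable: "\<phi> \<in> schwartz \<Longrightarrow> \<phi> differentiable (at x)"
  by (auto simp: schwartz_def smooth_def differentiable_on_def dest: bspec[where x="[]"])

lemma schwartz_rapid: "\<phi> \<in> schwartz \<Longrightarrow> rapid \<phi>"
  by (auto simp: schwartz_def rapid_iff_bounded dest!: bspec[where x="[]"] spec)

lemma schwartz_deriv:
  assumes "\<phi> \<in> schwartz" "b \<in> Basis"
  shows "(\<lambda>x. frechet_derivative \<phi> (at x) b) \<in> schwartz"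
proof -
  \<comment> \<open>The head of the list is differentiated last, so a derivative taken first belongs
    at the end of the list.\<close>
  have eq: "iter_deriv bs (\<lambda>x. frechet_derivative \<phi> (at x) b) = iter_deriv (bs @ [b]) \<phi>" for bs
    by (simp add: iter_deriv_append)
  have "bs @ [b] \<in> lists Basis" if "bs \<in> lists Basis" for bs
    using that assms(2) by auto
  with assms(1) show ?thesis
    unfolding schwartz_def smooth_def mem_Collect_eq eq by blast
qed

lemma schwartz_continuous: "\<phi> \<in> schwartz \<Longrightarrow> continuous_on UNIV \<phi>"
  by (meson schwartz_differentiable differentiable_imp_continuous_within
      continuous_at_imp_continuous_on)

lemma schwartz_measurable [measurable_dest]:
  "\<phi> \<in> schwartz \<Longrightarrow> \<phi> \<in> borel_measurable borel"
  by (intro borel_measurable_continuous_onI schwartz_continuous)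

lemma schwartz_has_derivative:
  "\<phi> \<in> schwartz \<Longrightarrow> (\<phi> has_derivative frechet_derivative \<phi> (at x)) (at x)"
  using schwartz_differentiable frechet_derivative_works by blast

lemma frechet_derivative_eq:
  "(f has_derivative f') (at x) \<Longrightarrow> frechet_derivative f (at x) = f'"
  using frechet_derivative_at by metis

lemma rapid_mono:
  assumes "rapid g" "\<And>x. norm (h x) \<le> K * (1 + norm x) ^ M * norm (g x)"
  shows "rapid h"
  unfolding rapid_def
proof
  fix N
  obtain C where C: "\<And>x. (1 + norm x) ^ (N + M) * norm (g x) \<le> C"
    using assms(1) unfolding rapid_def by blast
  have "(1 + norm x) ^ N * norm (h x) \<le> \<bar>K\<bar> * C" for x
  proof -
    have "(1 + norm x) ^ N * norm (h x) \<le> (1 + norm x) ^ N * (\<bar>K\<bar> * (1 + norm x) ^ M * norm (g x))"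
      by (intro mult_left_mono order_trans[OF assms(2)] mult_right_mono) auto
    also have "\<dots> = \<bar>K\<bar> * ((1 + norm x) ^ (N + M) * norm (g x))"
      by (simp add: power_add)
    also have "\<dots> \<le> \<bar>K\<bar> * C"
      by (intro mult_left_mono C) auto
    finally show ?thesis .
  qed
  then show "\<exists>C. \<forall>x. (1 + norm x) ^ N * norm (h x) \<le> C" by blast
qed

lemma rapid_add:
  assumes "rapid g" "rapid h"
  shows "rapid (\<lambda>x. g x + h x)"
  unfolding rapid_def
proof
  fix N
  obtain C D where "\<And>x. (1 + norm x) ^ N * norm (g x) \<le> C" "\<And>x. (1 + norm x) ^ N * norm (h x) \<le> D"
    using assms unfolding rapid_def by blast
  then have "(1 + norm x) ^ N * norm (g x + h x) \<le> C + D" for x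
    by (smt (verit, ccfv_SIG) distrib_left mult_left_mono norm_ge_zero norm_triangle_ineq zero_le_power)
  then show "\<exists>C. \<forall>x. (1 + norm x) ^ N * norm (g x + h x) \<le> C" by blast
qed

lemma rapid_scale:
  fixes g :: "'a::euclidean_space \<Rightarrow> complex"
  shows "rapid g \<Longrightarrow> rapid (\<lambda>x. c * g x)"
  by (rule rapid_mono[where K="norm c" and M=0]) (auto simp: norm_mult)

lemma rapid_inner:
  fixes g :: "'a::euclidean_space \<Rightarrow> complex"
  assumes "rapid g"
  shows "rapid (\<lambda>x. of_real (x \<bullet> b) * g x)"
proof (rule rapid_mono[OF assms, where K="norm b" and M=1])
  fix x :: 'a
  have "\<bar>x \<bullet> b\<bar> \<le> norm b * (1 + norm x)"
    using Cauchy_Schwarz_ineq2[of x b] by (simp add: algebra_simps) (smt (verit) norm_ge_zero)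
  then show "norm (of_real (x \<bullet> b) * g x) \<le> norm b * (1 + norm x) ^ 1 * norm (g x)"
    by (simp add: norm_mult mult_right_mono)
qed

lemma schwartz_lincomb:
  assumes "\<phi> \<in> schwartz" "\<psi> \<in> schwartz"
  shows "(\<lambda>x. c * \<phi> x + d * \<psi> x) \<in> schwartz"
proof (rule schwartz_coinduct[where S="{\<lambda>x. c * \<phi> x + d * \<psi> x | \<phi> \<psi>. \<phi> \<in> schwartz \<and> \<psi> \<in> schwartz}"])
  show "(\<lambda>x. c * \<phi> x + d * \<psi> x) \<in> {\<lambda>x. c * \<phi> x + d * \<psi> x | \<phi> \<psi>. \<phi> \<in> schwartz \<and> \<psi> \<in> schwartz}"
    using assms by blast
next
  fix \<theta> :: "'a \<Rightarrow> complex"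
  assume "\<theta> \<in> {\<lambda>x. c * \<phi> x + d * \<psi> x | \<phi> \<psi>. \<phi> \<in> schwartz \<and> \<psi> \<in> schwartz}"
  then obtain \<phi> \<psi> where \<theta>: "\<theta> = (\<lambda>x. c * \<phi> x + d * \<psi> x)" and s: "\<phi> \<in> schwartz" "\<psi> \<in> schwartz"
    by blast
  show "\<theta> differentiable_on UNIV"
    unfolding \<theta> differentiable_on_def using s[THEN schwartz_differentiable] by auto
  show "rapid \<theta>"
    unfolding \<theta> by (intro rapid_add rapid_scale schwartz_rapid s)
  fix b :: 'a assume b: "b \<in> Basis"
  have D: "(\<theta> has_derivative (\<lambda>h. c * frechet_derivative \<phi> (at x) h + d * frechet_derivative \<psi> (at x) h)) (at x)"
    for x unfolding \<theta> by (intro has_derivative_add has_derivative_mult_right schwartz_has_derivative s)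
  have "(\<lambda>x. frechet_derivative \<theta> (at x) b)
    = (\<lambda>x. c * frechet_derivative \<phi> (at x) b + d * frechet_derivative \<psi> (at x) b)"
    by (simp add: frechet_derivative_eq[OF D])
  with s b show "(\<lambda>x. frechet_derivative \<theta> (at x) b)
      \<in> {\<lambda>x. c * \<phi> x + d * \<psi> x | \<phi> \<psi>. \<phi> \<in> schwartz \<and> \<psi> \<in> schwartz}"
    by (auto intro!: schwartz_deriv)
qed

lemma schwartz_add: "\<phi> \<in> schwartz \<Longrightarrow> \<psi> \<in> schwartz \<Longrightarrow> (\<lambda>x. \<phi> x + \<psi> x) \<in> schwartz"
  using schwartz_lincomb[of \<phi> \<psi> 1 1] by simp

lemma schwartz_scale: "\<phi> \<in> schwartz \<Longrightarrow> (\<lambda>x. c * \<phi> x) \<in> schwartz"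
  using schwartz_lincomb[of \<phi> \<phi> c 0] by simp

lemma schwartz_inner:
  assumes "\<phi> \<in> schwartz"
  shows "(\<lambda>x. of_real (x \<bullet> c) * \<phi> x) \<in> schwartz"
\<comment> \<open>The extra summand \<psi> makes the family invariant: it absorbs the term in which
  the product rule differentiates the linear factor.\<close>
proof (rule schwartz_coinduct[where S="{\<lambda>x. of_real (x \<bullet> c) * \<phi> x + \<psi> x | \<phi> \<psi>. \<phi> \<in> schwartz \<and> \<psi> \<in> schwartz}"])
  show "(\<lambda>x. of_real (x \<bullet> c) * \<phi> x) \<in> {\<lambda>x. of_real (x \<bullet> c) * \<phi> x + \<psi> x | \<phi> \<psi>. \<phi> \<in> schwartz \<and> \<psi> \<in> schwartz}"
    using assms schwartz_scale[OF assms, of 0]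
    by (intro CollectI exI[of _ \<phi>] exI[of _ "\<lambda>x. 0"]) auto
next
  fix \<theta> :: "'a \<Rightarrow> complex"
  assume "\<theta> \<in> {\<lambda>x. of_real (x \<bullet> c) * \<phi> x + \<psi> x | \<phi> \<psi>. \<phi> \<in> schwartz \<and> \<psi> \<in> schwartz}"
  then obtain \<phi> \<psi> where \<theta>: "\<theta> = (\<lambda>x. of_real (x \<bullet> c) * \<phi> x + \<psi> x)" and s: "\<phi> \<in> schwartz" "\<psi> \<in> schwartz"
    by blast
  have D: "(\<theta> has_derivative (\<lambda>h. of_real (x \<bullet> c) * frechet_derivative \<phi> (at x) h
      + (of_real (h \<bullet> c) * \<phi> x + frechet_derivative \<psi> (at x) h))) (at x)" for x
    unfolding \<theta> using schwartz_has_derivative[OF s(1)] schwartz_has_derivative[OF s(2)]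
    by (auto intro!: derivative_eq_intros simp: algebra_simps)
  then show "\<theta> differentiable_on UNIV"
    unfolding differentiable_on_def differentiable_def by blast
  show "rapid \<theta>"
    unfolding \<theta> by (intro rapid_add rapid_inner schwartz_rapid s)
  fix b :: 'a assume b: "b \<in> Basis"
  have "(\<lambda>x. frechet_derivative \<theta> (at x) b) = (\<lambda>x. of_real (x \<bullet> c) * frechet_derivative \<phi> (at x) b
      + (of_real (b \<bullet> c) * \<phi> x + frechet_derivative \<psi> (at x) b))"
    by (simp add: frechet_derivative_eq[OF D])
  with s b show "(\<lambda>x. frechet_derivative \<theta> (at x) b)
      \<in> {\<lambda>x. of_real (x \<bullet> c) * \<phi> x + \<psi> x | \<phi> \<psi>. \<phi> \<in> schwartz \<and> \<psi> \<in> schwartz}"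
    by (auto intro!: schwartz_deriv schwartz_add schwartz_scale exI)
qed

lemma rapid_affine:
  assumes "rapid g" "c \<noteq> 0"
  shows "rapid (\<lambda>x. g (c *\<^sub>R x + a))"
  unfolding rapid_def
proof
  fix N
  obtain C where C: "\<And>x. (1 + norm x) ^ N * norm (g x) \<le> C"
    using assms(1) unfolding rapid_def by blast
  define K where "K = 1 + (1 + norm a) / \<bar>c\<bar>"
  have K: "1 + norm x \<le> K * (1 + norm (c *\<^sub>R x + a))" for x
  proof -
    have "\<bar>c\<bar> * norm x \<le> norm (c *\<^sub>R x + a) + norm a"
      by (metis add_diff_cancel_right' norm_scaleR norm_triangle_ineq4)
    then have "norm x \<le> (norm (c *\<^sub>R x + a) + norm a) / \<bar>c\<bar>"
      using assms(2) by (simp add: field_simps)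
    also have "\<dots> \<le> (1 + norm a) / \<bar>c\<bar> * (1 + norm (c *\<^sub>R x + a))"
      using assms(2) by (simp add: field_simps)
    finally show ?thesis unfolding K_def by (subst distrib_right) (intro add_mono, simp_all)
  qed
  have "K \<ge> 0" unfolding K_def by auto
  have "(1 + norm x) ^ N * norm (g (c *\<^sub>R x + a)) \<le> K ^ N * C" for x
  proof -
    have "(1 + norm x) ^ N * norm (g (c *\<^sub>R x + a))
        \<le> (K * (1 + norm (c *\<^sub>R x + a))) ^ N * norm (g (c *\<^sub>R x + a))"
      by (intro mult_right_mono power_mono K) auto
    also have "\<dots> = K ^ N * ((1 + norm (c *\<^sub>R x + a)) ^ N * norm (g (c *\<^sub>R x + a)))"
      by (simp add: power_mult_distrib)
    also have "\<dots> \<le> K ^ N * C"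
      by (intro mult_left_mono C) (simp add: \<open>K \<ge> 0\<close>)
    finally show ?thesis .
  qed
  then show "\<exists>C. \<forall>x. (1 + norm x) ^ N * norm (g (c *\<^sub>R x + a)) \<le> C" by blast
qed

lemma schwartz_affine:
  assumes "\<phi> \<in> schwartz" "c \<noteq> 0"
  shows "(\<lambda>x. \<phi> (c *\<^sub>R x + a)) \<in> schwartz"
proof (rule schwartz_coinduct[where S="{\<lambda>x. \<phi> (c *\<^sub>R x + a) | \<phi>. \<phi> \<in> schwartz}"])
  show "(\<lambda>x. \<phi> (c *\<^sub>R x + a)) \<in> {\<lambda>x. \<phi> (c *\<^sub>R x + a) | \<phi>. \<phi> \<in> schwartz}"
    using assms by blast
next
  fix \<theta> :: "'a \<Rightarrow> complex"
  assume "\<theta> \<in> {\<lambda>x. \<phi> (c *\<^sub>R x + a) | \<phi>. \<phi> \<in> schwartz}"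
  then obtain \<phi> where \<theta>: "\<theta> = (\<lambda>x. \<phi> (c *\<^sub>R x + a))" and s: "\<phi> \<in> schwartz"
    by blast
  have D: "(\<theta> has_derivative (\<lambda>h. frechet_derivative \<phi> (at (c *\<^sub>R x + a)) (c *\<^sub>R h))) (at x)" for x
    unfolding \<theta>
    by (rule has_derivative_compose[of "\<lambda>x. c *\<^sub>R x + a", OF _ schwartz_has_derivative[OF s]])
      (auto intro!: derivative_eq_intros)
  then show "\<theta> differentiable_on UNIV"
    unfolding differentiable_on_def differentiable_def by blast
  show "rapid \<theta>"
    unfolding \<theta> by (intro rapid_affine schwartz_rapid s assms)
  fix b :: 'a assume b: "b \<in> Basis"
  have lin: "linear (frechet_derivative \<phi> (at y))" for y
    using schwartz_has_derivative[OF s] has_derivative_linear by blast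
  have "(\<lambda>x. frechet_derivative \<theta> (at x) b)
      = (\<lambda>x. (\<lambda>y. of_real c * frechet_derivative \<phi> (at y) b) (c *\<^sub>R x + a))"
    by (simp add: frechet_derivative_eq[OF D] linear_scale[OF lin] scaleR_conv_of_real)
  moreover have "(\<lambda>y. of_real c * frechet_derivative \<phi> (at y) b) \<in> schwartz"
    by (intro schwartz_scale schwartz_deriv s b)
  ultimately show "(\<lambda>x. frechet_derivative \<theta> (at x) b) \<in> {\<lambda>x. \<phi> (c *\<^sub>R x + a) | \<phi>. \<phi> \<in> schwartz}"
    by (intro CollectI exI[of _ "\<lambda>y. of_real c * frechet_derivative \<phi> (at y) b"]) simp
qed

lemma smooth_deriv:
  assumes "smooth g" "b \<in> Basis"
  shows "smooth (\<lambda>x. frechet_derivative g (at x) b)"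
proof -
  have eq: "iter_deriv bs (\<lambda>x. frechet_derivative g (at x) b) = iter_deriv (bs @ [b]) g" for bs
    by (simp add: iter_deriv_append)
  have "bs @ [b] \<in> lists Basis" if "bs \<in> lists Basis" for bs
    using that assms(2) by auto
  with assms(1) show ?thesis
    unfolding smooth_def eq by blast
qed

lemma smooth_differentiable: "smooth g \<Longrightarrow> g differentiable (at x)"
  by (auto simp: smooth_def differentiable_on_def dest: bspec[where x="[]"])

lemma smooth_continuous: "smooth g \<Longrightarrow> continuous_on UNIV g"
  by (meson smooth_differentiable differentiable_imp_continuous_within
      continuous_at_imp_continuous_on)

lemma smooth_compact_support_schwartz:
  fixes g :: "'a::euclidean_space \<Rightarrow> real"
  assumes "smooth g" "\<And>x. norm x \<ge> R \<Longrightarrow> g x = 0"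
  shows "(\<lambda>x. complex_of_real (g x)) \<in> schwartz"
proof (rule schwartz_coinduct[where S="{\<lambda>x. complex_of_real (g x) | g. smooth g \<and> (\<exists>R. \<forall>x. norm x \<ge> R \<longrightarrow> g x = 0)}"])
  show "(\<lambda>x. complex_of_real (g x)) \<in> {\<lambda>x. complex_of_real (g x) | g. smooth g \<and> (\<exists>R. \<forall>x. norm x \<ge> R \<longrightarrow> g x = 0)}"
    using assms by blast
next
  fix \<theta> :: "'a \<Rightarrow> complex"
  assume "\<theta> \<in> {\<lambda>x. complex_of_real (g x) | g. smooth g \<and> (\<exists>R. \<forall>x. norm x \<ge> R \<longrightarrow> g x = 0)}"
  then obtain g R where \<theta>: "\<theta> = (\<lambda>x. complex_of_real (g x))" and s: "smooth g"
    and R: "\<And>x. norm x \<ge> R \<Longrightarrow> g x = 0"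
    by blast
  have Dg: "(g has_derivative frechet_derivative g (at x)) (at x)" for x
    using smooth_differentiable[OF s] frechet_derivative_works by blast
  have D: "(\<theta> has_derivative (\<lambda>h. of_real (frechet_derivative g (at x) h))) (at x)" for x
    unfolding \<theta> using Dg by (rule has_derivative_of_real)
  then show "\<theta> differentiable_on UNIV"
    unfolding differentiable_on_def differentiable_def by blast
  have "compact (g ` cball 0 R)"
    by (intro compact_continuous_image continuous_on_subset[OF smooth_continuous[OF s]]) auto
  then obtain B where B: "\<And>x. x \<in> cball 0 R \<Longrightarrow> norm (g x) \<le> B"
    by (meson bounded_iff compact_imp_bounded imageI)
  show "rapid \<theta>"
    unfolding rapid_def
  proof
    fix N
    have "(1 + norm x) ^ N * norm (\<theta> x) \<le> (1 + \<bar>R\<bar>) ^ N * \<bar>B\<bar>" for x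
    proof (cases "norm x \<ge> R")
      case False
      have "\<bar>g x\<bar> \<le> B" using B[of x] False by auto
      then show ?thesis
        unfolding \<theta> using False by (intro mult_mono power_mono) auto
    qed (simp add: \<theta> R)
    then show "\<exists>C. \<forall>x. (1 + norm x) ^ N * norm (\<theta> x) \<le> C" by blast
  qed
  fix b :: 'a assume b: "b \<in> Basis"
  \<comment> \<open>A point with |x| = R need not have a neighbourhood on which \<open>g\<close>
    vanishes. The radius therefore grows by 1 with each derivative, which the existential over
    \<open>R\<close> in the family permits.\<close>
  have "frechet_derivative g (at x) b = 0" if "norm x \<ge> R + 1" for x
  proof -
    have "\<forall>\<^sub>F y in nhds x. y \<in> - cball 0 R"
      using that by (intro eventually_nhds_in_open) auto
    then have ev: "\<forall>\<^sub>F y in nhds x. g y = 0"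
      by eventually_elim (auto intro: R)
    then have "((\<lambda>y. 0) has_derivative frechet_derivative g (at x)) (at x)"
      using R[of x] that by (intro has_derivative_transform_eventually[OF Dg])
        (auto simp: eventually_at_filter elim: eventually_mono)
    then show ?thesis
      by (metis frechet_derivative_eq has_derivative_const)
  qed
  moreover have "(\<lambda>x. frechet_derivative \<theta> (at x) b) = (\<lambda>x. complex_of_real (frechet_derivative g (at x) b))"
    by (simp add: frechet_derivative_eq[OF D])
  ultimately show "(\<lambda>x. frechet_derivative \<theta> (at x) b)
      \<in> {\<lambda>x. complex_of_real (g x) | g. smooth g \<and> (\<exists>R. \<forall>x. norm x \<ge> R \<longrightarrow> g x = 0)}"
    using smooth_deriv[OF s b]
    by (intro CollectI exI[of _ "\<lambda>x. frechet_derivative g (at x) b"] conjI exI[of _ "R + 1"]) auto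
qed

lemma nn_integral_inverse_square: "(\<integral>\<^sup>+(t::real). ennreal (inverse (1 + t\<^sup>2)) \<partial>lborel) < \<infinity>"
  using integrable_inverse_1_plus_square
  by (simp add: set_integrable_def integrable_iff_bounded)

text \<open>The exponent 2 d allows a comparison with the product over the coordinates t of 1 / (1 +
  t^2): each factor 1 + t^2 is at most (1 + |x|)^2, and the integral of the product
  factorises.\<close>

lemma integrable_decay:
  "integrable lborel (\<lambda>x::'a::euclidean_space. 1 / (1 + norm x) ^ (2 * DIM('a)))"
proof (rule integrableI_nonneg)
  have "(\<integral>\<^sup>+(x::'a). ennreal (1 / (1 + norm x) ^ (2 * DIM('a))) \<partial>lborel)
      \<le> (\<integral>\<^sup>+(x::'a). (\<Prod>b\<in>Basis. ennreal (inverse (1 + (x \<bullet> b)\<^sup>2))) \<partial>lborel)"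
  proof (rule nn_integral_mono)
    fix x :: 'a
    have "(\<Prod>b\<in>Basis. 1 + (x \<bullet> b)\<^sup>2) \<le> (\<Prod>b\<in>(Basis::'a set). (1 + norm x)\<^sup>2)"
    proof (rule prod_mono)
      fix b :: 'a assume b: "b \<in> Basis"
      have "(x \<bullet> b)\<^sup>2 \<le> (norm x)\<^sup>2"
        using Basis_le_norm[OF b, of x] by (metis abs_ge_zero power2_abs power_mono)
      then show "0 \<le> 1 + (x \<bullet> b)\<^sup>2 \<and> 1 + (x \<bullet> b)\<^sup>2 \<le> (1 + norm x)\<^sup>2"
        by (auto simp: power2_eq_square algebra_simps) (smt (verit) norm_ge_zero)
    qed
    then have "(\<Prod>b\<in>Basis. 1 + (x \<bullet> b)\<^sup>2) \<le> (1 + norm x) ^ (2 * DIM('a))"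
      by (simp add: power_mult)
    then have "1 / (1 + norm x) ^ (2 * DIM('a)) \<le> inverse (\<Prod>b\<in>Basis. 1 + (x \<bullet> b)\<^sup>2)"
      unfolding inverse_eq_divide
      by (intro divide_left_mono mult_pos_pos prod_pos zero_less_power) (auto intro: add_pos_nonneg)
    then have "ennreal (1 / (1 + norm x) ^ (2 * DIM('a)))
        \<le> ennreal (\<Prod>b\<in>Basis. inverse (1 + (x \<bullet> b)\<^sup>2))"
      using prod_inversef[of "\<lambda>b. 1 + (x \<bullet> b)\<^sup>2" Basis] by (simp add: o_def ennreal_leI)
    then show "ennreal (1 / (1 + norm x) ^ (2 * DIM('a)))
        \<le> (\<Prod>b\<in>Basis. ennreal (inverse (1 + (x \<bullet> b)\<^sup>2)))"
      by (simp add: prod_ennreal)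
  qed
  also have "\<dots> = (\<Prod>b\<in>(Basis::'a set). (\<integral>\<^sup>+t. ennreal (inverse (1 + t\<^sup>2)) \<partial>lborel))"
    by (rule nn_integral_lborel_prod) auto
  also have "\<dots> < \<infinity>"
    using nn_integral_inverse_square by (simp add: power_less_top_ennreal)
  finally show "(\<integral>\<^sup>+(x::'a). ennreal (1 / (1 + norm x) ^ (2 * DIM('a))) \<partial>lborel) < \<infinity>" .
qed auto

lemma rapid_bound:
  fixes g :: "'a::euclidean_space \<Rightarrow> 'b::real_normed_vector"
  assumes "rapid g"
  obtains C where "C \<ge> 0" "\<And>x. norm (g x) \<le> C / (1 + norm x) ^ N"
proof -
  obtain C where C: "\<And>x. (1 + norm x) ^ N * norm (g x) \<le> C"
    using assms unfolding rapid_def by blast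
  show thesis
  proof
    show "C \<ge> 0" using C[of 0] by (smt (verit) norm_ge_zero mult_nonneg_nonneg zero_le_power)
    fix x :: 'a
    have "(1 + norm x) ^ N > 0" by (simp add: add_pos_nonneg)
    then show "norm (g x) \<le> C / (1 + norm x) ^ N"
      using C[of x] by (simp add: field_simps)
  qed
qed

lemma rapid_integrable:
  fixes g :: "'a::euclidean_space \<Rightarrow> complex"
  assumes "rapid g" "g \<in> borel_measurable borel"
  shows "integrable lborel g"
proof -
  obtain C where "C \<ge> 0" "\<And>x. norm (g x) \<le> C / (1 + norm x) ^ (2 * DIM('a))"
    using rapid_bound[OF assms(1)] by blast
  then show ?thesis
    by (intro Bochner_Integration.integrable_bound[OF integrable_mult_right[OF integrable_decay, of C]])
      (use assms(2) in auto)
qed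

lemma schwartz_integrable: "\<phi> \<in> schwartz \<Longrightarrow> integrable lborel \<phi>"
  by (intro rapid_integrable schwartz_rapid schwartz_measurable)

lemma schwartz_bounded:
  assumes "\<phi> \<in> schwartz"
  obtains C where "C > 0" "\<And>x. norm (\<phi> x) \<le> C"
proof -
  obtain C where "C \<ge> 0" "\<And>x. norm (\<phi> x) \<le> C / (1 + norm x) ^ 0"
    using rapid_bound[OF schwartz_rapid[OF assms]] by blast
  then show thesis by (intro that[of "C + 1"]) (auto intro: order_trans[of _ C])
qed

subsection \<open>Changes of variables\<close>

lemma nn_integral_lborel_affine:
  fixes f :: "'a::euclidean_space \<Rightarrow> ennreal"
  assumes [measurable]: "f \<in> borel_measurable borel" and "c \<noteq> 0"
  shows "(\<integral>\<^sup>+x. f x \<partial>lborel) = ennreal (\<bar>c\<bar> ^ DIM('a)) * (\<integral>\<^sup>+x. f (c *\<^sub>R x + a) \<partial>lborel)"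
  by (subst lborel_affine[OF assms(2), of a])
    (simp add: nn_integral_density nn_integral_distr nn_integral_cmult add.commute ennreal_power)

lemma integrable_lborel_affine:
  fixes f :: "'a::euclidean_space \<Rightarrow> 'b::{banach, second_countable_topology}"
  assumes f: "integrable lborel f" and c: "c \<noteq> 0"
  shows "integrable lborel (\<lambda>x. f (c *\<^sub>R x + a))"
proof -
  have [measurable]: "f \<in> borel_measurable borel" using f by (auto dest: borel_measurable_integrable)
  have "(\<integral>\<^sup>+x. norm (f x) \<partial>lborel) = ennreal (\<bar>c\<bar> ^ DIM('a)) * (\<integral>\<^sup>+x. norm (f (c *\<^sub>R x + a)) \<partial>lborel)"
    by (rule nn_integral_lborel_affine) (auto simp: c)
  moreover have "(\<integral>\<^sup>+x. norm (f x) \<partial>lborel) < \<infinity>" using f by (simp add: integrable_iff_bounded)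
  ultimately show ?thesis
    using c by (auto simp: integrable_iff_bounded ennreal_mult_less_top ennreal_mult_eq_top_iff less_top)
qed

lemma integral_lborel_affine:
  fixes f :: "'a::euclidean_space \<Rightarrow> 'b::{banach, second_countable_topology}"
  assumes [measurable]: "f \<in> borel_measurable borel" and "c \<noteq> 0"
  shows "(LINT x|lborel. f x) = (\<bar>c\<bar> ^ DIM('a)) *\<^sub>R (LINT x|lborel. f (c *\<^sub>R x + a))"
  by (subst lborel_affine[OF assms(2), of a])
    (simp add: integral_density integral_distr add.commute ennreal_power)

subsection \<open>The Fourier transform of integrable functions\<close>

lemma norm_exp_i [simp]:
  "norm (exp (\<i> * of_real t)) = 1" "norm (exp (- (\<i> * of_real t))) = 1"
  by (simp_all add: norm_exp_eq_Re)

lemma integrable_exp_mult [intro]: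
  fixes g :: "'a::euclidean_space \<Rightarrow> complex"
  assumes "integrable lborel g"
  shows "integrable lborel (\<lambda>x. exp (\<i> * of_real (x \<bullet> \<xi>)) * g x)"
    and "integrable lborel (\<lambda>x. exp (- (\<i> * of_real (x \<bullet> \<xi>))) * g x)"
  by (rule Bochner_Integration.integrable_bound[OF assms];
      use assms in \<open>auto simp: norm_mult intro!: borel_measurable_times borel_measurable_integrable\<close>)+

lemma norm_fourier_le:
  fixes g :: "'a::euclidean_space \<Rightarrow> complex"
  shows "norm (fourier g \<xi>) \<le> (LINT x|lborel. norm (g x))"
  unfolding fourier_def
  by (rule order_trans[OF integral_norm_bound]) (simp add: norm_mult)

lemma fourier_measurable [measurable]:
  fixes g :: "'a::euclidean_space \<Rightarrow> complex"
  assumes [measurable]: "g \<in> borel_measurable borel"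
  shows "fourier g \<in> borel_measurable borel"
  unfolding fourier_def by measurable

lemma inv_fourier_eq_fourier:
  fixes g :: "'a::euclidean_space \<Rightarrow> complex"
  shows "inv_fourier g x = fourier g (- x) / of_real ((2 * pi) ^ DIM('a))"
  by (simp add: inv_fourier_def fourier_def inner_commute)

lemma inv_fourier_measurable [measurable]:
  fixes g :: "'a::euclidean_space \<Rightarrow> complex"
  assumes [measurable]: "g \<in> borel_measurable borel"
  shows "inv_fourier g \<in> borel_measurable borel"
  unfolding inv_fourier_def by measurable

text \<open>One formula for translations (c = 1), reflections (c = -1) and dilations.\<close>

lemma fourier_affine:
  fixes g :: "'a::euclidean_space \<Rightarrow> complex"
  assumes [measurable]: "g \<in> borel_measurable borel" and c: "c \<noteq> 0"
  shows "fourier g \<xi> = of_real (\<bar>c\<bar> ^ DIM('a)) * exp (- (\<i> * of_real (a \<bullet> \<xi>)))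
    * fourier (\<lambda>x. g (c *\<^sub>R x + a)) (c *\<^sub>R \<xi>)"
proof -
  have "fourier g \<xi> = \<bar>c\<bar> ^ DIM('a) *\<^sub>R
      (LINT x|lborel. exp (- (\<i> * of_real ((c *\<^sub>R x + a) \<bullet> \<xi>))) * g (c *\<^sub>R x + a))"
    unfolding fourier_def by (rule integral_lborel_affine) (auto simp: c)
  also have "(LINT x|lborel. exp (- (\<i> * of_real ((c *\<^sub>R x + a) \<bullet> \<xi>))) * g (c *\<^sub>R x + a))
      = (LINT x|lborel. exp (- (\<i> * of_real (a \<bullet> \<xi>))) *
          (exp (- (\<i> * of_real (x \<bullet> (c *\<^sub>R \<xi>)))) * g (c *\<^sub>R x + a)))"
    by (intro Bochner_Integration.integral_cong)
      (auto simp: inner_add_left algebra_simps exp_add exp_diff exp_minus divide_simps)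
  finally show ?thesis by (simp add: fourier_def scaleR_conv_of_real mult.assoc)
qed

lemma fourier_translate:
  fixes g :: "'a::euclidean_space \<Rightarrow> complex"
  assumes "g \<in> borel_measurable borel"
  shows "fourier (\<lambda>x. g (x + a)) \<xi> = exp (\<i> * of_real (a \<bullet> \<xi>)) * fourier g \<xi>"
  using fourier_affine[OF assms, of 1 \<xi> a] by (simp add: exp_minus field_simps)

lemma exp_remainder: "norm (exp (- (\<i> * of_real t)) - 1 + \<i> * of_real t) \<le> t\<^sup>2"
proof -
  have "norm (exp (- (\<i> * of_real t)) - 1 + \<i> * of_real t) \<le> t\<^sup>2 / 2"
    using iexp_approx1[of "- t" 1] by (simp add: power2_eq_square algebra_simps)
  then show ?thesis by (rule order_trans) simp
qed

text \<open>The quadratic Taylor remainder of the exponential bounds the error by |h|^2 times the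
  second absolute moment of \<open>g\<close>, so the quotient by |h| tends to 0.\<close>

lemma fourier_has_derivative:
  fixes g :: "'a::euclidean_space \<Rightarrow> complex"
  assumes g: "rapid g" and [measurable]: "g \<in> borel_measurable borel"
  shows "(fourier g has_derivative (\<lambda>h. fourier (\<lambda>x. - \<i> * (of_real (x \<bullet> h) * g x)) \<xi>)) (at \<xi>)"
proof -
  have ig: "integrable lborel g" by (intro rapid_integrable g) measurable
  have i1: "integrable lborel (\<lambda>x. of_real (x \<bullet> h) * g x)" for h
    by (intro rapid_integrable rapid_inner g) measurable
  have "rapid (\<lambda>x. of_real ((norm x)\<^sup>2) * g x)"
    by (rule rapid_mono[OF g, where K=1 and M=2]) (auto simp: norm_mult norm_power intro!: mult_right_mono power_mono)
  then have i2: "integrable lborel (\<lambda>x. of_real ((norm x)\<^sup>2) * g x)"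
    by (rule rapid_integrable) measurable
  define M where "M = (LINT x|lborel. norm (of_real ((norm x)\<^sup>2) * g x))"
  define D where "D h = fourier (\<lambda>x. - \<i> * (of_real (x \<bullet> h) * g x)) \<xi>" for h
  have iD: "integrable lborel (\<lambda>x. exp (- (\<i> * of_real (x \<bullet> \<xi>))) * (- \<i> * (of_real (x \<bullet> h) * g x)))" for h
    by (intro integrable_exp_mult integrable_mult_right i1)
  have "linear D"
  proof (rule linearI)
    show "D (h + k) = D h + D k" for h k
      unfolding D_def fourier_def Bochner_Integration.integral_add[OF iD[of h] iD[of k], symmetric]
      by (intro Bochner_Integration.integral_cong) (auto simp: inner_add_right algebra_simps)
    show "D (r *\<^sub>R h) = r *\<^sub>R D h" for r h
      unfolding D_def fourier_def
      by (subst Bochner_Integration.integral_scaleR_right[symmetric])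
        (auto intro!: Bochner_Integration.integral_cong simp: scaleR_conv_of_real algebra_simps)
  qed
  then have "bounded_linear D" by (rule linear_conv_bounded_linear[THEN iffD1])
  moreover have "(\<lambda>h. norm (fourier g (\<xi> + h) - fourier g \<xi> - D h) / norm h) \<midarrow>0\<rightarrow> 0"
  proof (rule Lim_null_comparison)
    show "\<forall>\<^sub>F h in at 0. norm (norm (fourier g (\<xi> + h) - fourier g \<xi> - D h) / norm h) \<le> M * norm h"
    proof (rule always_eventually, rule allI)
      fix h
      have "fourier g (\<xi> + h) - fourier g \<xi> - D h = (LINT x|lborel.
          exp (- (\<i> * of_real (x \<bullet> \<xi>))) * (exp (- (\<i> * of_real (x \<bullet> h))) - 1 + \<i> * of_real (x \<bullet> h)) * g x)"
        unfolding D_def fourier_def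
        by (subst Bochner_Integration.integral_diff[symmetric], (intro integrable_exp_mult ig)+,
            subst Bochner_Integration.integral_diff[symmetric],
            intro Bochner_Integration.integrable_diff integrable_exp_mult ig, rule iD,
            rule Bochner_Integration.integral_cong)
          (auto simp: algebra_simps inner_add_right exp_add exp_diff exp_minus divide_simps)
      also have "norm \<dots> \<le> (LINT x|lborel. (norm h)\<^sup>2 * norm (of_real ((norm x)\<^sup>2) * g x))"
      proof (rule Bochner_Integration.integral_norm_bound_integral)
        show "integrable lborel (\<lambda>x. (norm h)\<^sup>2 * norm (of_real ((norm x)\<^sup>2) * g x))"
          by (intro integrable_mult_right integrable_norm i2)
        fix x
        have "(x \<bullet> h)\<^sup>2 \<le> (norm h)\<^sup>2 * (norm x)\<^sup>2"
          using power_mono[OF Cauchy_Schwarz_ineq2[of x h], of 2]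
          by (simp add: power_mult_distrib mult.commute)
        then have "norm (exp (- (\<i> * of_real (x \<bullet> h))) - 1 + \<i> * of_real (x \<bullet> h)) \<le> (norm h)\<^sup>2 * (norm x)\<^sup>2"
          using exp_remainder[of "x \<bullet> h"] by linarith
        then show "norm (exp (- (\<i> * of_real (x \<bullet> \<xi>))) * (exp (- (\<i> * of_real (x \<bullet> h))) - 1 + \<i> * of_real (x \<bullet> h)) * g x)
            \<le> (norm h)\<^sup>2 * norm (of_real ((norm x)\<^sup>2) * g x)"
          unfolding norm_mult norm_exp_i by (simp add: mult_right_mono mult.assoc[symmetric] norm_power)
        have "integrable lborel (\<lambda>x. exp (- (\<i> * of_real (x \<bullet> (\<xi> + h)))) * g x - exp (- (\<i> * of_real (x \<bullet> \<xi>))) * g x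
            - exp (- (\<i> * of_real (x \<bullet> \<xi>))) * (- \<i> * (of_real (x \<bullet> h) * g x)))"
          by (intro Bochner_Integration.integrable_diff integrable_exp_mult ig iD)
        then show "integrable lborel (\<lambda>x. exp (- (\<i> * of_real (x \<bullet> \<xi>))) * (exp (- (\<i> * of_real (x \<bullet> h))) - 1 + \<i> * of_real (x \<bullet> h)) * g x)"
          by (rule back_subst[of "integrable lborel"])
            (auto simp: algebra_simps inner_add_right exp_add exp_diff exp_minus divide_simps)
      qed
      also have "\<dots> = M * (norm h)\<^sup>2" unfolding M_def by simp
      finally show "norm (norm (fourier g (\<xi> + h) - fourier g \<xi> - D h) / norm h) \<le> M * norm h"
        by (cases "h = 0") (auto simp: power2_eq_square field_simps)
    qed
    show "((\<lambda>h. M * norm h) \<longlongrightarrow> 0) (at 0)"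
      by (intro tendsto_mult_right_zero tendsto_norm_zero tendsto_ident_at)
  qed
  ultimately show ?thesis
    unfolding D_def[symmetric] has_derivative_at by blast
qed

text \<open>Difference quotients replace integration by parts: their transforms are explicit by the
  translation formula, and dominated convergence identifies the limit on the other side.\<close>

lemma fourier_deriv:
  fixes \<phi> :: "'a::euclidean_space \<Rightarrow> complex"
  assumes s: "\<phi> \<in> schwartz" and b: "b \<in> Basis"
  shows "fourier (\<lambda>x. frechet_derivative \<phi> (at x) b) \<xi> = \<i> * of_real (b \<bullet> \<xi>) * fourier \<phi> \<xi>"
proof -
  define d where "d x = frechet_derivative \<phi> (at x) b" for x
  have ds: "d \<in> schwartz" unfolding d_def by (rule schwartz_deriv[OF s b])
  note [measurable] = schwartz_measurable[OF s] schwartz_measurable[OF ds]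
  define h where "h n = 1 / real (Suc n)" for n
  have h: "0 < h n" "h n \<le> 1" for n by (auto simp: h_def)
  have h0: "h \<longlonglongrightarrow> 0" unfolding h_def by (rule LIMSEQ_Suc[OF lim_1_over_n])
  have h0': "filterlim h (at 0) sequentially"
    using h0 h by (auto simp: filterlim_at less_imp_neq[symmetric])
  define q where "q n x = (\<phi> (x + h n *\<^sub>R b) - \<phi> x) / of_real (h n)" for n x
  have D: "((\<lambda>t. \<phi> (x + t *\<^sub>R b)) has_derivative (\<lambda>u. u *\<^sub>R d (x + t *\<^sub>R b))) (at t)" for x t
  proof -
    have lin: "linear (frechet_derivative \<phi> (at y))" for y
      using schwartz_has_derivative[OF s] has_derivative_linear by blast
    show ?thesis unfolding d_def linear_scale[OF lin, symmetric]
      by (rule has_derivative_compose[of "\<lambda>t. x + t *\<^sub>R b", OF _ schwartz_has_derivative[OF s]])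
        (auto intro!: derivative_eq_intros)
  qed
  have qlim: "(\<lambda>n. q n x) \<longlonglongrightarrow> d x" for x
  proof -
    have "(\<lambda>u. norm (\<phi> (x + u *\<^sub>R b) - \<phi> x - u *\<^sub>R d x) / norm u) \<midarrow>0\<rightarrow> 0"
      using D[of x 0] unfolding has_derivative_at by simp
    then have "(\<lambda>n. norm (\<phi> (x + h n *\<^sub>R b) - \<phi> x - h n *\<^sub>R d x) / norm (h n)) \<longlonglongrightarrow> 0"
      by (rule filterlim_compose[OF _ h0'])
    moreover have "norm (\<phi> (x + h n *\<^sub>R b) - \<phi> x - h n *\<^sub>R d x) / norm (h n) = norm (q n x - d x)" for n
    proof -
      have "q n x - d x = (\<phi> (x + h n *\<^sub>R b) - \<phi> x - h n *\<^sub>R d x) / of_real (h n)"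
        using h[of n] unfolding q_def by (simp add: field_simps scaleR_conv_of_real)
      then show ?thesis by (simp add: norm_divide)
    qed
    ultimately have "(\<lambda>n. norm (q n x - d x)) \<longlonglongrightarrow> 0" by simp
    then show ?thesis by (simp add: tendsto_norm_zero_iff LIM_zero_iff)
  qed
  let ?N = "2 * DIM('a)"
  obtain C where C: "C \<ge> 0" "\<And>x. norm (d x) \<le> C / (1 + norm x) ^ ?N"
    using rapid_bound[OF schwartz_rapid[OF ds]] by blast
  \<comment> \<open>The quotient is bounded by the derivative on the segment from x to x + b. There
    1 + |x| is at most 2 (1 + |x + t b|), because |t b| <= 1; this is the origin of the factor 2 to
    the power 2 d.\<close>
  define w where "w x = C * 2 ^ ?N * (1 / (1 + norm x) ^ ?N)" for x :: 'a
  have qb: "norm (q n x) \<le> w x" for n x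
  proof -
    have db: "norm (d (x + t *\<^sub>R b)) \<le> w x" if "t \<in> {0..h n}" for t
    proof -
      have "norm x \<le> norm (x + t *\<^sub>R b) + norm (t *\<^sub>R b)"
        by (metis add_diff_cancel_right' norm_triangle_ineq4)
      moreover have "norm (t *\<^sub>R b) \<le> 1" using that b h(2)[of n] by auto
      ultimately have "1 + norm x \<le> 2 * (1 + norm (x + t *\<^sub>R b))"
        unfolding distrib_left using norm_ge_zero[of "x + t *\<^sub>R b"] by linarith
      then have "(1 + norm x) ^ ?N \<le> (2 * (1 + norm (x + t *\<^sub>R b))) ^ ?N"
        by (intro power_mono) auto
      then have le: "(1 + norm x) ^ ?N \<le> 2 ^ ?N * (1 + norm (x + t *\<^sub>R b)) ^ ?N"
        by (simp only: power_mult_distrib)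
      have "(1 + norm x) ^ ?N > 0" "(1 + norm (x + t *\<^sub>R b)) ^ ?N > 0" by (simp_all add: add_pos_nonneg)
      with le have "C / (1 + norm (x + t *\<^sub>R b)) ^ ?N \<le> w x"
        unfolding w_def using mult_left_mono[OF le C(1)] by (simp add: field_simps)
      with C(2) order_trans show ?thesis by blast
    qed
    have "norm (\<phi> (x + h n *\<^sub>R b) - \<phi> (x + 0 *\<^sub>R b)) \<le> w x * norm (h n - 0)"
    proof (rule differentiable_bound[where S="{0..h n}"])
      show "((\<lambda>t. \<phi> (x + t *\<^sub>R b)) has_derivative (\<lambda>u. u *\<^sub>R d (x + t *\<^sub>R b))) (at t within {0..h n})" for t
        by (rule has_derivative_at_withinI[OF D])
      show "onorm (\<lambda>u. u *\<^sub>R d (x + t *\<^sub>R b)) \<le> w x" if "t \<in> {0..h n}" for t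
        using db[OF that] by (intro onorm_bound) (auto intro: order_trans[OF norm_ge_zero] simp: mult.commute mult_left_mono)
    qed (use h[of n] in auto)
    then show ?thesis
      using h[of n] unfolding q_def by (simp add: norm_divide field_simps)
  qed
  have iw: "integrable lborel w"
    unfolding w_def by (intro integrable_mult_right integrable_decay)
  have 1: "(\<lambda>n. fourier (q n) \<xi>) \<longlonglongrightarrow> fourier d \<xi>"
    unfolding fourier_def
  proof (rule integral_dominated_convergence[OF _ _ iw])
    show "AE x in lborel. (\<lambda>n. exp (- (\<i> * of_real (x \<bullet> \<xi>))) * q n x) \<longlonglongrightarrow> exp (- (\<i> * of_real (x \<bullet> \<xi>))) * d x"
      by (intro AE_I2 tendsto_mult tendsto_const qlim)
    show "AE x in lborel. norm (exp (- (\<i> * of_real (x \<bullet> \<xi>))) * q n x) \<le> w x" for n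
      by (intro AE_I2) (simp add: norm_mult qb)
    show "(\<lambda>x. exp (- (\<i> * of_real (x \<bullet> \<xi>))) * q n x) \<in> borel_measurable lborel" for n
      unfolding q_def by measurable
  qed measurable
  have fq: "fourier (q n) \<xi> = (exp (\<i> * of_real (h n * (b \<bullet> \<xi>))) - 1) / of_real (h n) * fourier \<phi> \<xi>" for n
  proof -
    have i: "integrable lborel (\<lambda>x. \<phi> (x + h n *\<^sub>R b))"
      using integrable_lborel_affine[OF schwartz_integrable[OF s], of 1] by simp
    have "fourier (q n) \<xi> = (fourier (\<lambda>x. \<phi> (x + h n *\<^sub>R b)) \<xi> - fourier \<phi> \<xi>) / of_real (h n)"
      unfolding fourier_def q_def times_divide_eq_right right_diff_distrib
      by (subst integral_divide_zero, subst Bochner_Integration.integral_diff)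
        (intro integrable_exp_mult i schwartz_integrable s refl)+
    then show ?thesis
      by (simp add: fourier_translate field_simps)
  qed
  have "((\<lambda>z. (exp (\<i> * of_real (b \<bullet> \<xi>) * z) - 1) / z) \<longlongrightarrow> \<i> * of_real (b \<bullet> \<xi>)) (at 0)"
  proof -
    have "((\<lambda>z. exp (\<i> * of_real (b \<bullet> \<xi>) * z)) has_field_derivative \<i> * of_real (b \<bullet> \<xi>)) (at 0)"
      by (auto intro!: derivative_eq_intros)
    then show ?thesis by (simp add: has_field_derivative_iff)
  qed
  moreover have "filterlim (\<lambda>n. complex_of_real (h n)) (at 0) sequentially"
    using h by (auto simp: filterlim_at less_imp_neq[symmetric] intro!: tendsto_of_real_iff[of h 0, THEN iffD2, simplified] h0)
  ultimately have "(\<lambda>n. (exp (\<i> * of_real (b \<bullet> \<xi>) * of_real (h n)) - 1) / of_real (h n)) \<longlonglongrightarrow> \<i> * of_real (b \<bullet> \<xi>)"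
    by (rule filterlim_compose)
  then have "(\<lambda>n. fourier (q n) \<xi>) \<longlonglongrightarrow> \<i> * of_real (b \<bullet> \<xi>) * fourier \<phi> \<xi>"
    unfolding fq by (intro tendsto_mult tendsto_const) (simp add: mult_ac)
  with 1 have "fourier d \<xi> = \<i> * of_real (b \<bullet> \<xi>) * fourier \<phi> \<xi>"
    by (rule LIMSEQ_unique)
  then show ?thesis by (simp add: d_def[abs_def])
qed

text \<open>One more power of |\<xi>| is at most the sum of the |\<xi> . b|, and each of these
  factors is absorbed by a derivative of \<phi>. Hence the induction is over all Schwartz functions
  at once.\<close>

lemma rapid_fourier:
  assumes "\<phi> \<in> schwartz"
  shows "rapid (fourier \<phi>)"
proof -
  have "\<exists>C. \<forall>\<xi>. (1 + norm \<xi>) ^ N * norm (fourier \<phi> \<xi>) \<le> C" for N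
    using assms
  proof (induction N arbitrary: \<phi>)
    case 0
    then show ?case using norm_fourier_le by auto
  next
    case (Suc N)
    let ?d = "\<lambda>b x. frechet_derivative \<phi> (at x) b"
    obtain C where C: "\<And>\<xi>. (1 + norm \<xi>) ^ N * norm (fourier \<phi> \<xi>) \<le> C"
      using Suc by blast
    have "\<exists>C. \<forall>\<xi>. (1 + norm \<xi>) ^ N * norm (fourier (?d b) \<xi>) \<le> C" if "b \<in> Basis" for b
      by (rule Suc.IH[OF schwartz_deriv[OF Suc.prems that]])
    then obtain E where E: "\<And>b \<xi>. b \<in> Basis \<Longrightarrow> (1 + norm \<xi>) ^ N * norm (fourier (?d b) \<xi>) \<le> E b"
      by metis
    have "(1 + norm \<xi>) ^ Suc N * norm (fourier \<phi> \<xi>) \<le> C + (\<Sum>b\<in>Basis. E b)" for \<xi>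
    proof -
      have "(1 + norm \<xi>) ^ Suc N * norm (fourier \<phi> \<xi>)
          = (1 + norm \<xi>) ^ N * norm (fourier \<phi> \<xi>) + norm \<xi> * ((1 + norm \<xi>) ^ N * norm (fourier \<phi> \<xi>))"
        by (simp add: algebra_simps)
      also have "\<dots> \<le> C + (\<Sum>b\<in>Basis. \<bar>\<xi> \<bullet> b\<bar>) * ((1 + norm \<xi>) ^ N * norm (fourier \<phi> \<xi>))"
        by (intro add_mono C mult_right_mono norm_le_l1) auto
      also have "(\<Sum>b\<in>Basis. \<bar>\<xi> \<bullet> b\<bar>) * ((1 + norm \<xi>) ^ N * norm (fourier \<phi> \<xi>))
          = (\<Sum>b\<in>Basis. (1 + norm \<xi>) ^ N * norm (fourier (?d b) \<xi>))"
        unfolding sum_distrib_right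
        by (intro sum.cong refl) (simp add: fourier_deriv[OF Suc.prems] norm_mult inner_commute)
      also have "\<dots> \<le> (\<Sum>b\<in>Basis. E b)" by (intro sum_mono E)
      finally show ?thesis by simp
    qed
    then show ?case by blast
  qed
  then show ?thesis by (simp add: rapid_def)
qed

text \<open>The image of the Schwartz class is an invariant family: differentiating a transform
  multiplies the original function by -\<i> (x . b), which stays Schwartz.\<close>

lemma fourier_schwartz:
  assumes "\<phi> \<in> schwartz"
  shows "fourier \<phi> \<in> schwartz"
proof (rule schwartz_coinduct[where S="fourier ` schwartz"])
  show "fourier \<phi> \<in> fourier ` schwartz" using assms by blast
  fix \<theta> :: "'a \<Rightarrow> complex" assume "\<theta> \<in> fourier ` schwartz"
  then obtain \<phi> where \<theta>: "\<theta> = fourier \<phi>" and s: "\<phi> \<in> schwartz" by blast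
  note D = fourier_has_derivative[OF schwartz_rapid[OF s] schwartz_measurable[OF s], folded \<theta>]
  show "\<theta> differentiable_on UNIV"
    unfolding differentiable_on_def differentiable_def using D by blast
  show "rapid \<theta>" unfolding \<theta> by (rule rapid_fourier[OF s])
  fix b :: 'a
  have "(\<lambda>x. frechet_derivative \<theta> (at x) b) = fourier (\<lambda>x. - \<i> * (of_real (x \<bullet> b) * \<phi> x))"
    by (simp add: frechet_derivative_eq[OF D])
  then show "(\<lambda>x. frechet_derivative \<theta> (at x) b) \<in> fourier ` schwartz"
    using schwartz_scale[OF schwartz_inner[OF s]] by blast
qed

lemma inv_fourier_schwartz:
  assumes "\<phi> \<in> schwartz"
  shows "inv_fourier \<phi> \<in> schwartz"
proof -
  have "(\<lambda>x. (1 / of_real ((2 * pi) ^ DIM('a))) * fourier \<phi> ((- 1) *\<^sub>R x + 0)) \<in> schwartz"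
    by (intro schwartz_scale schwartz_affine fourier_schwartz assms) auto
  then show ?thesis
    by (rule back_subst[of "\<lambda>g. g \<in> schwartz"]) (auto simp: inv_fourier_eq_fourier)
qed

subsection \<open>Gaussians\<close>

lemma cnj_measurable [measurable]: "cnj \<in> borel_measurable borel"
  by (intro borel_measurable_continuous_onI continuous_intros)

lemma
  fixes h :: "'a::euclidean_space \<Rightarrow> real \<Rightarrow> complex"
  assumes h: "\<And>b. b \<in> Basis \<Longrightarrow> integrable lborel (h b)"
  shows lborel_integrable_prod: "integrable lborel (\<lambda>x::'a. \<Prod>b\<in>Basis. h b (x \<bullet> b))"
    and lborel_integral_prod:
      "(LINT x|lborel. (\<Prod>b\<in>Basis. h b ((x::'a) \<bullet> b))) = (\<Prod>b\<in>Basis. LINT t|lborel. h b t)"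
proof -
  interpret product_sigma_finite "\<lambda>_::'a. lborel :: real measure" ..
  let ?P = "\<Pi>\<^sub>M b\<in>(Basis::'a set). (lborel :: real measure)"
  let ?T = "\<lambda>f. \<Sum>b\<in>(Basis::'a set). f b *\<^sub>R b"
  have hm [measurable]: "b \<in> Basis \<Longrightarrow> h b \<in> borel_measurable borel" for b
    using h by (auto dest: borel_measurable_integrable)
  have [measurable]: "(\<lambda>x::'a. \<Prod>b\<in>Basis. h b (x \<bullet> b)) \<in> borel_measurable borel" by measurable
  have T: "(\<Prod>b\<in>Basis. h b (?T f \<bullet> b)) = (\<Prod>b\<in>Basis. h b (f b))" for f
    by (intro prod.cong refl) simp
  have Tm: "?T \<in> measurable ?P borel" by measurable
  show "integrable lborel (\<lambda>x::'a. \<Prod>b\<in>Basis. h b (x \<bullet> b))"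
    by (subst lborel_eq, subst integrable_distr_eq[OF Tm])
      (simp_all only: T, auto intro!: product_integrable_prod h)
  show "(LINT x|lborel. (\<Prod>b\<in>Basis. h b ((x::'a) \<bullet> b))) = (\<Prod>b\<in>Basis. LINT t|lborel. h b t)"
    by (subst lborel_eq, subst integral_distr[OF Tm])
      (simp_all only: T, auto intro!: product_integral_prod h)
qed

definition gauss :: "'a::euclidean_space \<Rightarrow> real" where
  "gauss x = exp (- ((norm x)\<^sup>2 / 2))"

lemma gauss_measurable [measurable]: "gauss \<in> borel_measurable borel"
  unfolding gauss_def[abs_def] by measurable

lemma gauss_nonneg [simp]: "gauss x \<ge> 0" and gauss_le_1: "gauss x \<le> 1" and gauss_0 [simp]: "gauss 0 = 1"
  by (auto simp: gauss_def)

lemma gauss_real_integrable: "integrable lborel (\<lambda>t::real. exp (- (t\<^sup>2 / 2)))"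
proof -
  have "integrable lborel (\<lambda>t::real. sqrt (2 * pi) * std_normal_density t)"
    by (intro integrable_mult_right integrable_normal_density) simp
  then show ?thesis
    by (rule back_subst[of "integrable lborel"]) (auto simp: std_normal_density_def real_sqrt_mult)
qed

text \<open>This is the characteristic function of the standard normal distribution at -t, freed
  from the normalising factor of the density.\<close>

lemma fourier_gauss_real:
  "(LINT u|lborel. exp (- (\<i> * of_real (u * t))) * of_real (exp (- (u\<^sup>2 / 2)))) = of_real (sqrt (2 * pi) * exp (- (t\<^sup>2 / 2)))"
proof -
  define S where "S = complex_of_real (sqrt (2 * pi))"
  have S: "S \<noteq> 0" by (simp add: S_def)
  define I where "I = (LINT u|lborel. exp (- (\<i> * of_real (u * t))) * complex_of_real (exp (- (u\<^sup>2 / 2))))"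
  have "of_real (exp (- (t\<^sup>2 / 2))) = char std_normal_distribution (- t)"
    by (simp add: char_std_normal_distribution)
  also have "\<dots> = (LINT u|lborel. std_normal_density u *\<^sub>R iexp (- t * u))"
    unfolding char_def by (subst integral_density) auto
  also have "\<dots> = (LINT u|lborel. (1 / S) *
      (exp (- (\<i> * of_real (u * t))) * of_real (exp (- (u\<^sup>2 / 2)))))"
    by (intro Bochner_Integration.integral_cong)
      (auto simp: std_normal_density_def scaleR_conv_of_real mult_ac S_def)
  also have "\<dots> = (1 / S) * I" unfolding I_def by (rule integral_mult_right_zero)
  finally have "I = S * of_real (exp (- (t\<^sup>2 / 2)))"
    using S by simp
  then show ?thesis by (simp only: I_def S_def of_real_mult)
qed

lemma gauss_prod: "gauss x = (\<Prod>b\<in>Basis. exp (- ((x \<bullet> b)\<^sup>2 / 2)))"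
proof -
  have "(norm x)\<^sup>2 = (\<Sum>b\<in>Basis. (x \<bullet> b)\<^sup>2)"
    by (metis (no_types, lifting) euclidean_inner power2_eq_square power2_norm_eq_inner sum.cong)
  then show ?thesis
    unfolding gauss_def by (simp add: exp_sum[symmetric] sum_negf sum_divide_distrib)
qed

lemma gauss_integrable: "integrable lborel (gauss :: 'a::euclidean_space \<Rightarrow> real)"
proof -
  have "integrable lborel (\<lambda>x::'a. \<Prod>b\<in>Basis. (\<lambda>_ t. complex_of_real (exp (- (t\<^sup>2 / 2)))) b (x \<bullet> b))"
    by (rule lborel_integrable_prod) (intro integrable_of_real gauss_real_integrable)
  then have "integrable lborel (\<lambda>x::'a. complex_of_real (gauss x))"
    by (simp only: gauss_prod of_real_prod)
  then show ?thesis using complex_of_real_integrable_eq by blast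
qed

lemma fourier_gauss:
  fixes x :: "'a::euclidean_space"
  shows "fourier (\<lambda>\<xi>. of_real (gauss \<xi>)) x = of_real (sqrt (2 * pi) ^ DIM('a) * gauss x)"
proof -
  define h where "h b u = exp (- (\<i> * of_real (u * (x \<bullet> b)))) * of_real (exp (- (u\<^sup>2 / 2)))" for b :: 'a and u
  have "integrable lborel (\<lambda>u. exp (- (\<i> * of_real (u \<bullet> t))) * complex_of_real (exp (- (u\<^sup>2 / 2))))" for t :: real
    by (intro integrable_exp_mult integrable_of_real gauss_real_integrable)
  then have ih: "integrable lborel (h b)" for b
    unfolding h_def by simp
  have "exp (- (\<i> * of_real (\<xi> \<bullet> x))) = (\<Prod>b\<in>Basis. exp (- (\<i> * of_real ((\<xi> \<bullet> b) * (x \<bullet> b)))))" for \<xi> :: 'a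
    by (subst euclidean_inner) (simp add: exp_sum[symmetric] sum_negf sum_distrib_left)
  then have "fourier (\<lambda>\<xi>. of_real (gauss \<xi>)) x = (LINT \<xi>|lborel. (\<Prod>b\<in>Basis. h b (\<xi> \<bullet> b)))"
    unfolding fourier_def gauss_prod h_def by (simp add: prod.distrib)
  also have "\<dots> = (\<Prod>b\<in>Basis. LINT t|lborel. h b t)"
    by (rule lborel_integral_prod) (rule ih)
  also have "\<dots> = (\<Prod>b\<in>Basis. of_real (sqrt (2 * pi) * exp (- ((x \<bullet> b)\<^sup>2 / 2))))"
    unfolding h_def fourier_gauss_real ..
  also have "\<dots> = of_real (\<Prod>b\<in>(Basis::'a set). (sqrt (2 * pi) * exp (- ((x \<bullet> b)\<^sup>2 / 2))))"
    by (rule of_real_prod[symmetric])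
  also have "(\<Prod>b\<in>(Basis::'a set). (sqrt (2 * pi) * exp (- ((x \<bullet> b)\<^sup>2 / 2)))) = sqrt (2 * pi) ^ DIM('a) * gauss x"
    by (simp add: prod.distrib gauss_prod)
  finally show ?thesis .
qed

lemma integral_gauss: "(LINT x|lborel. gauss (x::'a::euclidean_space)) = sqrt (2 * pi) ^ DIM('a)"
proof -
  have "complex_of_real (LINT x|lborel. gauss (x::'a)) = fourier (\<lambda>\<xi>. of_real (gauss (\<xi>::'a))) 0"
    unfolding fourier_def by (simp add: integral_of_real)
  also have "\<dots> = of_real (sqrt (2 * pi) ^ DIM('a))"
    by (simp add: fourier_gauss)
  finally show ?thesis using of_real_eq_iff by blast
qed

lemma sqrt_two_pi_power: "sqrt (2 * pi) ^ n * sqrt (2 * pi) ^ n = (2 * pi) ^ n"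
proof -
  have "sqrt (2 * pi) * sqrt (2 * pi) = 2 * pi" by simp
  then show ?thesis
    using power_mult_distrib[of "sqrt (2 * pi)" "sqrt (2 * pi)" n] by (simp only:)
qed

lemma fourier_gauss_scaled:
  fixes x :: "'a::euclidean_space"
  assumes "\<sigma> > 0"
  shows "fourier (\<lambda>\<xi>. of_real (gauss (\<sigma> *\<^sub>R \<xi>))) x
    = of_real ((1 / \<sigma>) ^ DIM('a) * sqrt (2 * pi) ^ DIM('a) * gauss ((1 / \<sigma>) *\<^sub>R x))"
  using fourier_affine[of "\<lambda>\<xi>. of_real (gauss (\<sigma> *\<^sub>R \<xi>))" "1 / \<sigma>" x 0] assms
  by (simp add: fourier_gauss)

section \<open>Multiplication formula, Plancherel inequality and Fourier inversion\<close>

lemma fourier_modulate: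
  "fourier (\<lambda>\<xi>. exp (\<i> * of_real (\<xi> \<bullet> x)) * g \<xi>) y = fourier g (y - x)"
  unfolding fourier_def
  by (intro Bochner_Integration.integral_cong)
    (auto simp: inner_diff_right inner_commute algebra_simps exp_add exp_diff exp_minus divide_simps)

lemma fourier_multiplication_formula:
  fixes g k :: "'a::euclidean_space \<Rightarrow> complex"
  assumes g: "integrable lborel g" and k: "integrable lborel k"
  shows "(LINT \<xi>|lborel. fourier g \<xi> * k \<xi>) = (LINT x|lborel. g x * fourier k x)"
proof -
  have [measurable]: "g \<in> borel_measurable borel" "k \<in> borel_measurable borel"
    using g k by (auto dest: borel_measurable_integrable)
  let ?f = "\<lambda>x \<xi>. exp (- (\<i> * of_real (x \<bullet> \<xi>))) * g x * k \<xi>"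
  have "integrable (lborel \<Otimes>\<^sub>M lborel) (case_prod ?f)"
  proof (rule lborel_pair.Fubini_integrable)
    show "integrable lborel (\<lambda>x. LINT y|lborel. norm (case (x, y) of (x, \<xi>) \<Rightarrow> ?f x \<xi>))"
      using g k by (simp add: norm_mult)
    show "AE x in lborel. integrable lborel (\<lambda>y. case (x, y) of (x, \<xi>) \<Rightarrow> ?f x \<xi>)"
    proof (rule AE_I2)
      fix x
      have "integrable lborel (\<lambda>y. g x * (exp (- (\<i> * of_real (y \<bullet> x))) * k y))"
        by (intro integrable_mult_right integrable_exp_mult k)
      then show "integrable lborel (\<lambda>y. case (x, y) of (x, \<xi>) \<Rightarrow> ?f x \<xi>)"
        by (simp add: inner_commute mult_ac)
    qed
  qed measurable
  from lborel_pair.Fubini_integral[OF this]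
  have F: "(LINT \<xi>|lborel. LINT x|lborel. exp (- (\<i> * of_real (x \<bullet> \<xi>))) * g x * k \<xi>)
      = (LINT x|lborel. LINT \<xi>|lborel. exp (- (\<i> * of_real (x \<bullet> \<xi>))) * g x * k \<xi>)" .
  have A: "(LINT x|lborel. exp (- (\<i> * of_real (x \<bullet> \<xi>))) * g x * k \<xi>) = fourier g \<xi> * k \<xi>" for \<xi>
    unfolding fourier_def by simp
  have B: "(LINT \<xi>|lborel. exp (- (\<i> * of_real (x \<bullet> \<xi>))) * g x * k \<xi>) = g x * fourier k x" for x
    unfolding fourier_def by (subst integral_mult_right_zero[symmetric])
      (simp add: inner_commute mult_ac)
  show ?thesis using F unfolding A B .
qed

lemma inv_fourier_multiplication_formula:
  fixes g k :: "'a::euclidean_space \<Rightarrow> complex"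
  assumes g: "integrable lborel g" and k: "integrable lborel k"
  shows "(LINT \<xi>|lborel. inv_fourier g \<xi> * k \<xi>) = (LINT x|lborel. g x * inv_fourier k x)"
proof -
  have [measurable]: "g \<in> borel_measurable borel" "k \<in> borel_measurable borel"
    using g k by (auto dest: borel_measurable_integrable)
  have k': "integrable lborel (\<lambda>x. k (- x))"
    using integrable_lborel_affine[OF k, of "-1" 0] by simp
  have fk: "fourier (\<lambda>x. k (- x)) x = fourier k (- x)" for x
    using fourier_affine[of "\<lambda>x. k (- x)" "-1" x 0] by simp
  have "(LINT \<xi>|lborel. fourier g (- \<xi>) * k \<xi>) = (LINT \<xi>|lborel. fourier g \<xi> * k (- \<xi>))"
    by (subst integral_lborel_affine[where c="-1" and a=0]) auto
  also have "\<dots> = (LINT x|lborel. g x * fourier k (- x))"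
    by (simp add: fourier_multiplication_formula[OF g k'] fk)
  finally show ?thesis by (simp add: inv_fourier_eq_fourier del: of_real_power of_real_mult)
qed

lemma gauss_scaled_tendsto: "(\<lambda>n. gauss ((1 / real (Suc n)) *\<^sub>R x)) \<longlonglongrightarrow> 1"
proof -
  have "(\<lambda>n. gauss ((1 / real (Suc n)) *\<^sub>R x)) \<longlonglongrightarrow> exp (- ((norm (0 *\<^sub>R x))\<^sup>2 / 2))"
    unfolding gauss_def
    by (intro tendsto_intros LIMSEQ_Suc[OF lim_1_over_n]) simp
  then show ?thesis by simp
qed

text \<open>Plancherel as an inequality, on \<open>L\<^sup>1\<close> only: with a Gaussian weight the left side becomes
  a convolution with a positive kernel, to which the arithmetic-geometric mean inequality applies.\<close>

lemma fourier_L2_le: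
  fixes g :: "'a::euclidean_space \<Rightarrow> complex"
  assumes g: "integrable lborel g"
  shows "(\<integral>\<^sup>+\<xi>. ennreal ((norm (fourier g \<xi>))\<^sup>2) \<partial>lborel)
    \<le> ennreal ((2 * pi) ^ DIM('a)) * (\<integral>\<^sup>+x. ennreal ((norm (g x))\<^sup>2) \<partial>lborel)"
    (is "_ \<le> ?R")
proof -
  have gm [measurable]: "g \<in> borel_measurable borel"
    using g by (auto dest: borel_measurable_integrable)
  have weighted: "(\<integral>\<^sup>+\<xi>. ennreal ((norm (fourier g \<xi>))\<^sup>2 * gauss (\<sigma> *\<^sub>R \<xi>)) \<partial>lborel) \<le> ?R"
    if \<sigma>: "\<sigma> > 0" for \<sigma>
  proof -
    \<comment> \<open>\<open>G\<close> is the Fourier transform of the Gaussian weight. Its mass (2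
      * pi)^d is the same for every \<sigma> and becomes the Plancherel constant.\<close>
    define G where "G z = (1 / \<sigma>) ^ DIM('a) * sqrt (2 * pi) ^ DIM('a) * gauss ((1 / \<sigma>) *\<^sub>R z)" for z :: 'a
    have Gm [measurable]: "G \<in> borel_measurable borel" unfolding G_def[abs_def] by measurable
    have Gpos: "G z \<ge> 0" for z unfolding G_def using \<sigma> by simp
    have Gint: "(\<integral>\<^sup>+z. ennreal (G (z + a)) \<partial>lborel) = ennreal ((2 * pi) ^ DIM('a))" for a
    proof -
      have "(\<integral>\<^sup>+z. ennreal (G (z + a)) \<partial>lborel) = (\<integral>\<^sup>+z. ennreal (G z) \<partial>lborel)"
        by (subst nn_integral_lborel_affine[where c=1 and a=a and f="\<lambda>z. ennreal (G z)"]) auto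
      also have "\<dots> = ennreal (\<sigma> ^ DIM('a)) * (\<integral>\<^sup>+z. ennreal (G (\<sigma> *\<^sub>R z)) \<partial>lborel)"
        using \<sigma> by (subst nn_integral_lborel_affine[where c=\<sigma> and a=0]) auto
      also have "(\<integral>\<^sup>+z. ennreal (G (\<sigma> *\<^sub>R z)) \<partial>lborel)
          = (\<integral>\<^sup>+z. ennreal ((1 / \<sigma>) ^ DIM('a) * sqrt (2 * pi) ^ DIM('a)) * ennreal (gauss (z::'a)) \<partial>lborel)"
        unfolding G_def using \<sigma>
        by (intro nn_integral_cong) (auto simp: ennreal_mult'[symmetric] ennreal_mult[symmetric])
      also have "\<dots> = ennreal ((1 / \<sigma>) ^ DIM('a) * sqrt (2 * pi) ^ DIM('a)) * ennreal (sqrt (2 * pi) ^ DIM('a))"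
        by (subst nn_integral_cmult)
          (auto simp: nn_integral_eq_integral[OF gauss_integrable] integral_gauss)
      finally show ?thesis
        using \<sigma> by (simp add: ennreal_mult[symmetric] power_divide mult.assoc sqrt_two_pi_power)
    qed
    \<comment> \<open>Chosen so that \<open>fourier g\<close> times \<open>k\<close> is the weighted
      integrand. Moving the transform from \<open>g\<close> to \<open>k\<close> yields the conjugate
      of the convolution of \<open>g\<close> with the kernel \<open>G\<close>.\<close>
    define k where "k \<xi> = cnj (fourier g \<xi>) * of_real (gauss (\<sigma> *\<^sub>R \<xi>))" for \<xi>
    have ig: "integrable lborel (\<lambda>\<xi>::'a. gauss (\<sigma> *\<^sub>R \<xi>))"
      using integrable_lborel_affine[OF gauss_integrable, of \<sigma> 0] \<sigma> by simp
    have km [measurable]: "k \<in> borel_measurable borel" unfolding k_def[abs_def] by measurable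
    have ik: "integrable lborel k"
    proof (rule Bochner_Integration.integrable_bound)
      show "integrable lborel (\<lambda>\<xi>::'a. (LINT x|lborel. norm (g x)) * gauss (\<sigma> *\<^sub>R \<xi>))"
        by (intro integrable_mult_right ig)
      show "AE \<xi> in lborel. norm (k \<xi>) \<le> norm ((LINT x|lborel. norm (g x)) * gauss (\<sigma> *\<^sub>R \<xi>))"
        unfolding k_def norm_mult 
        by (intro AE_I2 mult_mono) (auto intro: order_trans[OF norm_fourier_le])
    qed measurable
    have eq: "fourier g \<xi> * k \<xi> = of_real ((norm (fourier g \<xi>))\<^sup>2 * gauss (\<sigma> *\<^sub>R \<xi>))" for \<xi>
      unfolding k_def by (simp add: complex_norm_square[symmetric] mult.assoc[symmetric])
    have fk: "norm (fourier k x) \<le> (LINT y|lborel. norm (g y) * G (y - x))" for x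
    proof -
      have "fourier k x = cnj (LINT \<xi>|lborel. fourier g \<xi> * (exp (\<i> * of_real (\<xi> \<bullet> x)) * of_real (gauss (\<sigma> *\<^sub>R \<xi>))))"
        unfolding fourier_def[of k] Bochner_Integration.integral_cnj[symmetric] k_def
        by (intro Bochner_Integration.integral_cong) (auto simp: exp_cnj inner_commute)
      also have "(LINT \<xi>|lborel. fourier g \<xi> * (exp (\<i> * of_real (\<xi> \<bullet> x)) * of_real (gauss (\<sigma> *\<^sub>R \<xi>))))
          = (LINT y|lborel. g y * of_real (G (y - x)))"
      proof -
        have "integrable lborel (\<lambda>\<xi>. exp (\<i> * of_real (\<xi> \<bullet> x)) * complex_of_real (gauss (\<sigma> *\<^sub>R \<xi>)))"
          by (intro integrable_exp_mult integrable_of_real ig)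
        then show ?thesis
          by (subst fourier_multiplication_formula[OF g]) (simp_all add: fourier_modulate G_def fourier_gauss_scaled[OF \<sigma>])
      qed
      finally have "norm (fourier k x) \<le> (LINT y|lborel. norm (g y * of_real (G (y - x))))"
        by (simp only: complex_mod_cnj integral_norm_bound)
      then show ?thesis using Gpos by (simp add: norm_mult)
    qed
    have iw: "integrable lborel (\<lambda>\<xi>. (norm (fourier g \<xi>))\<^sup>2 * gauss (\<sigma> *\<^sub>R \<xi>))"
    proof (rule Bochner_Integration.integrable_bound)
      show "integrable lborel (\<lambda>\<xi>::'a. (LINT x|lborel. norm (g x))\<^sup>2 * gauss (\<sigma> *\<^sub>R \<xi>))"
        by (intro integrable_mult_right ig)
      show "AE \<xi> in lborel. norm ((norm (fourier g \<xi>))\<^sup>2 * gauss (\<sigma> *\<^sub>R \<xi>))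
          \<le> norm ((LINT x|lborel. norm (g x))\<^sup>2 * gauss (\<sigma> *\<^sub>R \<xi>))"
        unfolding norm_mult norm_power 
        by (intro AE_I2 mult_mono power_mono) (auto intro: order_trans[OF norm_fourier_le])
    qed measurable
    have "(\<integral>\<^sup>+\<xi>. ennreal ((norm (fourier g \<xi>))\<^sup>2 * gauss (\<sigma> *\<^sub>R \<xi>)) \<partial>lborel)
        = ennreal (LINT \<xi>|lborel. (norm (fourier g \<xi>))\<^sup>2 * gauss (\<sigma> *\<^sub>R \<xi>))"
      by (intro nn_integral_eq_integral iw) auto
    also have "(LINT \<xi>|lborel. (norm (fourier g \<xi>))\<^sup>2 * gauss (\<sigma> *\<^sub>R \<xi>))
        = norm (LINT \<xi>|lborel. fourier g \<xi> * k \<xi>)"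
      unfolding eq integral_complex_of_real norm_of_real 
      by (intro abs_of_nonneg[symmetric] integral_nonneg_AE) auto
    also have "\<dots> = norm (LINT x|lborel. g x * fourier k x)"
      by (simp add: fourier_multiplication_formula[OF g ik])
    also have "ennreal \<dots> \<le> (\<integral>\<^sup>+x. ennreal (norm (g x * fourier k x)) \<partial>lborel)"
    proof (rule integral_norm_bound_ennreal)
      show "integrable lborel (\<lambda>x. g x * fourier k x)"
        by (rule Bochner_Integration.integrable_bound[OF integrable_mult_left[OF g, of "of_real (LINT x|lborel. norm (k x))"]])
          (auto simp: norm_mult intro!: mult_left_mono order_trans[OF norm_fourier_le])
    qed
    also have "\<dots> \<le> (\<integral>\<^sup>+x. \<integral>\<^sup>+y. ennreal (norm (g x) * (norm (g y) * G (y - x))) \<partial>lborel \<partial>lborel)"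
    proof (rule nn_integral_mono)
      fix x
      have Gb: "G z \<le> (1 / \<sigma>) ^ DIM('a) * sqrt (2 * pi) ^ DIM('a)" for z
        unfolding G_def using \<sigma> gauss_le_1[of "(1 / \<sigma>) *\<^sub>R z"] by (simp add: mult_left_le)
      have "integrable lborel (\<lambda>y. norm (g y) * G (y - x))"
        by (rule Bochner_Integration.integrable_bound[OF integrable_mult_left[OF integrable_norm[OF g], of "(1 / \<sigma>) ^ DIM('a) * sqrt (2 * pi) ^ DIM('a)"]])
          (use Gpos Gb \<sigma> in \<open>auto simp: abs_mult intro!: mult_left_mono\<close>)
      then have "(\<integral>\<^sup>+y. ennreal (norm (g x) * (norm (g y) * G (y - x))) \<partial>lborel)
          = ennreal (LINT y|lborel. norm (g x) * (norm (g y) * G (y - x)))"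
        using Gpos by (intro nn_integral_eq_integral integrable_mult_right) auto
      then show "ennreal (norm (g x * fourier k x)) \<le> (\<integral>\<^sup>+y. ennreal (norm (g x) * (norm (g y) * G (y - x))) \<partial>lborel)"
        by (auto simp: norm_mult intro!: ennreal_leI mult_left_mono fk)
    qed
    also have "\<dots> \<le> (\<integral>\<^sup>+x. \<integral>\<^sup>+y. (ennreal ((norm (g x))\<^sup>2 / 2) * ennreal (G (y - x))
        + ennreal ((norm (g y))\<^sup>2 / 2) * ennreal (G (y - x))) \<partial>lborel \<partial>lborel)"
    proof (intro nn_integral_mono)
      fix x y
      have "0 \<le> (norm (g x) - norm (g y))\<^sup>2" by simp
      then have "norm (g x) * norm (g y) \<le> (norm (g x))\<^sup>2 / 2 + (norm (g y))\<^sup>2 / 2"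
        by (simp add: power2_eq_square algebra_simps)
      then have "norm (g x) * norm (g y) * G (y - x) \<le> ((norm (g x))\<^sup>2 / 2 + (norm (g y))\<^sup>2 / 2) * G (y - x)"
        by (rule mult_right_mono[OF _ Gpos])
      then show "ennreal (norm (g x) * (norm (g y) * G (y - x))) \<le> ennreal ((norm (g x))\<^sup>2 / 2) * ennreal (G (y - x))
        + ennreal ((norm (g y))\<^sup>2 / 2) * ennreal (G (y - x))"
        using Gpos by (simp add: ennreal_mult[symmetric] ennreal_plus[symmetric] distrib_right mult.assoc ennreal_leI del: ennreal_plus)
    qed
    also have "\<dots> = (\<integral>\<^sup>+x. \<integral>\<^sup>+y. ennreal ((norm (g x))\<^sup>2 / 2) * ennreal (G (y - x)) \<partial>lborel \<partial>lborel)
        + (\<integral>\<^sup>+x. \<integral>\<^sup>+y. ennreal ((norm (g y))\<^sup>2 / 2) * ennreal (G (y - x)) \<partial>lborel \<partial>lborel)"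
      by (subst nn_integral_add[symmetric], measurable, intro nn_integral_cong nn_integral_add) measurable
    also have "(\<integral>\<^sup>+x. \<integral>\<^sup>+y. ennreal ((norm (g y))\<^sup>2 / 2) * ennreal (G (y - x)) \<partial>lborel \<partial>lborel)
        = (\<integral>\<^sup>+y. \<integral>\<^sup>+x. ennreal ((norm (g y))\<^sup>2 / 2) * ennreal (G (y - x)) \<partial>lborel \<partial>lborel)"
      by (rule lborel_pair.Fubini') measurable
    also have "(\<integral>\<^sup>+x. \<integral>\<^sup>+y. ennreal ((norm (g x))\<^sup>2 / 2) * ennreal (G (y - x)) \<partial>lborel \<partial>lborel)
        = (\<integral>\<^sup>+x. ennreal ((norm (g x))\<^sup>2 / 2) * ennreal ((2 * pi) ^ DIM('a)) \<partial>lborel)"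
      using Gint[of "- x" for x] by (simp add: nn_integral_cmult)
    also have "(\<integral>\<^sup>+y. \<integral>\<^sup>+x. ennreal ((norm (g y))\<^sup>2 / 2) * ennreal (G (y - x)) \<partial>lborel \<partial>lborel)
        = (\<integral>\<^sup>+x. ennreal ((norm (g x))\<^sup>2 / 2) * ennreal ((2 * pi) ^ DIM('a)) \<partial>lborel)"
    proof (rule nn_integral_cong)
      fix y
      have Gsym: "G (y - x) = G (x + - y)" for x
        unfolding G_def gauss_def by (simp add: norm_minus_commute)
      show "(\<integral>\<^sup>+x. ennreal ((norm (g y))\<^sup>2 / 2) * ennreal (G (y - x)) \<partial>lborel)
        = ennreal ((norm (g y))\<^sup>2 / 2) * ennreal ((2 * pi) ^ DIM('a))"
        unfolding Gsym by (subst nn_integral_cmult) (auto simp: Gint simp del: add_uminus_conv_diff)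
    qed
    also have "(\<integral>\<^sup>+x. ennreal ((norm (g x))\<^sup>2 / 2) * ennreal ((2 * pi) ^ DIM('a)) \<partial>lborel)
        + (\<integral>\<^sup>+x. ennreal ((norm (g x))\<^sup>2 / 2) * ennreal ((2 * pi) ^ DIM('a)) \<partial>lborel)
        = (\<integral>\<^sup>+x. ennreal ((2 * pi) ^ DIM('a)) * ennreal ((norm (g x))\<^sup>2) \<partial>lborel)"
      by (subst nn_integral_add[symmetric])
        (auto intro!: nn_integral_cong simp: ennreal_mult[symmetric] ennreal_plus[symmetric] simp del: ennreal_plus)
    also have "\<dots> = ?R" by (rule nn_integral_cmult) measurable
    finally show ?thesis .
  qed
  \<comment> \<open>The bound is independent of \<sigma>, so Fatou's lemma along \<sigma> = 1 / (n +
    1) removes the weight. The right side may be infinite, since \<open>g\<close> is only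
    integrable.\<close>
  let ?u = "\<lambda>n \<xi>. ennreal ((norm (fourier g \<xi>))\<^sup>2 * gauss ((1 / real (Suc n)) *\<^sub>R \<xi>))"
  have "(\<integral>\<^sup>+\<xi>. ennreal ((norm (fourier g \<xi>))\<^sup>2) \<partial>lborel) = (\<integral>\<^sup>+\<xi>. liminf (\<lambda>n. ?u n \<xi>) \<partial>lborel)"
  proof (rule nn_integral_cong)
    fix \<xi>
    have "(\<lambda>n. ?u n \<xi>) \<longlonglongrightarrow> ennreal ((norm (fourier g \<xi>))\<^sup>2 * 1)"
      by (intro tendsto_ennrealI tendsto_mult tendsto_const gauss_scaled_tendsto)
    from lim_imp_Liminf[OF _ this]
    show "ennreal ((norm (fourier g \<xi>))\<^sup>2) = liminf (\<lambda>n. ?u n \<xi>)"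
      by simp
  qed
  also have "\<dots> \<le> liminf (\<lambda>n. \<integral>\<^sup>+\<xi>. ?u n \<xi> \<partial>lborel)"
    by (rule nn_integral_liminf) measurable
  also have "\<dots> \<le> liminf (\<lambda>n. ?R)"
    by (intro Liminf_mono always_eventually allI weighted) simp
  finally show ?thesis by (simp add: Liminf_const)
qed

text \<open>With c = (2 * pi)^d the normalisation contributes 1 / c^2 and Plancherel c. The
  remaining factor 1 / c is at most 1 and is dropped.\<close>

lemma inv_fourier_L2_le:
  fixes g :: "'a::euclidean_space \<Rightarrow> complex"
  assumes g: "integrable lborel g"
  shows "(\<integral>\<^sup>+x. ennreal ((norm (inv_fourier g x))\<^sup>2) \<partial>lborel)
    \<le> (\<integral>\<^sup>+\<xi>. ennreal ((norm (g \<xi>))\<^sup>2) \<partial>lborel)"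
proof -
  have [measurable]: "g \<in> borel_measurable borel"
    using g by (auto dest: borel_measurable_integrable)
  define c where "c = (2 * pi) ^ DIM('a)"
  have e: "inv_fourier g x = fourier g (- x) / of_real c" for x
    unfolding c_def by (rule inv_fourier_eq_fourier)
  have c: "1 \<le> c" unfolding c_def using pi_ge_two by (intro one_le_power) linarith
  have "(\<integral>\<^sup>+x. ennreal ((norm (inv_fourier g x))\<^sup>2) \<partial>lborel)
      = (\<integral>\<^sup>+x. ennreal (1 / c\<^sup>2) * ennreal ((norm (fourier g (- x)))\<^sup>2) \<partial>lborel)"
    by (intro nn_integral_cong)
      (use c in \<open>simp add: e norm_divide power_divide ennreal_mult[symmetric]\<close>)
  also have "\<dots> = ennreal (1 / c\<^sup>2) * (\<integral>\<^sup>+x. ennreal ((norm (fourier g (- x)))\<^sup>2) \<partial>lborel)"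
    by (rule nn_integral_cmult) measurable
  also have "(\<integral>\<^sup>+x. ennreal ((norm (fourier g (- x)))\<^sup>2) \<partial>lborel) = (\<integral>\<^sup>+x. ennreal ((norm (fourier g x))\<^sup>2) \<partial>lborel)"
    by (subst nn_integral_lborel_affine[where c="-1" and a=0 and f="\<lambda>x. ennreal ((norm (fourier g x))\<^sup>2)"]) auto
  also have "ennreal (1 / c\<^sup>2) * \<dots> \<le> ennreal (1 / c\<^sup>2) * (ennreal c * (\<integral>\<^sup>+\<xi>. ennreal ((norm (g \<xi>))\<^sup>2) \<partial>lborel))"
    unfolding c_def by (intro mult_left_mono fourier_L2_le g) auto
  also have "\<dots> = ennreal (1 / c) * (\<integral>\<^sup>+\<xi>. ennreal ((norm (g \<xi>))\<^sup>2) \<partial>lborel)"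
    using c by (simp add: mult.assoc[symmetric] ennreal_mult[symmetric] power2_eq_square)
  also have "\<dots> \<le> 1 * (\<integral>\<^sup>+\<xi>. ennreal ((norm (g \<xi>))\<^sup>2) \<partial>lborel)"
    using c by (intro mult_right_mono) auto
  finally show ?thesis by simp
qed

text \<open>The inversion integral with a Gaussian weight is computed twice. As the weight tends to
  1 it becomes the unweighted integral; by the multiplication formula it is also an average of
  \<phi> around x against a shrinking Gaussian, which tends to a multiple of \<phi> x.\<close>

lemma inv_fourier_fourier:
  fixes \<phi> :: "'a::euclidean_space \<Rightarrow> complex"
  assumes s: "\<phi> \<in> schwartz"
  shows "inv_fourier (fourier \<phi>) x = \<phi> x"
proof -
  note [measurable] = schwartz_measurable[OF s]
  note sf = fourier_schwartz[OF s]
  note isf = schwartz_integrable[OF sf]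
  define \<sigma> where "\<sigma> n = 1 / real (Suc n)" for n
  have \<sigma>: "\<sigma> n > 0" for n by (simp add: \<sigma>_def)
  have \<sigma>0: "\<sigma> \<longlonglongrightarrow> 0" unfolding \<sigma>_def by (rule LIMSEQ_Suc[OF lim_1_over_n])
  define I where "I n = (LINT \<xi>|lborel. fourier \<phi> \<xi> * (exp (\<i> * of_real (\<xi> \<bullet> x)) * of_real (gauss (\<sigma> n *\<^sub>R \<xi>))))" for n
  have "I \<longlonglongrightarrow> (LINT \<xi>|lborel. fourier \<phi> \<xi> * (exp (\<i> * of_real (\<xi> \<bullet> x)) * of_real 1))"
    unfolding I_def
  proof (rule integral_dominated_convergence[where w="\<lambda>\<xi>. norm (fourier \<phi> \<xi>)"])
    show "AE \<xi> in lborel. (\<lambda>n. fourier \<phi> \<xi> * (exp (\<i> * of_real (\<xi> \<bullet> x)) * of_real (gauss (\<sigma> n *\<^sub>R \<xi>))))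
        \<longlonglongrightarrow> fourier \<phi> \<xi> * (exp (\<i> * of_real (\<xi> \<bullet> x)) * of_real 1)"
      unfolding \<sigma>_def by (intro AE_I2 tendsto_intros gauss_scaled_tendsto)
    show "AE \<xi> in lborel. norm (fourier \<phi> \<xi> * (exp (\<i> * of_real (\<xi> \<bullet> x)) * of_real (gauss (\<sigma> n *\<^sub>R \<xi>)))) \<le> norm (fourier \<phi> \<xi>)" for n
      by (intro AE_I2) (simp add: norm_mult mult_left_le gauss_le_1)
  qed (use isf in auto)
  moreover have "I n = (LINT z|lborel. \<phi> (\<sigma> n *\<^sub>R z + x) * of_real (sqrt (2 * pi) ^ DIM('a) * gauss z))" for n
  proof -
    have ig: "integrable lborel (\<lambda>\<xi>::'a. gauss (\<sigma> n *\<^sub>R \<xi>))"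
      using integrable_lborel_affine[OF gauss_integrable, of "\<sigma> n" 0] \<sigma>[of n] by simp
    have "integrable lborel (\<lambda>\<xi>. exp (\<i> * of_real (\<xi> \<bullet> x)) * complex_of_real (gauss (\<sigma> n *\<^sub>R \<xi>)))"
      by (intro integrable_exp_mult integrable_of_real ig)
    then have "I n = (LINT y|lborel. \<phi> y * of_real ((1 / \<sigma> n) ^ DIM('a) * sqrt (2 * pi) ^ DIM('a) * gauss ((1 / \<sigma> n) *\<^sub>R (y - x))))"
      unfolding I_def
      by (subst fourier_multiplication_formula[OF schwartz_integrable[OF s]])
        (simp_all add: fourier_modulate fourier_gauss_scaled[OF \<sigma>])
    also have "\<dots> = \<sigma> n ^ DIM('a) *\<^sub>R (LINT z|lborel. \<phi> (\<sigma> n *\<^sub>R z + x)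
        * of_real ((1 / \<sigma> n) ^ DIM('a) * sqrt (2 * pi) ^ DIM('a) * gauss ((1 / \<sigma> n) *\<^sub>R ((\<sigma> n *\<^sub>R z + x) - x))))"
      using \<sigma>[of n] by (subst integral_lborel_affine[where c="\<sigma> n" and a=x]) auto
    also have "\<dots> = (LINT z|lborel. \<phi> (\<sigma> n *\<^sub>R z + x) * of_real (sqrt (2 * pi) ^ DIM('a) * gauss z))"
      using \<sigma>[of n] by (subst integral_scaleR_right[symmetric])
        (intro Bochner_Integration.integral_cong, auto simp: scaleR_conv_of_real power_divide)
    finally show ?thesis .
  qed
  moreover have "(\<lambda>n. LINT z|lborel. \<phi> (\<sigma> n *\<^sub>R z + x) * of_real (sqrt (2 * pi) ^ DIM('a) * gauss z))
      \<longlonglongrightarrow> (LINT z|lborel. \<phi> (0 *\<^sub>R z + x) * of_real (sqrt (2 * pi) ^ DIM('a) * gauss (z::'a)))"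
  proof -
    obtain C where C: "C > 0" "\<And>x. norm (\<phi> x) \<le> C" using schwartz_bounded[OF s] by blast
    show ?thesis
    proof (rule integral_dominated_convergence[where w="\<lambda>z. C * (sqrt (2 * pi) ^ DIM('a) * gauss z)"])
      show "integrable lborel (\<lambda>z::'a. C * (sqrt (2 * pi) ^ DIM('a) * gauss z))"
        by (intro integrable_mult_right gauss_integrable)
      have "isCont \<phi> y" for y
        using schwartz_continuous[OF s] by (simp add: continuous_on_eq_continuous_at)
      then show "AE z in lborel. (\<lambda>n. \<phi> (\<sigma> n *\<^sub>R z + x) * of_real (sqrt (2 * pi) ^ DIM('a) * gauss z))
          \<longlonglongrightarrow> \<phi> (0 *\<^sub>R z + x) * of_real (sqrt (2 * pi) ^ DIM('a) * gauss z)"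
        by (intro AE_I2 tendsto_mult tendsto_const isCont_tendsto_compose[of _ \<phi>] tendsto_add tendsto_scaleR \<sigma>0)
      show "AE z in lborel. norm (\<phi> (\<sigma> n *\<^sub>R z + x) * of_real (sqrt (2 * pi) ^ DIM('a) * gauss z))
          \<le> C * (sqrt (2 * pi) ^ DIM('a) * gauss z)" for n
        using C
        by (intro AE_I2) (auto simp: norm_mult norm_power intro!: mult_mono)
    qed measurable
  qed
  ultimately have "(LINT \<xi>|lborel. fourier \<phi> \<xi> * (exp (\<i> * of_real (\<xi> \<bullet> x)) * of_real 1))
      = (LINT z|lborel. \<phi> (0 *\<^sub>R z + x) * of_real (sqrt (2 * pi) ^ DIM('a) * gauss (z::'a)))"
    using LIMSEQ_unique by (metis (no_types, lifting) ext)
  also have "\<dots> = \<phi> x * of_real ((2 * pi) ^ DIM('a))"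
  proof -
    have "(LINT z|lborel. \<phi> (0 *\<^sub>R z + x) * of_real (sqrt (2 * pi) ^ DIM('a) * gauss (z::'a)))
        = \<phi> x * of_real (sqrt (2 * pi) ^ DIM('a) * (LINT z|lborel. gauss (z::'a)))"
      by (simp only: scaleR_zero_left add_0 integral_mult_right_zero integral_complex_of_real)
    then show ?thesis by (simp only: integral_gauss sqrt_two_pi_power)
  qed
  finally show ?thesis
    unfolding inv_fourier_def by (simp add: inner_commute mult.commute)
qed

lemma fourier_inv_fourier:
  fixes \<phi> :: "'a::euclidean_space \<Rightarrow> complex"
  assumes s: "\<phi> \<in> schwartz"
  shows "fourier (inv_fourier \<phi>) = \<phi>"
proof
  fix \<xi>
  note [measurable] = schwartz_measurable[OF s]
  have "fourier (inv_fourier \<phi>) \<xi> = fourier (\<lambda>x. inv_fourier \<phi> (- x)) (- \<xi>)"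
    using fourier_affine[of "inv_fourier \<phi>" "-1" \<xi> 0] by simp
  also have "\<dots> = inv_fourier (fourier \<phi>) \<xi>"
    unfolding inv_fourier_eq_fourier fourier_def[of "\<lambda>x. fourier \<phi> (- (- x)) / _"] by (simp add: fourier_def[of "fourier \<phi>"])
  finally show "fourier (inv_fourier \<phi>) \<xi> = \<phi> \<xi>" by (simp add: inv_fourier_fourier[OF s])
qed

subsection \<open>Square integrability by duality\<close>

lemma cauchy_schwarz_norm_integral:
  fixes u v :: "'a \<Rightarrow> complex"
  assumes [measurable]: "u \<in> borel_measurable M" "v \<in> borel_measurable M"
  shows "ennreal ((norm (LINT x|M. u x * v x))\<^sup>2)
    \<le> (\<integral>\<^sup>+x. ennreal ((norm (u x))\<^sup>2) \<partial>M) * (\<integral>\<^sup>+x. ennreal ((norm (v x))\<^sup>2) \<partial>M)"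
proof (cases "integrable M (\<lambda>x. u x * v x)")
  case True
  have "ennreal ((norm (LINT x|M. u x * v x))\<^sup>2) = (ennreal (norm (LINT x|M. u x * v x)))\<^sup>2"
    by (simp add: ennreal_power)
  also have "\<dots> \<le> (\<integral>\<^sup>+x. ennreal (norm (u x * v x)) \<partial>M)\<^sup>2"
    by (intro power_mono integral_norm_bound_ennreal True) simp
  also have "\<dots> = (\<integral>\<^sup>+x. ennreal (norm (u x)) * ennreal (norm (v x)) \<partial>M)\<^sup>2"
    by (simp add: norm_mult ennreal_mult)
  also have "\<dots> \<le> (\<integral>\<^sup>+x. (ennreal (norm (u x)))\<^sup>2 \<partial>M) * (\<integral>\<^sup>+x. (ennreal (norm (v x)))\<^sup>2 \<partial>M)"
    by (rule Cauchy_Schwarz_nn_integral) measurable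
  finally show ?thesis by (simp add: ennreal_power)
\<comment> \<open>A non-integrable product has Bochner integral 0, so the left side
  vanishes.\<close>
qed (simp add: not_integrable_integral_eq)

lemma integrable_tensor:
  fixes h :: "'a::euclidean_space \<Rightarrow> real" and k :: "'b::euclidean_space \<Rightarrow> real"
  assumes h: "integrable lborel h" and k: "integrable lborel k"
  shows "integrable (lborel \<Otimes>\<^sub>M lborel) (\<lambda>(x, y). h x * k y)"
proof (rule lborel_pair.Fubini_integrable)
  have [measurable]: "h \<in> borel_measurable borel" "k \<in> borel_measurable borel"
    using h k by (auto dest: borel_measurable_integrable)
  show "(\<lambda>(x, y). h x * k y) \<in> borel_measurable (lborel \<Otimes>\<^sub>M lborel)" by measurable
qed (use h k in \<open>auto simp: abs_mult\<close>)

lemma cball_sets_borel [measurable]: "cball a r \<in> sets borel"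
  by simp

lemma integrable_indicator_cball:
  "integrable lborel (indicat_real (cball (a::'a::euclidean_space) r))"
  using emeasure_lborel_cball_finite[of a r] by (intro integrable_real_indicator) auto

locale cutoff =
  fixes \<eta> :: "'a::euclidean_space \<Rightarrow> real"
  assumes cutoff: "lp_cutoff \<eta>"
begin

lemma eta_smooth: "smooth \<eta>"
  and eta_nonneg [simp]: "0 \<le> \<eta> x" and eta_le_1 [simp]: "\<eta> x \<le> 1"
  and eta_eq_1: "norm x \<le> 1 \<Longrightarrow> \<eta> x = 1" and eta_eq_0: "2 \<le> norm x \<Longrightarrow> \<eta> x = 0"
  using cutoff unfolding lp_cutoff_def by blast+

lemma eta_schwartz: "(\<lambda>x. complex_of_real (\<eta> x)) \<in> schwartz"
  by (rule smooth_compact_support_schwartz[OF eta_smooth eta_eq_0])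

lemma eta_continuous: "continuous_on UNIV \<eta>"
  by (rule smooth_continuous[OF eta_smooth])

lemma eta_measurable [measurable]: "\<eta> \<in> borel_measurable borel"
  by (rule borel_measurable_continuous_onI[OF eta_continuous])

lemma eta_integrable: "integrable lborel \<eta>"
  using schwartz_integrable[OF eta_schwartz] complex_of_real_integrable_eq by blast

text \<open>The Littlewood-Paley cutoff also serves as a mollifier below. Its mass is left
  unnormalised and has to be cancelled at the end.\<close>

lemma eta_integral_pos: "0 < (LINT x|lborel. \<eta> x)"
proof -
  have "0 < measure lborel (cball (0::'a) 1)"
    using content_cball_pos[of 1 "0::'a"] by simp
  also have "\<dots> = (LINT x|lborel. indicator (cball (0::'a) 1) x)"
    by simp
  also have "\<dots> \<le> (LINT x|lborel. \<eta> x)"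
    by (intro integral_mono eta_integrable integrable_indicator_cball) (auto simp: indicator_def eta_eq_1)
  finally show ?thesis .
qed

end

text \<open>Here \<open>u\<close> is, up to a reflection and a constant, the Fourier transform of \<open>H\<close> in the sense of
  distributions. Testing against translates of the rescaled cutoff \<open>\<eta>\<close> turns this into a bound
  for the pairing of \<open>H\<close> with continuous functions of compact support.\<close>

locale fourier_dual = cutoff \<eta> for \<eta> :: "'a::euclidean_space \<Rightarrow> real" +
  fixes H u :: "'a \<Rightarrow> complex"
  assumes H_meas [measurable]: "H \<in> borel_measurable borel"
    and u_meas [measurable]: "u \<in> borel_measurable borel"
    and dual: "\<And>\<kappa> R. \<kappa> \<in> schwartz \<Longrightarrow> (\<And>x. R \<le> norm x \<Longrightarrow> \<kappa> x = 0) \<Longrightarrow>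
      integrable lborel (\<lambda>x. H x * \<kappa> x) \<and> integrable lborel (\<lambda>x. u x * fourier \<kappa> x)
      \<and> (LINT x|lborel. H x * \<kappa> x) = (LINT x|lborel. u x * fourier \<kappa> x)"
begin

text \<open>\<open>dual\<close> is tested with \<eta> stretched until it equals 1 on the
  ball.\<close>

lemma locally_integrable: "integrable lborel (\<lambda>x. indicator (cball 0 R) x * norm (H x))"
proof -
  define T where "T = \<bar>R\<bar> + 1"
  have T: "T > 0" "R \<le> T" unfolding T_def by auto
  define \<kappa> where "\<kappa> x = complex_of_real (\<eta> ((1 / T) *\<^sub>R x + 0))" for x
  have "integrable lborel (\<lambda>x. H x * \<kappa> x)"
  proof (rule dual[THEN conjunct1, of _ "2 * T"])
    show "\<kappa> \<in> schwartz" unfolding \<kappa>_def using T by (intro schwartz_affine[OF eta_schwartz]) auto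
    show "\<kappa> x = 0" if "2 * T \<le> norm x" for x
      unfolding \<kappa>_def using that T eta_eq_0[of "(1 / T) *\<^sub>R x + 0"] by (simp add: field_simps)
  qed
  then show ?thesis
  proof (rule Bochner_Integration.integrable_bound)
    show "AE x in lborel. norm (indicator (cball 0 R) x * norm (H x)) \<le> norm (H x * \<kappa> x)"
      unfolding \<kappa>_def using T eta_eq_1[of "(1 / T) *\<^sub>R x + 0" for x]
      by (intro AE_I2) (auto simp: indicator_def norm_mult field_simps)
  qed measurable
qed

lemma integrable_against_bounded:
  assumes [measurable]: "g \<in> borel_measurable borel"
    and g: "\<And>x. norm (g x) \<le> B" "\<And>x. R < norm x \<Longrightarrow> g x = 0"
  shows "integrable lborel (\<lambda>x. H x * g x)"
proof (rule Bochner_Integration.integrable_bound[OF integrable_mult_right[OF locally_integrable[of R], of B]])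
  have "B \<ge> 0" using g(1)[of 0] norm_ge_zero order_trans by blast
  show "AE x in lborel. norm (H x * g x) \<le> norm (B * (indicator (cball 0 R) x * norm (H x)))"
  proof (rule AE_I2)
    fix x
    show "norm (H x * g x) \<le> norm (B * (indicator (cball 0 R) x * norm (H x)))"
      using g[of x] \<open>B \<ge> 0\<close> by (cases "norm x \<le> R")
        (auto simp: norm_mult abs_mult mult.commute[of "norm (H x)"] mult_right_mono)
  qed
qed measurable

text \<open>\<open>g\<close> need not be smooth, so it is first mollified. The mollification is a
  superposition of translates of a Schwartz bump, to each of which \<open>dual\<close> applies;
  Fubini assembles the results into a pairing of \<open>fourier g\<close> with \<open>u\<close>
  times a factor bounded by the mass m. Cauchy-Schwarz and Plancherel for \<open>g\<close> give the
  bound, and the mollification converges to m times \<open>g\<close>.\<close>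

lemma pairing_continuous:
  assumes g: "continuous_on UNIV g" "\<And>x. R < norm x \<Longrightarrow> g x = 0"
  shows "ennreal ((norm (LINT x|lborel. H x * g x))\<^sup>2)
    \<le> ennreal ((2 * pi) ^ DIM('a)) * (\<integral>\<^sup>+x. ennreal ((norm (g x))\<^sup>2) \<partial>lborel) * (\<integral>\<^sup>+x. ennreal ((norm (u x))\<^sup>2) \<partial>lborel)"
    (is "_ \<le> ?Q")
proof -
  have gm [measurable]: "g \<in> borel_measurable borel"
    by (rule borel_measurable_continuous_onI[OF g(1)])
  have "compact (g ` cball 0 R)"
    by (intro compact_continuous_image continuous_on_subset[OF g(1)]) auto
  then obtain B0 where B0: "\<And>x. x \<in> cball 0 R \<Longrightarrow> norm (g x) \<le> B0"
    by (meson bounded_iff compact_imp_bounded imageI)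
  define B where "B = \<bar>B0\<bar>"
  have B: "norm (g x) \<le> B" for x
    using B0[of x] g(2)[of x] unfolding B_def by (cases "norm x \<le> R") auto
  have B0 [simp]: "0 \<le> B" unfolding B_def by simp
  have ig: "integrable lborel g"
  proof (rule Bochner_Integration.integrable_bound)
    show "integrable lborel (\<lambda>x::'a. B * indicator (cball 0 R) x)"
      by (intro integrable_mult_right integrable_indicator_cball)
    show "AE x in lborel. norm (g x) \<le> norm (B * indicator (cball 0 R) x)"
    proof (rule AE_I2)
      fix x show "norm (g x) \<le> norm (B * indicator (cball 0 R) x)"
        using B[of x] g(2)[of x] by (cases "norm x \<le> R") auto
    qed
  qed measurable
  define m where "m = (LINT x|lborel. \<eta> x)"
  have m: "m > 0" unfolding m_def by (rule eta_integral_pos)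
  define t where "t n = real (Suc n)" for n
  have t: "t n \<ge> 1" for n unfolding t_def by simp
  \<comment> \<open>Scaled to keep the mass m for every n. The support stays in the ball of radius 2
    because t n >= 1, which gives a dominating function on a fixed ball.\<close>
  define \<rho> where "\<rho> n x = t n ^ DIM('a) * \<eta> (t n *\<^sub>R x)" for n x
  have [measurable]: "\<rho> n \<in> borel_measurable borel" for n unfolding \<rho>_def by measurable
  have \<rho>_nonneg: "0 \<le> \<rho> n x" and \<rho>_le: "\<rho> n x \<le> t n ^ DIM('a)" for n x
    unfolding \<rho>_def using t[of n] by (auto simp: mult_left_le)
  have \<rho>_0: "\<rho> n x = 0" if "2 \<le> norm x" for n x
  proof -
    have "2 \<le> t n * norm x" using t[of n] that mult_mono[of 1 "t n" 2 "norm x"] by simp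
    then show ?thesis unfolding \<rho>_def using t[of n] by (simp add: eta_eq_0)
  qed
  define E where "E n = fourier (\<lambda>x. complex_of_real (\<rho> n x))" for n
  have s\<rho>: "(\<lambda>x. complex_of_real (\<rho> n (x - y))) \<in> schwartz" for n y
  proof -
    have "(\<lambda>x. of_real (t n ^ DIM('a)) * complex_of_real (\<eta> (t n *\<^sub>R x + (- t n *\<^sub>R y)))) \<in> schwartz"
      using t[of n] by (intro schwartz_scale schwartz_affine[OF eta_schwartz]) auto
    then show ?thesis
      by (rule back_subst[of "\<lambda>f. f \<in> schwartz"]) (auto simp: \<rho>_def scaleR_diff_right)
  qed
  have \<rho>_shift_0: "complex_of_real (\<rho> n (x - y)) = 0" if "norm y + 2 \<le> norm x" for n x y
  proof -
    have "2 \<le> norm (x - y)" using that norm_triangle_ineq2[of x y] by linarith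
    then show ?thesis by (simp add: \<rho>_0)
  qed
  have E_shift: "fourier (\<lambda>x. complex_of_real (\<rho> n (x - y))) z = exp (- (\<i> * of_real (y \<bullet> z))) * E n z" for n y z
    using fourier_translate[of "\<lambda>x. complex_of_real (\<rho> n x)" "- y" z] by (simp add: E_def)
  have \<rho>_int: "(LINT x|lborel. \<rho> n x) = m" for n
    unfolding m_def \<rho>_def using t[of n] integral_lborel_affine[of \<eta> "t n" 0] by simp
  have E_le: "norm (E n z) \<le> m" for n z
    unfolding E_def using norm_fourier_le[of "\<lambda>x. complex_of_real (\<rho> n x)" z] \<rho>_nonneg \<rho>_int by simp
  have [measurable]: "E n \<in> borel_measurable borel" for n unfolding E_def by measurable
  \<comment> \<open>Integrability is available for \<open>u\<close> only after multiplication with a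
    transform from \<open>dual\<close>; the product with \<open>E n\<close> is what the
    multiplication formula is applied to.\<close>
  have uE: "integrable lborel (\<lambda>z. u z * E n z)" for n
    using dual[OF s\<rho>[of n 0], of 2] \<rho>_shift_0[of 0 _ n] by (simp add: E_def)
  define I where "I n = (LINT x|lborel. H x * (LINT y|lborel. g y * of_real (\<rho> n (x - y))))" for n
  have I_eq: "I n = (LINT z|lborel. fourier g z * (u z * E n z))" for n
  proof -
    have F: "integrable (lborel \<Otimes>\<^sub>M lborel) (\<lambda>(y, x). H x * (g y * of_real (\<rho> n (x - y))))"
    proof (rule Bochner_Integration.integrable_bound)
      show "integrable (lborel \<Otimes>\<^sub>M lborel) (\<lambda>(y, x). (t n ^ DIM('a) * norm (g y)) * (indicator (cball 0 (R + 2)) x * norm (H x)))"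
        by (intro integrable_tensor integrable_mult_right integrable_norm ig locally_integrable)
      show "AE p in lborel \<Otimes>\<^sub>M lborel. norm (case p of (y, x) \<Rightarrow> H x * (g y * of_real (\<rho> n (x - y))))
        \<le> norm (case p of (y, x) \<Rightarrow> (t n ^ DIM('a) * norm (g y)) * (indicator (cball 0 (R + 2)) x * norm (H x)))"
      proof (rule AE_I2, clarify)
        fix y x
        show "norm (H x * (g y * of_real (\<rho> n (x - y))))
          \<le> norm ((t n ^ DIM('a) * norm (g y)) * (indicator (cball 0 (R + 2)) x * norm (H x)))"
        proof (cases "R < norm y \<or> norm y + 2 \<le> norm x")
          case True
          then show ?thesis using g(2)[of y] \<rho>_shift_0[of y x n] by auto
        next
          case False
          then have "norm x \<le> R + 2" by linarith
          then show ?thesis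
            using \<rho>_nonneg[of n "x - y"] \<rho>_le[of n "x - y"] t[of n]
            by (simp add: norm_mult abs_mult mult_right_mono mult.assoc[symmetric] mult.commute[of "norm (H x)"])
              (simp add: mult.commute[of _ "\<rho> n (x - y)"] mult_right_mono mult.assoc)
        qed
      qed
    qed measurable
    have "I n = (LINT x|lborel. LINT y|lborel. H x * (g y * of_real (\<rho> n (x - y))))"
      unfolding I_def by simp
    also have "\<dots> = (LINT y|lborel. LINT x|lborel. H x * (g y * of_real (\<rho> n (x - y))))"
      using lborel_pair.Fubini_integral[OF F] by simp
    also have "\<dots> = (LINT y|lborel. g y * (LINT x|lborel. H x * of_real (\<rho> n (x - y))))"
      by (subst integral_mult_right_zero[symmetric]) (simp add: mult_ac)
    also have "\<dots> = (LINT y|lborel. g y * fourier (\<lambda>z. u z * E n z) y)"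
    proof -
      have "(LINT x|lborel. H x * of_real (\<rho> n (x - y))) = (LINT z|lborel. u z * (exp (- (\<i> * of_real (y \<bullet> z))) * E n z))" for y
        using dual[OF s\<rho>[of n y] \<rho>_shift_0[of y _ n]] by (simp add: E_shift)
      also have "\<dots> y = fourier (\<lambda>z. u z * E n z) y" for y
        unfolding fourier_def by (intro Bochner_Integration.integral_cong) (auto simp: inner_commute mult_ac)
      finally show ?thesis by simp
    qed
    also have "\<dots> = (LINT z|lborel. fourier g z * (u z * E n z))"
      by (rule fourier_multiplication_formula[OF ig uE, symmetric])
    finally show ?thesis .
  qed
  have I_le: "ennreal ((norm (I n))\<^sup>2) \<le> ennreal (m\<^sup>2) * ?Q" for n
  proof -
    have "ennreal ((norm (I n))\<^sup>2) \<le> (\<integral>\<^sup>+z. ennreal ((norm (fourier g z))\<^sup>2) \<partial>lborel)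
        * (\<integral>\<^sup>+z. ennreal ((norm (u z * E n z))\<^sup>2) \<partial>lborel)"
      unfolding I_eq by (rule cauchy_schwarz_norm_integral) measurable
    also have "\<dots> \<le> (ennreal ((2 * pi) ^ DIM('a)) * (\<integral>\<^sup>+x. ennreal ((norm (g x))\<^sup>2) \<partial>lborel))
        * (\<integral>\<^sup>+z. ennreal (m\<^sup>2) * ennreal ((norm (u z))\<^sup>2) \<partial>lborel)"
    proof (intro mult_mono fourier_L2_le ig nn_integral_mono)
      fix z
      show "ennreal ((norm (u z * E n z))\<^sup>2) \<le> ennreal (m\<^sup>2) * ennreal ((norm (u z))\<^sup>2)"
        using m power_mono[OF E_le norm_ge_zero, of n z 2]
        by (simp add: norm_mult power_mult_distrib ennreal_mult[symmetric] mult.commute[of "(norm (u z))\<^sup>2"] mult_right_mono ennreal_leI)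
    qed auto
    also have "\<dots> = ennreal (m\<^sup>2) * ?Q"
      by (subst nn_integral_cmult) (auto simp: mult_ac)
    finally show ?thesis .
  qed
  have conv: "(LINT y|lborel. g y * of_real (\<rho> n (x - y))) = (LINT z|lborel. g (x - (1 / t n) *\<^sub>R z) * of_real (\<eta> z))" for n x
  proof -
    have "(LINT y|lborel. g y * of_real (\<rho> n (x - y)))
        = \<bar>- (1 / t n)\<bar> ^ DIM('a) *\<^sub>R (LINT z|lborel. g (- (1 / t n) *\<^sub>R z + x) * of_real (\<rho> n (x - (- (1 / t n) *\<^sub>R z + x))))"
      using t[of n] by (intro integral_lborel_affine) auto
    also have "\<dots> = (LINT z|lborel. g (x - (1 / t n) *\<^sub>R z) * of_real (\<eta> z))"
      using t[of n] by (subst integral_scaleR_right[symmetric], intro Bochner_Integration.integral_cong)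
        (auto simp: \<rho>_def scaleR_conv_of_real power_divide)
    finally show ?thesis .
  qed
  have conv_le: "norm (LINT y|lborel. g y * of_real (\<rho> n (x - y))) \<le> B * m * indicator (cball 0 (R + 2)) x" for n x
  proof (cases "norm x \<le> R + 2")
    case True
    have "norm (LINT y|lborel. g y * of_real (\<rho> n (x - y))) \<le> (LINT z|lborel. norm (g (x - (1 / t n) *\<^sub>R z) * of_real (\<eta> z)))"
      unfolding conv by (rule integral_norm_bound)
    also have "\<dots> \<le> (LINT z|lborel. B * \<eta> z)"
    proof (rule integral_mono')
      show "integrable lborel (\<lambda>z. B * \<eta> z)" by (intro integrable_mult_right eta_integrable)
    qed (auto simp: norm_mult B mult_right_mono)
    finally show ?thesis using True by (simp add: m_def)
  next
    case False
    have "g y * of_real (\<rho> n (x - y)) = 0" for y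
      using False g(2)[of y] \<rho>_shift_0[of y x n] by (cases "R < norm y") auto
    then have "(LINT y|lborel. g y * of_real (\<rho> n (x - y))) = 0"
      by (simp only: integral_zero)
    then show ?thesis using False by simp
  qed
  have tlim: "(\<lambda>n. 1 / t n) \<longlonglongrightarrow> 0" unfolding t_def by (rule LIMSEQ_Suc[OF lim_1_over_n])
  have conv_lim: "(\<lambda>n. LINT y|lborel. g y * of_real (\<rho> n (x - y))) \<longlonglongrightarrow> of_real m * g x" for x
  proof -
    have "(\<lambda>n. LINT z|lborel. g (x - (1 / t n) *\<^sub>R z) * of_real (\<eta> z)) \<longlonglongrightarrow> (LINT z|lborel. g (x - 0 *\<^sub>R z) * of_real (\<eta> z))"
    proof (rule integral_dominated_convergence[where w="\<lambda>z. B * \<eta> z"])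
      show "integrable lborel (\<lambda>z. B * \<eta> z)" by (intro integrable_mult_right eta_integrable)
      have "isCont g y" for y
        using g(1) by (simp add: continuous_on_eq_continuous_at)
      then show "AE z in lborel. (\<lambda>n. g (x - (1 / t n) *\<^sub>R z) * of_real (\<eta> z)) \<longlonglongrightarrow> g (x - 0 *\<^sub>R z) * of_real (\<eta> z)"
        by (intro AE_I2 tendsto_mult tendsto_const isCont_tendsto_compose[of _ g] tendsto_diff tendsto_scaleR tlim)
    qed (auto simp: norm_mult B mult_right_mono)
    also have "(LINT z|lborel. g (x - 0 *\<^sub>R z) * of_real (\<eta> z)) = of_real m * g x"
      unfolding m_def by simp
    finally show ?thesis unfolding conv .
  qed
  have "I \<longlonglongrightarrow> (LINT x|lborel. H x * (of_real m * g x))"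
    unfolding I_def
  proof (rule integral_dominated_convergence[where w="\<lambda>x. B * m * (indicator (cball 0 (R + 2)) x * norm (H x))"])
    show "integrable lborel (\<lambda>x. B * m * (indicator (cball 0 (R + 2)) x * norm (H x)))"
      by (intro integrable_mult_right locally_integrable)
    show "AE x in lborel. (\<lambda>n. H x * (LINT y|lborel. g y * of_real (\<rho> n (x - y)))) \<longlonglongrightarrow> H x * (of_real m * g x)"
      by (intro AE_I2 tendsto_mult tendsto_const conv_lim)
    show "AE x in lborel. norm (H x * (LINT y|lborel. g y * of_real (\<rho> n (x - y))))
        \<le> B * m * (indicator (cball 0 (R + 2)) x * norm (H x))" for n
    proof (rule AE_I2)
      fix x
      show "norm (H x * (LINT y|lborel. g y * of_real (\<rho> n (x - y))))
        \<le> B * m * (indicator (cball 0 (R + 2)) x * norm (H x))"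
        using mult_left_mono[OF conv_le[of n x] norm_ge_zero[of "H x"]] by (simp only: norm_mult mult_ac)
    qed
  qed measurable
  also have "(LINT x|lborel. H x * (of_real m * g x)) = of_real m * (LINT x|lborel. H x * g x)"
    by (subst integral_mult_right_zero[symmetric]) (simp add: mult_ac)
  finally have "(\<lambda>n. ennreal ((norm (I n))\<^sup>2)) \<longlonglongrightarrow> ennreal ((norm (of_real m * (LINT x|lborel. H x * g x)))\<^sup>2)"
    by (intro tendsto_ennrealI tendsto_power tendsto_norm)
  then have "ennreal ((norm (of_real m * (LINT x|lborel. H x * g x)))\<^sup>2) \<le> ennreal (m\<^sup>2) * ?Q"
    by (rule LIMSEQ_le_const2) (use I_le in blast)
  then have "ennreal (m\<^sup>2) * ennreal ((norm (LINT x|lborel. H x * g x))\<^sup>2) \<le> ennreal (m\<^sup>2) * ?Q"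
    using m by (simp add: norm_mult power_mult_distrib ennreal_mult[symmetric])
  then show ?thesis
    using m by (subst (asm) ennreal_mult_le_mult_iff) auto
qed

lemma pairing_bounded:
  assumes [measurable]: "\<phi> \<in> borel_measurable borel"
    and \<phi>: "\<And>x. norm (\<phi> x) \<le> B" "\<And>x. R < norm x \<Longrightarrow> \<phi> x = 0" and B: "B > 0"
  shows "ennreal ((norm (LINT x|lborel. H x * \<phi> x))\<^sup>2)
    \<le> ennreal ((2 * pi) ^ DIM('a)) * (\<integral>\<^sup>+x. ennreal ((norm (\<phi> x))\<^sup>2) \<partial>lborel) * (\<integral>\<^sup>+x. ennreal ((norm (u x))\<^sup>2) \<partial>lborel)"
\<comment> \<open>If \<open>u\<close> is not square integrable, the right side is infinite unless
  \<phi> vanishes almost everywhere, where 0 * top = 0. In the other case the limit below multiplies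
  by a finite constant.\<close>
proof (cases "(\<integral>\<^sup>+x. ennreal ((norm (u x))\<^sup>2) \<partial>lborel) = top")
  case True
  show ?thesis
  proof (cases "(\<integral>\<^sup>+x. ennreal ((norm (\<phi> x))\<^sup>2) \<partial>lborel) = 0")
    case z: True
    then have "AE x in lborel. \<phi> x = 0"
      by (subst (asm) nn_integral_0_iff_AE) auto
    then have "(LINT x|lborel. H x * \<phi> x) = 0"
      by (intro integral_eq_zero_AE) auto
    then show ?thesis by simp
  next
    case False
    then show ?thesis using True by (simp add: ennreal_mult_top ennreal_mult_eq_top_iff)
  qed
next
  case False
  have "\<phi> \<in> borel_measurable lebesgue" by (simp add: measurable_completion)
  then have "\<phi> measurable_on UNIV"
    by (rule lebesgue_measurable_imp_measurable_on) simp
  then obtain N g where N: "negligible N" and g: "\<And>n. continuous_on UNIV (g n)"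
    and lim: "\<And>x. x \<notin> N \<Longrightarrow> (\<lambda>n. g n x) \<longlonglongrightarrow> \<phi> x"
    unfolding measurable_on_def by auto
  have "AE x in lebesgue. x \<notin> N"
    using N by (intro AE_not_in) (simp add: negligible_iff_null_sets)
  then have AEN: "AE x in lborel. x \<notin> N"
    by (simp only: AE_completion_iff)
  \<comment> \<open>The continuous functions approximating \<phi> may be unbounded and without
    compact support. Radial projection onto the disc of radius B and the factor \<open>cut\<close>
    repair this for dominated convergence, and both leave the limit \<phi> unchanged.\<close>
  define clamp where "clamp z = z / of_real (max 1 (norm z / B))" for z :: complex
  have clamp_cont: "continuous_on UNIV clamp"
    unfolding clamp_def[abs_def] using B by (intro continuous_intros) auto
  have clamp_le: "norm (clamp z) \<le> B" for z
    unfolding clamp_def using B by (auto simp: norm_divide max_def field_simps)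
  have clamp_id: "clamp z = z" if "norm z \<le> B" for z
    unfolding clamp_def using B that by (simp add: max_def field_simps)
  define cut where "cut x = max 0 (min 1 (R + 1 - norm x))" for x :: 'a
  have cut: "0 \<le> cut x" "cut x \<le> 1" for x unfolding cut_def by auto
  have cut0: "cut x = 0" if "R + 1 < norm x" for x unfolding cut_def using that by auto
  have cut1: "cut x = 1" if "norm x \<le> R" for x unfolding cut_def using that by auto
  have cut_cont: "continuous_on UNIV cut" unfolding cut_def[abs_def] by (intro continuous_intros)
  define h where "h n x = of_real (cut x) * clamp (g n x)" for n x
  have h_cont: "continuous_on UNIV (h n)" for n
    unfolding h_def
    by (intro continuous_intros continuous_on_compose2[OF clamp_cont g] cut_cont) auto
  have [measurable]: "h n \<in> borel_measurable borel" for n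
    by (rule borel_measurable_continuous_onI[OF h_cont])
  have h0: "h n x = 0" if "R + 1 < norm x" for n x unfolding h_def using cut0[OF that] by simp
  have h_le: "norm (h n x) \<le> B * indicator (cball 0 (R + 1)) x" for n x
    using h0[of x n] clamp_le[of "g n x"] cut[of x] B mult_mono[of "cut x" 1 "norm (clamp (g n x))" B]
    by (cases "norm x \<le> R + 1") (auto simp: h_def norm_mult)
  have h_lim: "AE x in lborel. (\<lambda>n. h n x) \<longlonglongrightarrow> \<phi> x"
    using AEN
  proof eventually_elim
    case (elim x)
    have "isCont clamp z" for z
      using clamp_cont by (simp add: continuous_on_eq_continuous_at)
    then have "(\<lambda>n. h n x) \<longlonglongrightarrow> of_real (cut x) * clamp (\<phi> x)"
      unfolding h_def by (intro tendsto_mult tendsto_const isCont_tendsto_compose[of _ clamp] lim elim)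
    also have "of_real (cut x) * clamp (\<phi> x) = \<phi> x"
      unfolding clamp_id[OF \<phi>(1)] using \<phi>(2)[of x] cut1[of x] by (cases "norm x \<le> R") auto
    finally show ?case .
  qed
  have "(\<lambda>n. LINT x|lborel. H x * h n x) \<longlonglongrightarrow> (LINT x|lborel. H x * \<phi> x)"
  proof (rule integral_dominated_convergence[where w="\<lambda>x. B * (indicator (cball 0 (R + 1)) x * norm (H x))"])
    show "integrable lborel (\<lambda>x. B * (indicator (cball 0 (R + 1)) x * norm (H x)))"
      by (intro integrable_mult_right locally_integrable)
    show "AE x in lborel. (\<lambda>n. H x * h n x) \<longlonglongrightarrow> H x * \<phi> x"
      using h_lim by eventually_elim (intro tendsto_mult tendsto_const)
    show "AE x in lborel. norm (H x * h n x) \<le> B * (indicator (cball 0 (R + 1)) x * norm (H x))" for n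
    proof (rule AE_I2)
      fix x show "norm (H x * h n x) \<le> B * (indicator (cball 0 (R + 1)) x * norm (H x))"
        using mult_left_mono[OF h_le[of n x] norm_ge_zero[of "H x"]] by (simp only: norm_mult mult_ac)
    qed
  qed measurable
  then have 1: "(\<lambda>n. ennreal ((norm (LINT x|lborel. H x * h n x))\<^sup>2)) \<longlonglongrightarrow> ennreal ((norm (LINT x|lborel. H x * \<phi> x))\<^sup>2)"
    by (intro tendsto_ennrealI tendsto_power tendsto_norm)
  have 2: "(\<lambda>n. \<integral>\<^sup>+x. ennreal ((norm (h n x))\<^sup>2) \<partial>lborel) \<longlonglongrightarrow> (\<integral>\<^sup>+x. ennreal ((norm (\<phi> x))\<^sup>2) \<partial>lborel)"
  proof (rule nn_integral_dominated_convergence[where w="\<lambda>x. ennreal (B\<^sup>2 * indicator (cball 0 (R + 1)) x)"])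
    have "integrable lborel (\<lambda>x::'a. B\<^sup>2 * indicator (cball 0 (R + 1)) x)"
      by (intro integrable_mult_right integrable_indicator_cball)
    from nn_integral_eq_integral[OF this]
    show "(\<integral>\<^sup>+(x::'a). ennreal (B\<^sup>2 * indicator (cball 0 (R + 1)) x) \<partial>lborel) < \<infinity>"
      by simp
    show "AE x in lborel. ennreal ((norm (h n x))\<^sup>2) \<le> ennreal (B\<^sup>2 * indicator (cball 0 (R + 1)) x)" for n
    proof (rule AE_I2)
      fix x show "ennreal ((norm (h n x))\<^sup>2) \<le> ennreal (B\<^sup>2 * indicator (cball 0 (R + 1)) x)"
        using power_mono[OF h_le norm_ge_zero, of n x 2]
        by (intro ennreal_leI) (auto simp: power_mult_distrib indicator_def split: if_splits)
    qed
    show "AE x in lborel. (\<lambda>n. ennreal ((norm (h n x))\<^sup>2)) \<longlonglongrightarrow> ennreal ((norm (\<phi> x))\<^sup>2)"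
      using h_lim by eventually_elim (intro tendsto_ennrealI tendsto_power tendsto_norm)
  qed measurable
  have 3: "(\<lambda>n. ennreal ((2 * pi) ^ DIM('a)) * (\<integral>\<^sup>+x. ennreal ((norm (h n x))\<^sup>2) \<partial>lborel) * (\<integral>\<^sup>+x. ennreal ((norm (u x))\<^sup>2) \<partial>lborel))
    \<longlonglongrightarrow> ennreal ((2 * pi) ^ DIM('a)) * (\<integral>\<^sup>+x. ennreal ((norm (\<phi> x))\<^sup>2) \<partial>lborel) * (\<integral>\<^sup>+x. ennreal ((norm (u x))\<^sup>2) \<partial>lborel)"
  proof -
    have "ennreal ((2 * pi) ^ DIM('a)) * (\<integral>\<^sup>+x. ennreal ((norm (u x))\<^sup>2) \<partial>lborel) < top"
      using False by (simp add: ennreal_mult_less_top less_top)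
    from ennreal_tendsto_cmult[OF this 2] show ?thesis by (simp only: mult_ac)
  qed
  show ?thesis
    by (rule LIMSEQ_le[OF 1 3]) (intro exI[of _ 0] allI impI pairing_continuous[OF h_cont h0])
qed

text \<open>With the conjugate of \<open>H\<close> on \<open>E n\<close> as test function, the
  pairing is the integral r of |H|^2 over \<open>E n\<close>. The pairing bound then reads r^2 <= r
  * P with P the right side, and r cancels.\<close>

theorem L2_le:
  "(\<integral>\<^sup>+x. ennreal ((norm (H x))\<^sup>2) \<partial>lborel)
    \<le> ennreal ((2 * pi) ^ DIM('a)) * (\<integral>\<^sup>+x. ennreal ((norm (u x))\<^sup>2) \<partial>lborel)" (is "_ \<le> ?P")
proof -
  \<comment> \<open>Truncating both |x| and |H x| makes the test function bounded with compact
    support and r finite, as cancellation requires.\<close>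
  define E where "E n = {x. norm x \<le> real n \<and> norm (H x) \<le> real n}" for n :: nat
  have [measurable]: "E n \<in> sets borel" for n unfolding E_def by measurable
  have le: "(\<integral>\<^sup>+x. ennreal ((norm (H x))\<^sup>2 * indicator (E n) x) \<partial>lborel) \<le> ?P" (is "?a \<le> _") for n
  proof (cases "?a = 0")
    case False
    define \<phi> where "\<phi> x = cnj (H x) * of_real (indicator (E n) x)" for x
    have [measurable]: "\<phi> \<in> borel_measurable borel" unfolding \<phi>_def[abs_def] by measurable
    have \<phi>_le: "norm (\<phi> x) \<le> real n + 1" for x
      unfolding \<phi>_def E_def by (auto simp: indicator_def norm_mult)
    have \<phi>_0: "\<phi> x = 0" if "real n < norm x" for x
      unfolding \<phi>_def E_def using that by (auto simp: indicator_def)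
    have eq: "H x * \<phi> x = of_real ((norm (H x))\<^sup>2 * indicator (E n) x)" for x
      unfolding \<phi>_def by (simp add: complex_norm_square[symmetric] mult.assoc[symmetric])
    have int: "integrable lborel (\<lambda>x. (norm (H x))\<^sup>2 * indicator (E n) x)"
    proof -
      have "integrable lborel (\<lambda>x. H x * \<phi> x)"
        by (rule integrable_against_bounded[OF _ \<phi>_le \<phi>_0]) measurable
      then show ?thesis unfolding eq using complex_of_real_integrable_eq by blast
    qed
    define r where "r = (LINT x|lborel. (norm (H x))\<^sup>2 * indicator (E n) x)"
    have r: "r \<ge> 0" unfolding r_def by (intro Bochner_Integration.integral_nonneg) auto
    have a: "?a = ennreal r"
      unfolding r_def by (intro nn_integral_eq_integral int) auto
    have "ennreal ((norm (LINT x|lborel. H x * \<phi> x))\<^sup>2)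
      \<le> ennreal ((2 * pi) ^ DIM('a)) * (\<integral>\<^sup>+x. ennreal ((norm (\<phi> x))\<^sup>2) \<partial>lborel) * (\<integral>\<^sup>+x. ennreal ((norm (u x))\<^sup>2) \<partial>lborel)"
      by (rule pairing_bounded[OF _ \<phi>_le \<phi>_0]) auto
    also have Hphi: "(LINT x|lborel. H x * \<phi> x) = of_real r"
      unfolding eq r_def by (rule integral_complex_of_real)
    also have "(\<integral>\<^sup>+x. ennreal ((norm (\<phi> x))\<^sup>2) \<partial>lborel) = ?a"
      unfolding \<phi>_def by (intro nn_integral_cong) (auto simp: norm_mult indicator_def)
    also have "ennreal ((norm (complex_of_real r))\<^sup>2) = ennreal r * ennreal r"
      using r by (simp add: ennreal_mult[symmetric] power2_eq_square)
    also have "ennreal ((2 * pi) ^ DIM('a)) * ?a * (\<integral>\<^sup>+x. ennreal ((norm (u x))\<^sup>2) \<partial>lborel) = ennreal r * ?P"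
      unfolding a by (simp only: mult_ac)
    finally have "ennreal r * ennreal r \<le> ennreal r * ?P" .
    then show ?thesis
      using False unfolding a by (subst (asm) ennreal_mult_le_mult_iff) auto
  qed simp
  have "(\<integral>\<^sup>+x. ennreal ((norm (H x))\<^sup>2) \<partial>lborel)
      = (\<integral>\<^sup>+x. liminf (\<lambda>n. ennreal ((norm (H x))\<^sup>2 * indicator (E n) x)) \<partial>lborel)"
  proof (rule nn_integral_cong)
    fix x
    obtain n0 :: nat where n0: "norm x + norm (H x) \<le> real n0" using real_arch_simple by blast
    have "x \<in> E n" if "n0 \<le> n" for n
    proof -
      have "norm x + norm (H x) \<le> real n" using n0 that by linarith
      then show ?thesis
        unfolding E_def using norm_ge_zero[of x] norm_ge_zero[of "H x"] by (simp only: mem_Collect_eq) linarith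
    qed
    then have "\<forall>\<^sub>F n in sequentially. ennreal ((norm (H x))\<^sup>2 * indicator (E n) x) = ennreal ((norm (H x))\<^sup>2)"
      by (intro eventually_sequentiallyI[of n0]) auto
    from lim_imp_Liminf[OF _ tendsto_eventually[OF this]]
    show "ennreal ((norm (H x))\<^sup>2) = liminf (\<lambda>n. ennreal ((norm (H x))\<^sup>2 * indicator (E n) x))"
      by simp
  qed
  also have "\<dots> \<le> liminf (\<lambda>n. \<integral>\<^sup>+x. ennreal ((norm (H x))\<^sup>2 * indicator (E n) x) \<partial>lborel)"
    by (rule nn_integral_liminf) measurable
  also have "\<dots> \<le> liminf (\<lambda>n. ?P)"
    by (intro Liminf_mono always_eventually allI le)
  finally show ?thesis by (simp add: Liminf_const)
qed

end

subsection \<open>Bernstein's inequality for the Littlewood--Paley pieces\<close>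

text \<open>Young's inequality is applied to |u| / A and |v| / B, with A and B the two norms. If one
  of these vanishes, the product is zero almost everywhere.\<close>

lemma holder_norm_integral:
  fixes u v :: "'a \<Rightarrow> complex"
  assumes pq: "p > 1" "q > 1" "1 / p + 1 / q = 1"
    and [measurable]: "u \<in> borel_measurable M" "v \<in> borel_measurable M"
    and u: "integrable M (\<lambda>x. norm (u x) powr p)" and v: "integrable M (\<lambda>x. norm (v x) powr q)"
  shows "norm (LINT x|M. u x * v x)
    \<le> (LINT x|M. norm (u x) powr p) powr (1 / p) * (LINT x|M. norm (v x) powr q) powr (1 / q)"
proof -
  define U where "U = (LINT x|M. norm (u x) powr p)"
  define V where "V = (LINT x|M. norm (v x) powr q)"
  have U0: "U \<ge> 0" and V0: "V \<ge> 0"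
    unfolding U_def V_def by (auto intro!: Bochner_Integration.integral_nonneg)
  show ?thesis unfolding U_def[symmetric] V_def[symmetric]
  proof (cases "U = 0 \<or> V = 0")
    case True
    have "AE x in M. u x * v x = 0"
      using True
    proof
      assume "U = 0"
      then have "AE x in M. norm (u x) powr p = 0"
        unfolding U_def by (subst (asm) integral_nonneg_eq_0_iff_AE[OF u]) auto
      then show ?thesis by eventually_elim (auto simp: powr_eq_0_iff)
    next
      assume "V = 0"
      then have "AE x in M. norm (v x) powr q = 0"
        unfolding V_def by (subst (asm) integral_nonneg_eq_0_iff_AE[OF v]) auto
      then show ?thesis by eventually_elim (auto simp: powr_eq_0_iff)
    qed
    then have "(LINT x|M. u x * v x) = 0" by (rule integral_eq_zero_AE)
    then show "norm (LINT x|M. u x * v x) \<le> U powr (1 / p) * V powr (1 / q)" by simp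
  next
    case False
    then have UV: "U > 0" "V > 0" using U0 V0 by auto
    define A where "A = U powr (1 / p)"
    define B where "B = V powr (1 / q)"
    have AB: "A > 0" "B > 0" "A powr p = U" "B powr q = V"
      unfolding A_def B_def using UV pq by (auto simp: powr_powr)
    have bd: "norm (u x * v x) \<le> A * B * (norm (u x) powr p / (p * U) + norm (v x) powr q / (q * V))" for x
    proof -
      have "norm (u x) / A * (norm (v x) / B) \<le> (norm (u x) / A) powr p / p + (norm (v x) / B) powr q / q"
        using AB pq by (intro Youngs_inequality) auto
      then have "norm (u x) / A * (norm (v x) / B) \<le> norm (u x) powr p / (p * U) + norm (v x) powr q / (q * V)"
        using AB by (simp add: powr_divide mult.commute)
      then have "A * B * (norm (u x) / A * (norm (v x) / B)) \<le> A * B * (norm (u x) powr p / (p * U) + norm (v x) powr q / (q * V))"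
        using AB by (intro mult_left_mono) auto
      then show ?thesis using AB by (simp add: norm_mult)
    qed
    have i: "integrable M (\<lambda>x. A * B * (norm (u x) powr p / (p * U) + norm (v x) powr q / (q * V)))"
      by (intro integrable_mult_right Bochner_Integration.integrable_add integrable_divide u v)
    have iuv: "integrable M (\<lambda>x. u x * v x)"
      by (rule Bochner_Integration.integrable_bound[OF i]) (auto intro!: AE_I2 order_trans[OF bd] abs_ge_self)
    have "norm (LINT x|M. u x * v x) \<le> (LINT x|M. norm (u x * v x))"
      by (rule integral_norm_bound)
    also have "\<dots> \<le> (LINT x|M. A * B * (norm (u x) powr p / (p * U) + norm (v x) powr q / (q * V)))"
      by (rule integral_mono[OF integrable_norm[OF iuv] i bd])
    also have "\<dots> = A * B * (U / (p * U) + V / (q * V))"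
      unfolding U_def V_def using u v by simp
    also have "\<dots> = A * B" using UV pq by simp
    finally show "norm (LINT x|M. u x * v x) \<le> U powr (1 / p) * V powr (1 / q)"
      by (simp add: A_def B_def)
  qed
qed

lemma schwartz_powr_integrable:
  fixes \<phi> :: "'a::euclidean_space \<Rightarrow> complex"
  assumes s: "\<phi> \<in> schwartz" and p: "p \<ge> 1"
  shows "integrable lborel (\<lambda>x. norm (\<phi> x) powr p)"
proof -
  note [measurable] = schwartz_measurable[OF s]
  obtain C where C: "C > 0" "\<And>x. norm (\<phi> x) \<le> C" using schwartz_bounded[OF s] by blast
  show ?thesis
  proof (rule Bochner_Integration.integrable_bound[OF integrable_mult_right[OF integrable_norm[OF schwartz_integrable[OF s]], of "C powr (p - 1)"]])
    show "AE x in lborel. norm (norm (\<phi> x) powr p) \<le> norm (C powr (p - 1) * norm (\<phi> x))"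
    proof (rule AE_I2)
      fix x
      have "norm (\<phi> x) powr p = norm (\<phi> x) powr (p - 1) * norm (\<phi> x)"
        by (cases "\<phi> x = 0") (auto simp: powr_diff)
      also have "\<dots> \<le> C powr (p - 1) * norm (\<phi> x)"
        using C p by (intro mult_right_mono powr_mono2) auto
      finally show "norm (norm (\<phi> x) powr p) \<le> norm (C powr (p - 1) * norm (\<phi> x))" by simp
    qed
  qed measurable
qed

lemma Lnorm_cases:
  fixes u :: "'a::euclidean_space \<Rightarrow> complex"
  assumes p: "p > 0" and u: "u \<in> borel_measurable borel"
  obtains "Lnorm p u = top"
  | "integrable lborel (\<lambda>x. norm (u x) powr p)"
    "Lnorm p u = ennreal ((LINT x|lborel. norm (u x) powr p) powr (1 / p))"
proof (cases "(\<integral>\<^sup>+x. ennreal (norm (u x) powr p) \<partial>lborel) = top")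
  case True
  then show thesis using that(1) p by (simp add: Lnorm_def epowr_def)
next
  case False
  have i: "integrable lborel (\<lambda>x. norm (u x) powr p)"
    using u False by (intro integrableI_nonneg) (auto simp: less_top)
  then have "(\<integral>\<^sup>+x. ennreal (norm (u x) powr p) \<partial>lborel) = ennreal (LINT x|lborel. norm (u x) powr p)"
    by (intro nn_integral_eq_integral) auto
  with i show thesis using that(2) p
    by (simp add: Lnorm_def epowr_def Bochner_Integration.integral_nonneg)
qed

lemma two_powi_eq_powr: "(2::real) powi k = 2 powr real_of_int k"
  by (simp add: powr_real_of_int')

section \<open>Dilated cutoffs and the norms of their kernels\<close>

context cutoff
begin

text \<open>Multiplier of the truncation to low frequencies; \<open>dil k - dil (k - 1)\<close> is
  the symbol of \<open>lp_piece \<eta> k\<close>.\<close>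

definition dil :: "int \<Rightarrow> 'a \<Rightarrow> real" where
  "dil k \<xi> = \<eta> ((2 powi (- k)) *\<^sub>R \<xi>)"

lemma dil_measurable [measurable]: "dil k \<in> borel_measurable borel"
  unfolding dil_def[abs_def] by measurable

lemma dil_nonneg [simp]: "0 \<le> dil k \<xi>" and dil_le_1 [simp]: "dil k \<xi> \<le> 1"
  by (simp_all add: dil_def)

lemma dil_eq_1: "norm \<xi> \<le> 2 powi k \<Longrightarrow> dil k \<xi> = 1"
  unfolding dil_def by (rule eta_eq_1) (simp add: power_int_minus field_simps)

lemma dil_eq_0: "2 powi (k + 1) \<le> norm \<xi> \<Longrightarrow> dil k \<xi> = 0"
  unfolding dil_def by (rule eta_eq_0) (simp add: power_int_minus power_int_add field_simps)

lemma dil_schwartz: "(\<lambda>\<xi>. complex_of_real (dil k \<xi>)) \<in> schwartz"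
  using schwartz_affine[OF eta_schwartz, of "2 powi (- k)" 0] by (simp add: dil_def)

text \<open>The support of \<open>dil j\<close> lies in |\<xi>| <= 2^(j + 1) <= 2^k, where
  \<open>dil k\<close> is 1. This reproducing identity lets a Schwartz kernel recover a piece from
  its representative.\<close>

lemma dil_mult: "j < k \<Longrightarrow> dil j \<xi> * dil k \<xi> = dil j \<xi>"
proof -
  assume "j < k"
  then have "(2::real) powi (j + 1) \<le> 2 powi k" by (intro power_int_increasing) auto
  then show ?thesis using dil_eq_1[of \<xi> k] dil_eq_0[of j \<xi>] by (cases "norm \<xi> \<le> 2 powi k") auto
qed

lemma dil_le: "j < k \<Longrightarrow> dil j \<xi> \<le> dil k \<xi>"
  by (metis dil_le_1 dil_mult dil_nonneg mult_left_le_one_le)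

text \<open>Adding \<open>1\<close> makes the constant positive without further argument.\<close>

definition bernstein_const :: "real \<Rightarrow> real" where
  "bernstein_const r = 2 powr (real DIM('a) / r) *
    (LINT y|lborel. norm (fourier (\<lambda>\<xi>. complex_of_real (\<eta> \<xi>)) y) powr (r / (r - 1))) powr (1 - 1 / r) + 1"

text \<open>Bernstein's constant times the sum of the geometric series with ratio 2^(-d / r), which
  arises from adding all pieces of lower frequency.\<close>

definition low_const :: "real \<Rightarrow> real" where
  "low_const r = bernstein_const r / (1 - 2 powr (- (real DIM('a) / r)))"

lemma bernstein_const_pos: "bernstein_const r > 0"
  unfolding bernstein_const_def by (intro add_nonneg_pos mult_nonneg_nonneg) auto

lemma low_const_pos: "r > 1 \<Longrightarrow> low_const r > 0"
  unfolding low_const_def using bernstein_const_pos by (intro divide_pos_pos) (auto simp: powr_less_one)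

lemma fourier_dil:
  "fourier (\<lambda>\<xi>. complex_of_real (dil k \<xi>)) y
    = of_real ((2 powi k) ^ DIM('a)) * fourier (\<lambda>\<xi>. complex_of_real (\<eta> \<xi>)) ((2 powi k) *\<^sub>R y)"
  using fourier_affine[of "\<lambda>\<xi>. complex_of_real (dil k \<xi>)" "2 powi k" y 0]
  by (simp add: dil_def power_int_minus)

text \<open>The kernel is 2^((k + 1) d) times a dilate by 2^(k + 1), so its norm for the conjugate
  exponent r / (r - 1) scales like 2^((k + 1) d / r). The shift from k to k + 1 is the source of the
  factor 2^(d / r) in \<open>bernstein_const\<close>.\<close>

lemma fourier_dil_norm:
  assumes r: "r > 1"
  shows "(LINT y|lborel. norm (fourier (\<lambda>\<xi>. complex_of_real (dil (k + 1) \<xi>)) y) powr (r / (r - 1))) powr (1 - 1 / r)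
    \<le> bernstein_const r * 2 powr (of_int k * real DIM('a) / r)"
proof -
  let ?q = "r / (r - 1)" and ?\<theta> = "fourier (\<lambda>\<xi>. complex_of_real (\<eta> \<xi>))" and ?c = "2 powi (k + 1) :: real"
  define d where "d = real DIM('a)"
  define V where "V = (LINT y|lborel. norm (?\<theta> y) powr ?q)"
  have V: "V \<ge> 0" unfolding V_def by (auto intro!: Bochner_Integration.integral_nonneg)
  have c: "?c > 0" by simp
  have cd: "?c ^ DIM('a) = ?c powr d" unfolding d_def by (simp add: powr_realpow)
  have [measurable]: "?\<theta> \<in> borel_measurable borel" by measurable
  have "(LINT y|lborel. norm (fourier (\<lambda>\<xi>. complex_of_real (dil (k + 1) \<xi>)) y) powr ?q)
      = (LINT y|lborel. (?c powr d) powr ?q * norm (?\<theta> (?c *\<^sub>R y)) powr ?q)"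
    unfolding fourier_dil norm_mult norm_of_real cd
    by (intro Bochner_Integration.integral_cong) (auto simp: powr_mult)
  also have "\<dots> = (?c powr d) powr ?q * (LINT y|lborel. norm (?\<theta> (?c *\<^sub>R y)) powr ?q)" by simp
  also have "(LINT y|lborel. norm (?\<theta> (?c *\<^sub>R y)) powr ?q) = V / ?c powr d"
    unfolding V_def using integral_lborel_affine[of "\<lambda>y. norm (?\<theta> y) powr ?q" ?c 0] c
    by (simp add: cd[symmetric])
  finally have "(LINT y|lborel. norm (fourier (\<lambda>\<xi>. complex_of_real (dil (k + 1) \<xi>)) y) powr ?q)
      = (?c powr d) powr (?q - 1) * V"
    using c by (simp add: powr_diff)
  also have "((?c powr d) powr (?q - 1) * V) powr (1 - 1 / r) = ?c powr (d / r) * V powr (1 - 1 / r)"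
  proof -
    have "(?q - 1) * (1 - 1 / r) = 1 / r" using r by (simp add: field_simps)
    then have "d * ((?q - 1) * (1 - 1 / r)) = d / r" by simp
    then show ?thesis using V by (simp add: powr_mult powr_powr mult.assoc)
  qed
  also have "?c powr (d / r) = 2 powr (d / r) * 2 powr (of_int k * d / r)"
    by (simp add: two_powi_eq_powr powr_powr powr_add[symmetric] add_divide_distrib[symmetric] algebra_simps)
  also have "2 powr (d / r) * 2 powr (of_int k * d / r) * V powr (1 - 1 / r)
      = (2 powr (d / r) * V powr (1 - 1 / r)) * 2 powr (of_int k * d / r)" by simp
  also have "\<dots> \<le> bernstein_const r * 2 powr (of_int k * d / r)"
    unfolding bernstein_const_def V_def d_def by (intro mult_right_mono) auto
  finally show ?thesis unfolding d_def .
qed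

end

text \<open>\<open>F\<close> is tied to the choice made by \<open>fourier_fun\<close>, because
  \<open>lp_piece\<close> and \<open>Dpow\<close> are defined through that choice.\<close>

locale lp_function = cutoff \<eta> for \<eta> :: "'a::euclidean_space \<Rightarrow> real" +
  fixes f :: "'a dist" and F :: "'a \<Rightarrow> complex"
  assumes F_def: "F = fourier_fun f"
    and F_repr: "represents F (dist_fourier f)"
begin

lemma F_meas [measurable]: "F \<in> borel_measurable borel"
  using F_repr by (simp add: represents_def)

lemma F_integrable: "\<phi> \<in> schwartz \<Longrightarrow> integrable lborel (\<lambda>\<xi>. F \<xi> * \<phi> \<xi>)"
  using F_repr by (simp add: represents_def)

text \<open>Fourier inversion writes \<psi> as the transform of \<open>inv_fourier \<psi>\<close>,
  which turns the value of \<open>f\<close> into one of \<open>dist_fourier f\<close>.\<close>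

lemma f_eq:
  assumes "\<psi> \<in> schwartz"
  shows "f \<psi> = (LINT \<xi>|lborel. F \<xi> * inv_fourier \<psi> \<xi>)"
proof -
  have "dist_fourier f (inv_fourier \<psi>) = (LINT \<xi>|lborel. F \<xi> * inv_fourier \<psi> \<xi>)"
    using F_repr inv_fourier_schwartz[OF assms] by (simp add: represents_def)
  then show ?thesis by (simp add: dist_fourier_def fourier_inv_fourier[OF assms])
qed

lemma F_dil_integrable: "integrable lborel (\<lambda>\<xi>. F \<xi> * of_real (dil k \<xi>))"
  by (rule F_integrable[OF dil_schwartz])

definition low :: "int \<Rightarrow> 'a \<Rightarrow> complex" where
  "low k = inv_fourier (\<lambda>\<xi>. F \<xi> * of_real (dil k \<xi>))"

lemma low_measurable [measurable]: "low k \<in> borel_measurable borel"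
  unfolding low_def by measurable

lemma low_diff: "low k x - low j x = inv_fourier (\<lambda>\<xi>. F \<xi> * of_real (dil k \<xi> - dil j \<xi>)) x"
proof -
  have "(LINT \<xi>|lborel. exp (\<i> * of_real (x \<bullet> \<xi>)) * (F \<xi> * of_real (dil k \<xi> - dil j \<xi>)))
      = (LINT \<xi>|lborel. exp (\<i> * of_real (x \<bullet> \<xi>)) * (F \<xi> * of_real (dil k \<xi>)) - exp (\<i> * of_real (x \<bullet> \<xi>)) * (F \<xi> * of_real (dil j \<xi>)))"
    by (intro Bochner_Integration.integral_cong) (auto simp: algebra_simps)
  also have "\<dots> = (LINT \<xi>|lborel. exp (\<i> * of_real (x \<bullet> \<xi>)) * (F \<xi> * of_real (dil k \<xi>)))
      - (LINT \<xi>|lborel. exp (\<i> * of_real (x \<bullet> \<xi>)) * (F \<xi> * of_real (dil j \<xi>)))"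
    using integrable_exp_mult(1)[OF F_dil_integrable, of x] by (subst Bochner_Integration.integral_diff) (auto simp: inner_commute)
  finally show ?thesis by (simp add: low_def inv_fourier_def diff_divide_distrib)
qed

text \<open>\<open>u\<close> is tested against a translate of the kernel of
  \<open>dil (k + 1)\<close>, which equals 1 where the symbol of the piece lives. The outcome is the
  inversion integral at the given x, hence an identity at every point and not just almost
  everywhere.\<close>

lemma low_step_eq:
  defines "\<theta> \<equiv> \<lambda>k. fourier (\<lambda>\<xi>. complex_of_real (dil (k + 1) \<xi>))"
  assumes u: "represents u (lp_piece \<eta> k f)"
  shows "of_real ((2 * pi) ^ DIM('a)) * (low k x - low (k - 1) x) = (LINT y|lborel. u y * \<theta> k (y - x))"
proof -
  let ?c = "complex_of_real ((2 * pi) ^ DIM('a))"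
  have c: "?c \<noteq> 0" by simp
  have s\<theta>: "\<theta> k \<in> schwartz" unfolding \<theta>_def by (intro fourier_schwartz dil_schwartz)
  define \<psi> where "\<psi> y = \<theta> k (y - x)" for y
  have s\<psi>: "\<psi> \<in> schwartz"
    using schwartz_affine[OF s\<theta>, of 1 "- x"] by (simp add: \<psi>_def[abs_def])
  have inv\<psi>: "inv_fourier \<psi> \<xi> = exp (\<i> * of_real (x \<bullet> \<xi>)) * of_real (dil (k + 1) \<xi>)" for \<xi>
  proof -
    have "fourier \<psi> (- \<xi>) = exp (\<i> * of_real (x \<bullet> \<xi>)) * fourier (\<theta> k) (- \<xi>)"
      using fourier_translate[OF schwartz_measurable[OF s\<theta>], of "- x" "- \<xi>"] by (simp add: \<psi>_def[abs_def])
    then have "inv_fourier \<psi> \<xi> = exp (\<i> * of_real (x \<bullet> \<xi>)) * inv_fourier (\<theta> k) \<xi>"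
      by (simp add: inv_fourier_eq_fourier)
    also have "inv_fourier (\<theta> k) \<xi> = of_real (dil (k + 1) \<xi>)"
      unfolding \<theta>_def by (rule inv_fourier_fourier[OF dil_schwartz])
    finally show ?thesis .
  qed
  have mult: "(dil k \<xi> - dil (k - 1) \<xi>) * dil (k + 1) \<xi> = dil k \<xi> - dil (k - 1) \<xi>" for \<xi>
    by (simp add: left_diff_distrib dil_mult)
  have "(LINT y|lborel. u y * \<psi> y) = lp_piece \<eta> k f \<psi>"
    using u s\<psi> by (simp add: represents_def)
  also have "\<dots> = (LINT \<xi>|lborel. exp (\<i> * of_real (x \<bullet> \<xi>)) * (F \<xi> * of_real (dil k \<xi> - dil (k - 1) \<xi>)))"
    unfolding lp_piece_def fourier_multiplier_def F_def[symmetric] inv\<psi>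
  proof (intro Bochner_Integration.integral_cong refl)
    fix \<xi>
    have e: "\<eta> ((2 powi (- k)) *\<^sub>R \<xi>) - \<eta> ((2 powi (- k + 1)) *\<^sub>R \<xi>) = dil k \<xi> - dil (k - 1) \<xi>"
      by (simp add: dil_def)
    have "of_real (dil k \<xi> - dil (k - 1) \<xi>) * F \<xi> * (exp (\<i> * of_real (x \<bullet> \<xi>)) * of_real (dil (k + 1) \<xi>))
        = exp (\<i> * of_real (x \<bullet> \<xi>)) * (F \<xi> * of_real ((dil k \<xi> - dil (k - 1) \<xi>) * dil (k + 1) \<xi>))"
      unfolding of_real_mult by (simp only: mult_ac)
    then show "of_real (\<eta> ((2 powi (- k)) *\<^sub>R \<xi>) - \<eta> ((2 powi (- k + 1)) *\<^sub>R \<xi>)) * F \<xi>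
        * (exp (\<i> * of_real (x \<bullet> \<xi>)) * of_real (dil (k + 1) \<xi>))
        = exp (\<i> * of_real (x \<bullet> \<xi>)) * (F \<xi> * of_real (dil k \<xi> - dil (k - 1) \<xi>))"
      by (simp only: e mult)
  qed
  also have "\<dots> = ?c * (low k x - low (k - 1) x)"
    unfolding low_diff inv_fourier_def using c by (simp del: of_real_power of_real_mult)
  finally show ?thesis by (simp add: \<psi>_def)
qed

text \<open>Hoelder's inequality for the convolution formula \<open>low_step_eq\<close>. Dividing by
  the constant keeps the claim meaningful for an infinite norm and makes it a lower bound for every
  member of the infimum in \<open>dist_Lnorm\<close>.\<close>

lemma bernstein:
  assumes r: "r > 1" and u: "represents u (lp_piece \<eta> k f)"
  shows "ennreal (norm (low k x - low (k - 1) x) / (bernstein_const r * 2 powr (of_int k * real DIM('a) / r))) \<le> Lnorm r u"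
proof -
  define C where "C = bernstein_const r * 2 powr (of_int k * real DIM('a) / r)"
  have C: "C > 0" unfolding C_def using bernstein_const_pos by simp
  have um [measurable]: "u \<in> borel_measurable borel" using u by (simp add: represents_def)
  define \<theta> where "\<theta> = fourier (\<lambda>\<xi>. complex_of_real (dil (k + 1) \<xi>))"
  have s\<theta>: "\<theta> \<in> schwartz" unfolding \<theta>_def by (intro fourier_schwartz dil_schwartz)
  note [measurable] = schwartz_measurable[OF s\<theta>]
  have "r > 0" using r by simp
  from this um show ?thesis
  proof (cases rule: Lnorm_cases)
    case 2
    define q where "q = r / (r - 1)"
    have q: "q > 1" "1 / r + 1 / q = 1" "1 / q = 1 - 1 / r"
      unfolding q_def using r by (auto simp: field_simps)
    have i: "integrable lborel (\<lambda>y. norm (\<theta> y) powr q)"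
      using schwartz_powr_integrable[OF s\<theta>] q by simp
    have i': "integrable lborel (\<lambda>y. norm (\<theta> (y - x)) powr q)"
      using integrable_lborel_affine[OF i, of 1 "- x"] by simp
    have eq: "(LINT y|lborel. norm (\<theta> (y - x)) powr q) = (LINT y|lborel. norm (\<theta> y) powr q)"
      using integral_lborel_affine[of "\<lambda>y. norm (\<theta> y) powr q" 1 "- x"] by simp
    have pi1: "1 \<le> (2 * pi) ^ DIM('a)" using pi_ge_two by (intro one_le_power) linarith
    have "norm (low k x - low (k - 1) x) \<le> (2 * pi) ^ DIM('a) * norm (low k x - low (k - 1) x)"
      using mult_right_mono[OF pi1 norm_ge_zero, of "low k x - low (k - 1) x"] by simp
    also have "\<dots> = norm (complex_of_real ((2 * pi) ^ DIM('a)) * (low k x - low (k - 1) x))"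
      unfolding norm_mult norm_of_real using pi1 by simp
    also have "\<dots> = norm (LINT y|lborel. u y * \<theta> (y - x))"
      unfolding low_step_eq[OF u] \<theta>_def ..
    also have "\<dots> \<le> (LINT y|lborel. norm (u y) powr r) powr (1 / r) * (LINT y|lborel. norm (\<theta> (y - x)) powr q) powr (1 / q)"
      using r q i' 2 by (intro holder_norm_integral) auto
    also have "\<dots> \<le> (LINT y|lborel. norm (u y) powr r) powr (1 / r) * C"
      unfolding eq q(3) unfolding q_def \<theta>_def C_def by (intro mult_left_mono fourier_dil_norm r) simp
    finally show ?thesis
      unfolding 2(2) C_def[symmetric] using C by (intro ennreal_leI) (simp add: field_simps)
  qed simp
qed

lemma low_step_bound:
  assumes r: "r > 1" and b: "(SUP k. dist_Lnorm r (lp_piece \<eta> k f)) \<le> ennreal b" "b \<ge> 0"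
  shows "norm (low k x - low (k - 1) x) \<le> bernstein_const r * b * 2 powr (of_int k * real DIM('a) / r)"
proof -
  let ?C = "bernstein_const r * 2 powr (of_int k * real DIM('a) / r)"
  have C: "?C > 0" using bernstein_const_pos by simp
  have "ennreal (norm (low k x - low (k - 1) x) / ?C) \<le> dist_Lnorm r (lp_piece \<eta> k f)"
    unfolding dist_Lnorm_def by (intro INF_greatest) (use bernstein[OF r] in auto)
  also have "\<dots> \<le> (SUP k. dist_Lnorm r (lp_piece \<eta> k f))" by (intro SUP_upper) simp
  also note b(1)
  finally have "norm (low k x - low (k - 1) x) / ?C \<le> b" using b(2) by simp
  then show ?thesis using C by (simp add: field_simps)
qed

text \<open>For every \<xi> other than 0 the cutoffs eventually vanish, and the function
  \<open>F\<close> gives no mass to the origin. A polynomial \<open>f\<close> would violate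
  this.\<close>

lemma low_tendsto_0: "(\<lambda>m. low (k - int m) x) \<longlonglongrightarrow> 0"
proof -
  have "(\<lambda>m. LINT \<xi>|lborel. exp (\<i> * of_real (x \<bullet> \<xi>)) * (F \<xi> * of_real (dil (k - int m) \<xi>))) \<longlonglongrightarrow> integral\<^sup>L lborel (\<lambda>_::'a. 0)"
  \<comment> \<open>The majorant uses k + 1 instead of k because \<open>dil_le\<close> compares
    strictly ordered indices, and m = 0 occurs.\<close>
  proof (rule integral_dominated_convergence[where w="\<lambda>\<xi>::'a. norm (F \<xi> * of_real (dil (k + 1) \<xi>))"])
    show "integrable lborel (\<lambda>\<xi>::'a. norm (F \<xi> * of_real (dil (k + 1) \<xi>)))"
      by (intro integrable_norm F_dil_integrable)
    show "AE \<xi> in lborel. norm (exp (\<i> * of_real (x \<bullet> \<xi>)) * (F \<xi> * of_real (dil (k - int m) \<xi>))) \<le> norm (F \<xi> * of_real (dil (k + 1) \<xi>))" for m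
      by (intro AE_I2) (auto simp: norm_mult intro!: mult_left_mono dil_le)
    show "AE \<xi> in lborel. (\<lambda>m. exp (\<i> * of_real (x \<bullet> \<xi>)) * (F \<xi> * of_real (dil (k - int m) \<xi>))) \<longlonglongrightarrow> 0"
      using AE_lborel_singleton[of "0::'a"]
    proof eventually_elim
      case (elim \<xi>)
      have "(\<lambda>m. 2 powi (k + 1) * (1 / 2) ^ m) \<longlonglongrightarrow> (2 powi (k + 1) * 0 :: real)"
        by (intro tendsto_mult tendsto_const LIMSEQ_power_zero) simp
      moreover have "2 powi (k + 1) * (0::real) < norm \<xi>" using elim by simp
      ultimately have "\<forall>\<^sub>F m in sequentially. 2 powi (k + 1) * (1 / 2) ^ m < norm \<xi>"
        by (rule order_tendstoD)
      then have "\<forall>\<^sub>F m in sequentially. exp (\<i> * of_real (x \<bullet> \<xi>)) * (F \<xi> * of_real (dil (k - int m) \<xi>)) = 0"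
      proof eventually_elim
        case (elim m)
        have "(2::real) powi (k - int m + 1) = 2 powi (k + 1 - int m)" by (simp add: algebra_simps)
        also have "\<dots> = 2 powi (k + 1) * (1 / 2) ^ m"
          by (simp add: power_int_diff power_divide)
        finally show ?case using elim by (simp add: dil_eq_0)
      qed
      then show ?case by (rule tendsto_eventually)
    qed
  qed measurable
  then have "(\<lambda>m. (LINT \<xi>|lborel. exp (\<i> * of_real (x \<bullet> \<xi>)) * (F \<xi> * of_real (dil (k - int m) \<xi>))) / of_real ((2 * pi) ^ DIM('a)))
      \<longlonglongrightarrow> 0 / of_real ((2 * pi) ^ DIM('a))"
    by (intro tendsto_divide tendsto_const) auto
  then show ?thesis by (simp add: low_def inv_fourier_def)
qed

text \<open>Telescoping towards low frequencies: the increments form a geometric series with ratio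
  2^(-d / r), and the remainder tends to 0.\<close>

lemma low_bound:
  assumes r: "r > 1" and b: "(SUP k. dist_Lnorm r (lp_piece \<eta> k f)) \<le> ennreal b" "b \<ge> 0"
  shows "norm (low k x) \<le> low_const r * b * 2 powr (of_int k * real DIM('a) / r)"
proof -
  define d where "d = real DIM('a) / r"
  have d: "d > 0" unfolding d_def using r by simp
  define \<rho> where "\<rho> = 2 powr (- d)"
  have \<rho>: "0 < \<rho>" "\<rho> < 1" unfolding \<rho>_def using d by (auto simp: powr_less_one)
  define c where "c = bernstein_const r * b * 2 powr (of_int k * d)"
  have c: "c \<ge> 0" unfolding c_def using less_imp_le[OF bernstein_const_pos] b by simp
  have tele: "norm (low k x) \<le> c * (\<Sum>i<m. \<rho> ^ i) + norm (low (k - int m) x)" for m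
  proof (induction m)
    case (Suc m)
    have "of_int (k - int m) * d = of_int k * d + - d * real m" by (simp add: algebra_simps)
    then have e: "2 powr (of_int (k - int m) * d) = 2 powr (of_int k * d) * \<rho> ^ m"
      unfolding \<rho>_def by (simp only: powr_add) (simp add: powr_realpow[symmetric] powr_powr)
    have "norm (low (k - int m) x) \<le> norm (low (k - int m) x - low (k - int m - 1) x) + norm (low (k - int m - 1) x)"
      by (metis diff_add_cancel norm_triangle_ineq)
    also have "norm (low (k - int m) x - low (k - int m - 1) x) \<le> c * \<rho> ^ m"
      using low_step_bound[OF r b, of "k - int m" x] e by (simp add: c_def d_def mult.assoc)
    finally show ?case using Suc by (simp add: distrib_left algebra_simps)
  qed simp
  have geom: "c * (\<Sum>i<m. \<rho> ^ i) \<le> c * (1 / (1 - \<rho>))" for m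
    using c \<rho> by (intro mult_left_mono) (auto simp: sum_gp_strict divide_right_mono)
  have "norm (low k x) \<le> c * (1 / (1 - \<rho>)) + norm (low (k - int m) x)" for m
    using tele[of m] geom[of m] by linarith
  moreover have "(\<lambda>m. c * (1 / (1 - \<rho>)) + norm (low (k - int m) x)) \<longlonglongrightarrow> c * (1 / (1 - \<rho>)) + norm (0::complex)"
    by (intro tendsto_add tendsto_const tendsto_norm low_tendsto_0)
  ultimately have "norm (low k x) \<le> c * (1 / (1 - \<rho>)) + norm (0::complex)"
    by (intro LIMSEQ_le_const) auto
  then show ?thesis
    by (simp add: c_def low_const_def \<rho>_def d_def)
qed

end

subsection \<open>The uniform estimate for truncated frequencies\<close>

text \<open>The largest term present is at most (min \<tau> X)^a and the later ones shrink by
  2^(-a). The minimum, rather than X alone, is what the induction from \<tau> to \<tau> / 2 needs: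
  once \<tau> < X, the tail has to be measured by \<tau> / 2.\<close>

lemma sum_dyadic_below:
  fixes a X \<tau> :: real
  assumes "a > 0" "\<tau> > 0" "X \<ge> 0"
  shows "(\<Sum>i<N. if \<tau> * (1 / 2) ^ i < X then (\<tau> * (1 / 2) ^ i) powr a else 0)
    \<le> (min \<tau> X) powr a / (1 - 2 powr (- a))"
  using assms(2)
proof (induction N arbitrary: \<tau>)
  case 0
  have "2 powr (- a) < 1" using assms(1) by (simp add: powr_less_one)
  then show ?case by simp
next
  case (Suc N)
  define \<rho> where "\<rho> = 2 powr (- a)"
  have \<rho>: "0 < \<rho>" "\<rho> < 1" unfolding \<rho>_def using assms(1) by (simp_all add: powr_less_one)
  let ?g = "\<lambda>\<tau> i. if \<tau> * (1 / 2) ^ i < X then (\<tau> * (1 / 2) ^ i) powr a else 0"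
  have IH: "(\<Sum>i<N. ?g (\<tau> / 2) i) \<le> (min (\<tau> / 2) X) powr a / (1 - \<rho>)"
    using Suc.IH[of "\<tau> / 2"] Suc.prems by (simp add: \<rho>_def)
  have e: "\<tau> * (1 / 2) ^ Suc i = \<tau> / 2 * (1 / 2) ^ i" for i by simp
  have "(\<Sum>i<Suc N. ?g \<tau> i) = ?g \<tau> 0 + (\<Sum>i<N. ?g (\<tau> / 2) i)"
    by (subst sum.lessThan_Suc_shift) (simp only: e)
  also have "\<dots> \<le> (min \<tau> X) powr a / (1 - \<rho>)"
  proof (cases "\<tau> < X")
    case True
    have "(\<tau> / 2) powr a = \<tau> powr a * \<rho>"
      unfolding \<rho>_def using Suc.prems by (simp add: powr_divide powr_minus_divide)
    then have "?g \<tau> 0 + (\<Sum>i<N. ?g (\<tau> / 2) i) \<le> \<tau> powr a + \<tau> powr a * \<rho> / (1 - \<rho>)"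
      using IH True Suc.prems by simp
    also have "\<dots> = \<tau> powr a / (1 - \<rho>)" using \<rho> by (simp add: field_simps)
    finally show ?thesis using True by simp
  next
    case False
    have "?g \<tau> 0 + (\<Sum>i<N. ?g (\<tau> / 2) i) \<le> (min (\<tau> / 2) X) powr a / (1 - \<rho>)"
      using IH False by simp
    also have "\<dots> \<le> (min \<tau> X) powr a / (1 - \<rho>)"
      using \<rho> assms Suc.prems by (intro divide_right_mono powr_mono2) auto
    finally show ?thesis .
  qed
  finally show ?case unfolding \<rho>_def .
qed

text \<open>A single term suffices. For the least i with \<Lambda> * q^(i + 1) < v, minimality, or v
  <= \<Lambda> when i = 0, gives v <= \<Lambda> * q^i. The finite top level \<Lambda> is the reason
  for truncating the frequencies from above.\<close>

lemma discrete_layer_cake: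
  fixes v \<Lambda> q r :: real
  assumes v: "0 \<le> v" "v \<le> \<Lambda>" and q: "0 < q" "q < 1" and r: "r > 0"
  shows "ennreal (v powr r) \<le> (\<Sum>i. ennreal (if \<Lambda> * q ^ Suc i < v then (\<Lambda> * q ^ i) powr r else 0))"
proof (cases "v = 0")
  case False
  then have v0: "v > 0" using v by simp
  have "(\<lambda>i. \<Lambda> * q ^ Suc i) \<longlonglongrightarrow> \<Lambda> * 0"
    using q by (intro tendsto_mult tendsto_const LIMSEQ_Suc[OF LIMSEQ_power_zero]) auto
  then have "\<forall>\<^sub>F i in sequentially. \<Lambda> * q ^ Suc i < v"
    by (rule order_tendstoD) (simp add: v0)
  then obtain i0 where i0: "\<Lambda> * q ^ Suc i0 < v" by (auto simp: eventually_sequentially)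
  define i where "i = (LEAST i. \<Lambda> * q ^ Suc i < v)"
  have i: "\<Lambda> * q ^ Suc i < v" unfolding i_def using i0 by (rule LeastI)
  have le: "v \<le> \<Lambda> * q ^ i"
  proof (cases i)
    case (Suc j)
    then have "\<not> \<Lambda> * q ^ Suc j < v" using not_less_Least[of j "\<lambda>i. \<Lambda> * q ^ Suc i < v"] by (simp add: i_def)
    then show ?thesis using Suc by simp
  qed (use v in simp)
  define t where "t i = ennreal (if \<Lambda> * q ^ Suc i < v then (\<Lambda> * q ^ i) powr r else 0)" for i
  have "ennreal (v powr r) \<le> t i"
    unfolding t_def using i le v r by (auto intro!: ennreal_leI powr_mono2)
  also have "\<dots> \<le> (\<Sum>i. t i)"
    using sum_le_suminf[of t "{i}"] by simp
  finally show ?thesis unfolding t_def .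
qed simp

context cutoff
begin

text \<open>4 comes from Chebyshev at half a level, 2^d from the r-th power of the ratio 2^(d / r)
  of consecutive levels, the power r - 2 from the levels themselves, and the denominator from the
  geometric series in 2^(-2 s).\<close>

definition layer_const :: "real \<Rightarrow> real \<Rightarrow> real" where
  "layer_const r s = 4 * 2 powr real DIM('a) * (2 * low_const r) powr (r - 2) / (1 - 2 powr (- (2 * s)))"

lemma layer_const_pos:
  assumes "r > 1" "s > 0"
  shows "layer_const r s > 0"
  unfolding layer_const_def using low_const_pos[OF assms(1)] assms(2)
  by (intro mult_pos_pos divide_pos_pos) (auto simp: powr_less_one)

end

context lp_function
begin

definition energy :: "real \<Rightarrow> ennreal" where
  "energy s = (\<integral>\<^sup>+\<xi>. ennreal ((norm (F \<xi>))\<^sup>2 * norm \<xi> powr (2 * s)) \<partial>lborel)"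

text \<open>Both cutoffs are 1 on |\<xi>| <= 2^j, so their difference vanishes there and is at most
  1 elsewhere.\<close>

lemma low_diff_L2:
  assumes "j \<le> n"
  shows "(\<integral>\<^sup>+x. ennreal ((norm (low n x - low j x))\<^sup>2) \<partial>lborel)
    \<le> (\<integral>\<^sup>+\<xi>. ennreal ((norm (F \<xi>))\<^sup>2 * indicator {\<xi>. 2 powi j < norm \<xi>} \<xi>) \<partial>lborel)"
proof -
  have "integrable lborel (\<lambda>\<xi>. F \<xi> * of_real (dil n \<xi>) - F \<xi> * of_real (dil j \<xi>))"
    by (intro Bochner_Integration.integrable_diff F_dil_integrable)
  then have i: "integrable lborel (\<lambda>\<xi>. F \<xi> * of_real (dil n \<xi> - dil j \<xi>))"
    by (simp add: right_diff_distrib)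
  have "(\<integral>\<^sup>+x. ennreal ((norm (low n x - low j x))\<^sup>2) \<partial>lborel)
      \<le> (\<integral>\<^sup>+\<xi>. ennreal ((norm (F \<xi> * of_real (dil n \<xi> - dil j \<xi>)))\<^sup>2) \<partial>lborel)"
    unfolding low_diff by (rule inv_fourier_L2_le[OF i])
  also have "\<dots> \<le> (\<integral>\<^sup>+\<xi>. ennreal ((norm (F \<xi>))\<^sup>2 * indicator {\<xi>. 2 powi j < norm \<xi>} \<xi>) \<partial>lborel)"
  proof (intro nn_integral_mono ennreal_leI)
    fix \<xi>
    show "(norm (F \<xi> * of_real (dil n \<xi> - dil j \<xi>)))\<^sup>2 \<le> (norm (F \<xi>))\<^sup>2 * indicator {\<xi>. 2 powi j < norm \<xi>} \<xi>"
    proof (cases "2 powi j < norm \<xi>")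
      case True
      have "\<bar>dil n \<xi> - dil j \<xi>\<bar> \<le> 1"
        using dil_nonneg[of n \<xi>] dil_le_1[of n \<xi>] dil_nonneg[of j \<xi>] dil_le_1[of j \<xi>] by linarith
      then have "\<bar>dil n \<xi> - dil j \<xi>\<bar>\<^sup>2 \<le> 1" using abs_ge_zero power_le_one by blast
      then show ?thesis
        using True unfolding norm_mult norm_of_real power_mult_distrib by (simp add: mult_left_le)
    next
      case False
      moreover have "(2::real) powi j \<le> 2 powi n" using assms by (intro power_int_increasing) auto
      ultimately have "norm \<xi> \<le> 2 powi j" "norm \<xi> \<le> 2 powi n" by linarith+
      then have "dil j \<xi> = 1" "dil n \<xi> = 1" by (simp_all add: dil_eq_1)
      then show ?thesis by simp
    qed
  qed
  finally show ?thesis .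
qed

text \<open>The strict positivity of \<open>b\<close> keeps all levels positive, so that dividing by
  their squares is legitimate.\<close>

lemma low_Lr_bound:
  assumes r: "r > 1" and s: "s > 0" and rs: "1 / r + s / real DIM('a) = 1 / 2"
    and b: "(SUP k. dist_Lnorm r (lp_piece \<eta> k f)) \<le> ennreal b" "b > 0"
  shows "(\<integral>\<^sup>+x. ennreal (norm (low n x) powr r) \<partial>lborel)
    \<le> ennreal (layer_const r s * b powr (r - 2)) * energy s"
proof -
  define \<delta> where "\<delta> = real DIM('a) / r"
  have \<delta>: "\<delta> > 0" unfolding \<delta>_def using r by simp
  have "real DIM('a) / 2 = \<delta> + s"
    using rs r unfolding \<delta>_def by (simp add: field_simps)
  then have \<delta>s: "\<delta> * (r - 2) = 2 * s" and \<delta>r: "\<delta> * r = real DIM('a)"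
    using r unfolding \<delta>_def by (simp_all add: field_simps)
  define q where "q = 2 powr (- \<delta>)"
  have q: "0 < q" "q < 1" unfolding q_def using \<delta> by (auto simp: powr_less_one)
  define L where "L = low_const r"
  have L: "L > 0" unfolding L_def using low_const_pos r by simp
  \<comment> \<open>Twice the pointwise bound for \<open>low n\<close>: the top of the
    levels.\<close>
  define \<Lambda> where "\<Lambda> = 2 * L * b * 2 powr (of_int n * \<delta>)"
  have \<Lambda>: "\<Lambda> > 0" unfolding \<Lambda>_def using L b by simp
  \<comment> \<open>Offset by one because the threshold of the i-th layer is \<Lambda> * q^(i + 1),
    which is exactly twice the pointwise bound for \<open>low (j i)\<close>.\<close>
  define j where "j i = n - 1 - int i" for i
  define \<tau> where "\<tau> = (2::real) powr (of_int n - 1)"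
  have \<tau>: "\<tau> > 0" by (simp add: \<tau>_def)
  have \<tau>j: "2 powr of_int (j i) = \<tau> * (1 / 2) ^ i" for i
    unfolding \<tau>_def j_def by (simp add: powr_diff powr_realpow power_divide)
  have lev: "\<Lambda> * q ^ Suc i = 2 * L * b * 2 powr (of_int (j i) * \<delta>)" for i
  proof -
    have "q ^ Suc i = 2 powr (- \<delta> * real (Suc i))"
      using q powr_realpow[of q "Suc i"] by (simp add: q_def powr_powr)
    then have "\<Lambda> * q ^ Suc i = 2 * L * b * (2 powr (of_int n * \<delta>) * 2 powr (- \<delta> * real (Suc i)))"
      unfolding \<Lambda>_def by simp
    also have "2 powr (of_int n * \<delta>) * 2 powr (- \<delta> * real (Suc i)) = 2 powr (of_int (j i) * \<delta>)"
      unfolding powr_add[symmetric] j_def by (simp add: algebra_simps)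
    finally show ?thesis .
  qed
  have low_j: "norm (low k x) \<le> L * b * 2 powr (of_int k * \<delta>)" for k x
    using low_bound[OF r b(1) less_imp_le[OF b(2)], of k x] by (simp add: L_def \<delta>_def)
  define a where "a i = 4 * 2 powr real DIM('a) * (2 * L * b) powr (r - 2) * (\<tau> * (1 / 2) ^ i) powr (2 * s)" for i
  have a_nonneg: "a i \<ge> 0" for i unfolding a_def by simp
  \<comment> \<open>The coefficient of layer i, with l the threshold. Since \<Lambda> * q^i = l *
    2^\<delta> and \<delta> * r = d, it equals 4 * 2^d * l^(r - 2), and \<delta> * (r - 2) = 2 * s
    converts the frequency part into (2^(j i))^(2 s).\<close>
  have a_eq: "(\<Lambda> * q ^ i) powr r * (4 / (\<Lambda> * q ^ Suc i)\<^sup>2) = a i" for i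
  proof -
    define l where "l = \<Lambda> * q ^ Suc i"
    have l: "l > 0" unfolding l_def using \<Lambda> q by simp
    have "\<Lambda> * q ^ i = l * 2 powr \<delta>"
      unfolding l_def q_def by (simp add: powr_minus)
    then have "(\<Lambda> * q ^ i) powr r = l powr r * 2 powr real DIM('a)"
      using l by (simp add: powr_mult powr_powr \<delta>r)
    then have "(\<Lambda> * q ^ i) powr r * (4 / l\<^sup>2) = 4 * 2 powr real DIM('a) * l powr (r - 2)"
      using l by (simp add: powr_diff powr_numeral)
    also have "l powr (r - 2) = (2 * L * b) powr (r - 2) * (2 powr of_int (j i)) powr (2 * s)"
      unfolding l_def lev using L b by (simp add: powr_mult powr_powr \<delta>s[symmetric] mult.assoc)
    finally show ?thesis unfolding l_def a_def \<tau>j by simp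
  qed
  \<comment> \<open>Chebyshev in pointwise form: above the threshold l the low part is at most l /
    2, so the high part is at least l / 2.\<close>
  have term_le: "ennreal (if \<Lambda> * q ^ Suc i < norm (low n x) then (\<Lambda> * q ^ i) powr r else 0)
      \<le> ennreal (a i) * ennreal ((norm (low n x - low (j i) x))\<^sup>2)" for i x
  proof (cases "\<Lambda> * q ^ Suc i < norm (low n x)")
    case True
    define l where "l = \<Lambda> * q ^ Suc i"
    have l: "l > 0" unfolding l_def using \<Lambda> q by simp
    have "norm (low (j i) x) \<le> l / 2"
      using low_j[of "j i" x] unfolding l_def lev by simp
    then have "l / 2 \<le> norm (low n x - low (j i) x)"
      using True norm_triangle_ineq2[of "low n x" "low (j i) x"] unfolding l_def[symmetric] by linarith
    then have "(l / 2)\<^sup>2 \<le> (norm (low n x - low (j i) x))\<^sup>2"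
      using l by (intro power_mono) auto
    then have "1 \<le> 4 / l\<^sup>2 * (norm (low n x - low (j i) x))\<^sup>2"
      using l by (simp add: power_divide field_simps)
    then have "(\<Lambda> * q ^ i) powr r * 1 \<le> (\<Lambda> * q ^ i) powr r * (4 / l\<^sup>2 * (norm (low n x - low (j i) x))\<^sup>2)"
      by (rule mult_left_mono) simp
    also have "\<dots> = a i * (norm (low n x - low (j i) x))\<^sup>2"
      unfolding l_def a_eq[symmetric] by simp
    finally show ?thesis
      using True a_nonneg by (simp add: ennreal_mult[symmetric] ennreal_leI)
  qed simp
  have F2m [measurable]: "(\<lambda>\<xi>. ennreal ((norm (F \<xi>))\<^sup>2 * indicator {\<xi>. 2 powi j i < norm \<xi>} \<xi>)) \<in> borel_measurable borel" for i
    by measurable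
  have "(\<integral>\<^sup>+x. ennreal (norm (low n x) powr r) \<partial>lborel)
      \<le> (\<integral>\<^sup>+x. (\<Sum>i. ennreal (if \<Lambda> * q ^ Suc i < norm (low n x) then (\<Lambda> * q ^ i) powr r else 0)) \<partial>lborel)"
  proof (intro nn_integral_mono discrete_layer_cake q)
    fix x
    have "norm (low n x) \<le> \<Lambda> / 2" using low_j[of n x] by (simp add: \<Lambda>_def)
    then show "norm (low n x) \<le> \<Lambda>" using \<Lambda> by linarith
  qed (use r in auto)
  also have "\<dots> \<le> (\<integral>\<^sup>+x. (\<Sum>i. ennreal (a i) * ennreal ((norm (low n x - low (j i) x))\<^sup>2)) \<partial>lborel)"
    by (intro nn_integral_mono suminf_le term_le) auto
  also have "\<dots> = (\<Sum>i. ennreal (a i) * (\<integral>\<^sup>+x. ennreal ((norm (low n x - low (j i) x))\<^sup>2) \<partial>lborel))"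
    by (subst nn_integral_suminf) (auto simp: nn_integral_cmult)
  also have "\<dots> \<le> (\<Sum>i. ennreal (a i) * (\<integral>\<^sup>+\<xi>. ennreal ((norm (F \<xi>))\<^sup>2 * indicator {\<xi>. 2 powi j i < norm \<xi>} \<xi>) \<partial>lborel))"
    by (intro suminf_le mult_left_mono low_diff_L2) (auto simp: j_def)
  also have "\<dots> = (\<integral>\<^sup>+\<xi>. (\<Sum>i. ennreal (a i) * ennreal ((norm (F \<xi>))\<^sup>2 * indicator {\<xi>. 2 powi j i < norm \<xi>} \<xi>)) \<partial>lborel)"
    by (subst nn_integral_suminf) (auto simp: nn_integral_cmult)
  also have "\<dots> \<le> (\<integral>\<^sup>+\<xi>. ennreal (layer_const r s * b powr (r - 2)) * ennreal ((norm (F \<xi>))\<^sup>2 * norm \<xi> powr (2 * s)) \<partial>lborel)"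
  \<comment> \<open>For fixed \<xi> the surviving levels are those with \<tau> / 2^i < |\<xi>|.
    Partial sums are bounded uniformly in N by \<open>sum_dyadic_below\<close>.\<close>
  proof (intro nn_integral_mono suminf_le_const)
    fix \<xi> N
    define c where "c = 4 * 2 powr real DIM('a) * (2 * L * b) powr (r - 2)"
    have c: "c \<ge> 0" unfolding c_def by simp
    have "(\<Sum>i<N. ennreal (a i) * ennreal ((norm (F \<xi>))\<^sup>2 * indicator {\<xi>. 2 powi j i < norm \<xi>} \<xi>))
        = ennreal (\<Sum>i<N. a i * ((norm (F \<xi>))\<^sup>2 * indicator {\<xi>. 2 powi j i < norm \<xi>} \<xi>))"
      by (subst sum_ennreal[symmetric]) (auto simp: ennreal_mult a_nonneg)
    also have "(\<Sum>i<N. a i * ((norm (F \<xi>))\<^sup>2 * indicator {\<xi>. 2 powi j i < norm \<xi>} \<xi>))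
        = c * (norm (F \<xi>))\<^sup>2 * (\<Sum>i<N. if \<tau> * (1 / 2) ^ i < norm \<xi> then (\<tau> * (1 / 2) ^ i) powr (2 * s) else 0)"
      unfolding sum_distrib_left
      by (intro sum.cong refl) (auto simp: a_def c_def two_powi_eq_powr \<tau>j)
    also have "\<dots> \<le> c * (norm (F \<xi>))\<^sup>2 * ((min \<tau> (norm \<xi>)) powr (2 * s) / (1 - 2 powr (- (2 * s))))"
      using c s \<tau> by (intro mult_left_mono sum_dyadic_below) auto
    also have "\<dots> \<le> c * (norm (F \<xi>))\<^sup>2 * (norm \<xi> powr (2 * s) / (1 - 2 powr (- (2 * s))))"
      using c s \<tau> by (intro mult_left_mono divide_right_mono powr_mono2) (auto simp: powr_less_one less_imp_le)
    also have "\<dots> = layer_const r s * b powr (r - 2) * ((norm (F \<xi>))\<^sup>2 * norm \<xi> powr (2 * s))"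
      unfolding layer_const_def c_def L_def[symmetric] using L b by (simp add: powr_mult)
    also have "ennreal \<dots> = ennreal (layer_const r s * b powr (r - 2)) * ennreal ((norm (F \<xi>))\<^sup>2 * norm \<xi> powr (2 * s))"
      by (simp add: ennreal_mult'')
    finally show "(\<Sum>i<N. ennreal (a i) * ennreal ((norm (F \<xi>))\<^sup>2 * indicator {\<xi>. 2 powi j i < norm \<xi>} \<xi>))
        \<le> ennreal (layer_const r s * b powr (r - 2)) * ennreal ((norm (F \<xi>))\<^sup>2 * norm \<xi> powr (2 * s))"
      by (simp add: ennreal_leI)
  qed auto
  also have "\<dots> = ennreal (layer_const r s * b powr (r - 2)) * energy s"
    unfolding energy_def by (rule nn_integral_cmult) measurable
  finally show ?thesis .
qed

end

subsection \<open>Removing the truncation\<close>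

lemma nn_integral_Fatou_le:
  fixes g :: "nat \<Rightarrow> 'a \<Rightarrow> real"
  assumes [measurable]: "\<And>n. g n \<in> borel_measurable M"
    and lim: "AE x in M. (\<lambda>n. g n x) \<longlonglongrightarrow> h x"
    and le: "\<forall>\<^sub>F n in sequentially. (\<integral>\<^sup>+x. ennreal (g n x) \<partial>M) \<le> K"
  shows "(\<integral>\<^sup>+x. ennreal (h x) \<partial>M) \<le> K"
proof -
  have "(\<integral>\<^sup>+x. ennreal (h x) \<partial>M) = (\<integral>\<^sup>+x. liminf (\<lambda>n. ennreal (g n x)) \<partial>M)"
  proof (rule nn_integral_cong_AE)
    show "AE x in M. ennreal (h x) = liminf (\<lambda>n. ennreal (g n x))"
      using lim
    proof eventually_elim
      case (elim x)
      then have "(\<lambda>n. ennreal (g n x)) \<longlonglongrightarrow> ennreal (h x)" by (rule tendsto_ennrealI)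
      from lim_imp_Liminf[OF _ this] show ?case by simp
    qed
  qed
  also have "\<dots> \<le> liminf (\<lambda>n. \<integral>\<^sup>+x. ennreal (g n x) \<partial>M)"
    by (rule nn_integral_liminf) measurable
  also have "\<dots> \<le> liminf (\<lambda>n. K)"
    by (rule Liminf_mono[OF le])
  finally show ?thesis by (simp add: Liminf_const)
qed

section \<open>From the norm of \<open>Dpow s f\<close> to the weighted integral of the
  transform\<close>

context lp_function
begin

text \<open>Testing \<open>u\<close> with \<open>fourier \<kappa>\<close> makes
  \<open>Dpow s f\<close> integrate |\<xi>|^s * F against \<kappa>, by inversion. This is the
  hypothesis of the duality locale; compact support of \<kappa> bounds |\<xi>|^s there and so gives
  integrability.\<close>

lemma energy_le_dual:
  assumes s: "s \<ge> 0" and u: "represents u (Dpow s f)"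
  shows "energy s \<le> ennreal ((2 * pi) ^ DIM('a)) * (\<integral>\<^sup>+x. ennreal ((norm (u x))\<^sup>2) \<partial>lborel)"
proof -
  define H where "H \<xi> = of_real (norm \<xi> powr s) * F \<xi>" for \<xi>
  have [measurable]: "H \<in> borel_measurable borel" unfolding H_def[abs_def] by measurable
  have [measurable]: "u \<in> borel_measurable borel" using u by (simp add: represents_def)
  interpret fourier_dual \<eta> H u
  proof
    fix \<kappa> :: "'a \<Rightarrow> complex" and R
    assume \<kappa>: "\<kappa> \<in> schwartz" and R: "\<And>x. R \<le> norm x \<Longrightarrow> \<kappa> x = 0"
    note [measurable] = schwartz_measurable[OF \<kappa>]
    have "integrable lborel (\<lambda>x. H x * \<kappa> x)"
    proof (rule Bochner_Integration.integrable_bound[OF integrable_mult_right[OF F_integrable[OF \<kappa>], of "of_real (\<bar>R\<bar> powr s)"]])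
      show "AE x in lborel. norm (H x * \<kappa> x) \<le> norm (of_real (\<bar>R\<bar> powr s) * (F x * \<kappa> x))"
      proof (rule AE_I2)
        fix x
        show "norm (H x * \<kappa> x) \<le> norm (of_real (\<bar>R\<bar> powr s) * (F x * \<kappa> x))"
        proof (cases "R \<le> norm x")
          case False
          then have "norm x powr s \<le> \<bar>R\<bar> powr s" using s by (intro powr_mono2) auto
          then show ?thesis
            by (simp add: H_def norm_mult mult.assoc mult_right_mono)
        qed (simp add: R)
      qed
    qed measurable
    moreover have "integrable lborel (\<lambda>x. u x * fourier \<kappa> x)"
      and "(LINT x|lborel. H x * \<kappa> x) = (LINT x|lborel. u x * fourier \<kappa> x)"
    proof -
      have *: "integrable lborel (\<lambda>x. u x * fourier \<kappa> x)
          \<and> Dpow s f (fourier \<kappa>) = (LINT x|lborel. u x * fourier \<kappa> x)"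
        using u fourier_schwartz[OF \<kappa>] by (simp add: represents_def)
      have "Dpow s f (fourier \<kappa>) = (LINT x|lborel. H x * \<kappa> x)"
        by (simp add: Dpow_def fourier_multiplier_def F_def[symmetric] H_def inv_fourier_fourier[OF \<kappa>])
      then show "integrable lborel (\<lambda>x. u x * fourier \<kappa> x)"
        "(LINT x|lborel. H x * \<kappa> x) = (LINT x|lborel. u x * fourier \<kappa> x)"
        using * by simp_all
    qed
    ultimately show "integrable lborel (\<lambda>x. H x * \<kappa> x) \<and> integrable lborel (\<lambda>x. u x * fourier \<kappa> x)
      \<and> (LINT x|lborel. H x * \<kappa> x) = (LINT x|lborel. u x * fourier \<kappa> x)" by blast
  qed measurable
  have "(norm (H \<xi>))\<^sup>2 = (norm (F \<xi>))\<^sup>2 * norm \<xi> powr (2 * s)" for \<xi>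
  proof -
    have "(norm \<xi> powr s)\<^sup>2 = norm \<xi> powr (2 * s)"
      by (simp add: power2_eq_square powr_add[symmetric])
    then show ?thesis by (simp add: H_def norm_mult power_mult_distrib)
  qed
  with L2_le show ?thesis by (simp add: energy_def)
qed

text \<open>\<open>dist_Lnorm\<close> is an infimum, so representatives with norm below a + 1 / (n +
  1) are used and n tends to infinity.\<close>

lemma energy_le:
  assumes s: "s \<ge> 0" and a: "dist_Lnorm 2 (Dpow s f) = ennreal a" "a \<ge> 0"
  shows "energy s \<le> ennreal ((2 * pi) ^ DIM('a) * a\<^sup>2)"
proof -
  let ?c = "(2 * pi) ^ DIM('a)"
  have c: "?c > 0" by simp
  have le: "energy s \<le> ennreal (?c * t\<^sup>2)"
    if u: "represents u (Dpow s f)" and t: "Lnorm 2 u = ennreal t" "t \<ge> 0" for u t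
  proof -
    have um: "u \<in> borel_measurable borel" using u by (simp add: represents_def)
    have "(0::real) < 2" by simp
    from this um show ?thesis
    proof (cases rule: Lnorm_cases)
      case 1
      then show ?thesis using t by simp
    next
      case 2
      define I where "I = (LINT x|lborel. norm (u x) powr 2)"
      have I: "I \<ge> 0" unfolding I_def by (auto intro!: Bochner_Integration.integral_nonneg)
      have "ennreal t = ennreal (I powr (1 / 2))" using 2 t by (simp add: I_def)
      then have "t = I powr (1 / 2)" using t by simp
      then have t2: "t\<^sup>2 = I" using I by (simp add: powr_half_sqrt)
      have "(\<integral>\<^sup>+x. ennreal ((norm (u x))\<^sup>2) \<partial>lborel) = (\<integral>\<^sup>+x. ennreal (norm (u x) powr 2) \<partial>lborel)"
        by (simp add: powr_numeral)
      also have "\<dots> = ennreal I"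
        unfolding I_def by (intro nn_integral_eq_integral 2) auto
      finally have "energy s \<le> ennreal ?c * ennreal I"
        using energy_le_dual[OF s u] by (simp only:)
      also have "\<dots> = ennreal (?c * I)" by (rule ennreal_mult''[symmetric, OF I])
      finally show ?thesis unfolding t2 .
    qed
  qed
  have bound: "energy s \<le> ennreal (?c * (a + 1 / real (Suc n))\<^sup>2)" for n
  proof -
    have "dist_Lnorm 2 (Dpow s f) < ennreal (a + 1 / real (Suc n))"
      unfolding a using a by (intro ennreal_lessI) (auto intro: add_nonneg_pos)
    then obtain u where u: "represents u (Dpow s f)" "Lnorm 2 u < ennreal (a + 1 / real (Suc n))"
      unfolding dist_Lnorm_def by (auto simp: INF_less_iff)
    then obtain t where t: "Lnorm 2 u = ennreal t" "t \<ge> 0" by (cases "Lnorm 2 u") auto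
    have "ennreal t < ennreal (a + 1 / real (Suc n))" using u(2) unfolding t(1) .
    then have "t \<le> a + 1 / real (Suc n)"
      unfolding ennreal_less_iff[OF t(2)] by (rule less_imp_le)
    then have "ennreal (?c * t\<^sup>2) \<le> ennreal (?c * (a + 1 / real (Suc n))\<^sup>2)"
      using t c by (intro ennreal_leI mult_left_mono power_mono) auto
    then show ?thesis using le[OF u(1) t] by (rule order_trans[rotated])
  qed
  have "(\<lambda>n. ennreal (?c * (a + 1 / real (Suc n))\<^sup>2)) \<longlonglongrightarrow> ennreal (?c * (a + 0)\<^sup>2)"
    by (intro tendsto_ennrealI tendsto_mult tendsto_const tendsto_power tendsto_add LIMSEQ_Suc[OF lim_1_over_n])
  then have "energy s \<le> ennreal (?c * (a + 0)\<^sup>2)"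
    by (rule LIMSEQ_le_const) (use bound in blast)
  then show ?thesis by simp
qed

section \<open>The limit of the truncations as a function representing \<open>f\<close>\<close>

lemma low_bounded: obtains C where "C \<ge> 0" "\<And>x. norm (low k x) \<le> C"
proof
  show "0 \<le> (LINT x|lborel. norm (F x * of_real (dil k x))) / (2 * pi) ^ DIM('a)"
    by (intro divide_nonneg_nonneg Bochner_Integration.integral_nonneg) auto
  show "norm (low k x) \<le> (LINT x|lborel. norm (F x * of_real (dil k x))) / (2 * pi) ^ DIM('a)" for x
    unfolding low_def inv_fourier_eq_fourier norm_divide norm_of_real
    by (auto intro!: divide_right_mono norm_fourier_le)
qed

text \<open>Once the inverse transform is moved onto \<psi>, the cutoffs increase to 1 under an
  integral dominated by |F| times |inv_fourier \<psi>|.\<close>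

lemma low_pairing_tendsto:
  assumes \<psi>: "\<psi> \<in> schwartz"
  shows "(\<lambda>n. LINT x|lborel. low (int n) x * \<psi> x) \<longlonglongrightarrow> f \<psi>"
proof -
  note si = inv_fourier_schwartz[OF \<psi>]
  note [measurable] = schwartz_measurable[OF si]
  have "(LINT x|lborel. low (int n) x * \<psi> x) = (LINT \<xi>|lborel. F \<xi> * of_real (dil (int n) \<xi>) * inv_fourier \<psi> \<xi>)" for n
    unfolding low_def by (rule inv_fourier_multiplication_formula[OF F_dil_integrable schwartz_integrable[OF \<psi>]])
  moreover have "(\<lambda>n. LINT \<xi>|lborel. F \<xi> * of_real (dil (int n) \<xi>) * inv_fourier \<psi> \<xi>) \<longlonglongrightarrow> (LINT \<xi>|lborel. F \<xi> * inv_fourier \<psi> \<xi>)"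
  proof (rule integral_dominated_convergence[where w="\<lambda>\<xi>. norm (F \<xi> * inv_fourier \<psi> \<xi>)"])
    show "integrable lborel (\<lambda>\<xi>. norm (F \<xi> * inv_fourier \<psi> \<xi>))"
      by (intro integrable_norm F_integrable si)
    show "AE \<xi> in lborel. norm (F \<xi> * of_real (dil (int n) \<xi>) * inv_fourier \<psi> \<xi>) \<le> norm (F \<xi> * inv_fourier \<psi> \<xi>)" for n
      by (intro AE_I2) (auto simp: norm_mult intro!: mult_right_mono mult_left_le)
    show "AE \<xi> in lborel. (\<lambda>n. F \<xi> * of_real (dil (int n) \<xi>) * inv_fourier \<psi> \<xi>) \<longlonglongrightarrow> F \<xi> * inv_fourier \<psi> \<xi>"
    proof (rule AE_I2)
      fix \<xi> :: 'a
      obtain m where m: "norm \<xi> < 2 ^ m" using real_arch_pow[of 2 "norm \<xi>"] by auto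
      have "dil (int n) \<xi> = 1" if "m \<le> n" for n
      proof (rule dil_eq_1)
        have "(2::real) ^ m \<le> 2 ^ n" using that by (intro power_increasing) auto
        with m have "norm \<xi> \<le> 2 ^ n" by linarith
        then show "norm \<xi> \<le> 2 powi int n" by simp
      qed
      then have "\<forall>\<^sub>F n in sequentially. F \<xi> * of_real (dil (int n) \<xi>) * inv_fourier \<psi> \<xi> = F \<xi> * inv_fourier \<psi> \<xi>"
        by (intro eventually_sequentiallyI[of m]) simp
      then show "(\<lambda>n. F \<xi> * of_real (dil (int n) \<xi>) * inv_fourier \<psi> \<xi>) \<longlonglongrightarrow> F \<xi> * inv_fourier \<psi> \<xi>"
        by (rule tendsto_eventually)
    qed
  qed measurable
  ultimately show ?thesis by (simp add: f_eq[OF \<psi>])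
qed

text \<open>On |\<xi>| > 2^m the weight satisfies 1 <= 2^(-2 s m) * |\<xi>|^(2 s).\<close>

lemma low_diff_decay:
  assumes s: "s > 0" and mn: "m \<le> n"
  shows "(\<integral>\<^sup>+x. ennreal ((norm (low (int n) x - low (int m) x))\<^sup>2) \<partial>lborel)
    \<le> ennreal ((2 powr (- (2 * s))) ^ m) * energy s"
proof -
  have "(\<integral>\<^sup>+x. ennreal ((norm (low (int n) x - low (int m) x))\<^sup>2) \<partial>lborel)
      \<le> (\<integral>\<^sup>+\<xi>. ennreal ((norm (F \<xi>))\<^sup>2 * indicator {\<xi>. 2 powi (int m) < norm \<xi>} \<xi>) \<partial>lborel)"
    using mn by (intro low_diff_L2) auto
  also have "\<dots> \<le> (\<integral>\<^sup>+\<xi>. ennreal ((2 powr (- (2 * s))) ^ m) * ennreal ((norm (F \<xi>))\<^sup>2 * norm \<xi> powr (2 * s)) \<partial>lborel)"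
  proof (rule nn_integral_mono)
    fix \<xi> :: 'a
    show "ennreal ((norm (F \<xi>))\<^sup>2 * indicator {\<xi>. 2 powi (int m) < norm \<xi>} \<xi>)
      \<le> ennreal ((2 powr (- (2 * s))) ^ m) * ennreal ((norm (F \<xi>))\<^sup>2 * norm \<xi> powr (2 * s))"
    proof (cases "2 powi (int m) < norm \<xi>")
      case True
      have "(2 powr (- (2 * s))) ^ m * (2 powi (int m)) powr (2 * s) = (2 powr (- (2 * s)) * 2 powr (2 * s)) ^ m"
        by (simp add: power_mult_distrib powr_powr powr_realpow[symmetric] mult_ac)
      also have "\<dots> = 1" by (simp add: powr_add[symmetric])
      finally have "1 = (2 powr (- (2 * s))) ^ m * (2 powi (int m)) powr (2 * s)" by simp
      also have "\<dots> \<le> (2 powr (- (2 * s))) ^ m * norm \<xi> powr (2 * s)"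
        using True s by (intro mult_left_mono powr_mono2) auto
      finally have "(norm (F \<xi>))\<^sup>2 * 1 \<le> (norm (F \<xi>))\<^sup>2 * ((2 powr (- (2 * s))) ^ m * norm \<xi> powr (2 * s))"
        by (intro mult_left_mono) auto
      then have "(norm (F \<xi>))\<^sup>2 \<le> (2 powr (- (2 * s))) ^ m * ((norm (F \<xi>))\<^sup>2 * norm \<xi> powr (2 * s))"
        by (simp only: mult_ac mult_1)
      then show ?thesis using True by (simp add: ennreal_mult[symmetric] ennreal_leI)
    qed simp
  qed
  also have "\<dots> = ennreal ((2 powr (- (2 * s))) ^ m) * energy s"
    unfolding energy_def by (rule nn_integral_cmult) measurable
  finally show ?thesis .
qed

text \<open>Where the sequence diverges, \<open>lim\<close> is an unspecified value. For s > 0 and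
  finite energy this happens only on a null set.\<close>

definition limit :: "'a \<Rightarrow> complex" where
  "limit x = lim (\<lambda>n. low (int n) x)"

lemma limit_measurable [measurable]: "limit \<in> borel_measurable borel"
  unfolding limit_def[abs_def] by (rule borel_measurable_lim_metric) measurable

text \<open>The squared increments decay geometrically in \<open>L\<^sup>1\<close>, so they are still summable
  after multiplication with a smaller geometric weight.\<close>

lemma low_tendsto_limit:
  assumes s: "s > 0" and fin: "energy s < \<infinity>"
  shows "AE x in lborel. (\<lambda>n. low (int n) x) \<longlonglongrightarrow> limit x"
proof -
  \<comment> \<open>The squared increments decay like 2^(-2 s n), which is \<kappa>^(-2 n); the
    weight \<kappa>^n therefore leaves the summable \<kappa>^(-n).\<close>
  define \<kappa> where "\<kappa> = 2 powr s"
  have \<kappa>: "\<kappa> > 1" unfolding \<kappa>_def using s by simp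
  define w where "w n x = low (int (Suc n)) x - low (int n) x" for n x
  have [measurable]: "w n \<in> borel_measurable borel" for n unfolding w_def[abs_def] by measurable
  obtain e where e: "energy s = ennreal e" "e \<ge> 0" using fin by (cases "energy s") auto
  have step: "ennreal (\<kappa> ^ n) * (\<integral>\<^sup>+x. ennreal ((norm (w n x))\<^sup>2) \<partial>lborel) \<le> ennreal ((1 / \<kappa>) ^ n * e)" for n
  proof -
    have "2 powr (- (2 * s)) = 1 / \<kappa> * (1 / \<kappa>)"
      unfolding \<kappa>_def by (simp add: powr_minus_divide powr_add[symmetric])
    then have "\<kappa> ^ n * ((2 powr (- (2 * s))) ^ n * e) = (\<kappa> * (1 / \<kappa> * (1 / \<kappa>))) ^ n * e"
      by (simp only: power_mult_distrib mult.assoc)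
    also have "\<kappa> * (1 / \<kappa> * (1 / \<kappa>)) = 1 / \<kappa>" using \<kappa> by simp
    finally have eq: "\<kappa> ^ n * ((2 powr (- (2 * s))) ^ n * e) = (1 / \<kappa>) ^ n * e" .
    have "ennreal (\<kappa> ^ n) * (\<integral>\<^sup>+x. ennreal ((norm (w n x))\<^sup>2) \<partial>lborel)
        \<le> ennreal (\<kappa> ^ n) * (ennreal ((2 powr (- (2 * s))) ^ n) * energy s)"
      unfolding w_def by (intro mult_left_mono low_diff_decay s) auto
    also have "\<dots> = ennreal (\<kappa> ^ n * ((2 powr (- (2 * s))) ^ n * e))"
      unfolding e using \<kappa> e(2) by (simp add: ennreal_mult)
    finally show ?thesis unfolding eq .
  qed
  have "(\<integral>\<^sup>+x. (\<Sum>n. ennreal (\<kappa> ^ n) * ennreal ((norm (w n x))\<^sup>2)) \<partial>lborel)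
      = (\<Sum>n. ennreal (\<kappa> ^ n) * (\<integral>\<^sup>+x. ennreal ((norm (w n x))\<^sup>2) \<partial>lborel))"
    by (subst nn_integral_suminf) (auto simp: nn_integral_cmult)
  also have "\<dots> \<le> (\<Sum>n. ennreal ((1 / \<kappa>) ^ n * e))"
    by (intro suminf_le step) auto
  also have "\<dots> = ennreal (\<Sum>n. (1 / \<kappa>) ^ n * e)"
    using \<kappa> e(2) by (intro suminf_ennreal2 summable_mult2 summable_geometric) auto
  also have "\<dots> < \<infinity>" by simp
  finally have "AE x in lborel. (\<Sum>n. ennreal (\<kappa> ^ n) * ennreal ((norm (w n x))\<^sup>2)) \<noteq> \<infinity>"
    by (intro nn_integral_PInf_AE) auto
  then show ?thesis
  proof eventually_elim
    case (elim x)
    define t where "t n = ennreal (\<kappa> ^ n) * ennreal ((norm (w n x))\<^sup>2)" for n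
    obtain K where K: "suminf t = ennreal K" "K \<ge> 0"
      using elim unfolding t_def[symmetric] by (cases "suminf t") auto
    \<comment> \<open>Finiteness of the weighted series bounds each of its terms by K, so the
      increments at x are dominated by a geometric series with ratio \<kappa>^(-1/2).\<close>
    have w_le: "norm (w n x) \<le> sqrt K * (sqrt (1 / \<kappa>)) ^ n" for n
    proof -
      have "ennreal (\<kappa> ^ n * (norm (w n x))\<^sup>2) = t n" unfolding t_def using \<kappa> by (simp add: ennreal_mult)
      also have "\<dots> \<le> ennreal K" using sum_le_suminf[of t "{n}"] K by simp
      finally have "\<kappa> ^ n * (norm (w n x))\<^sup>2 \<le> K" using K by simp
      then have "(norm (w n x))\<^sup>2 \<le> K * (1 / \<kappa>) ^ n"
        using \<kappa> by (simp add: power_divide field_simps)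
      then have "sqrt ((norm (w n x))\<^sup>2) \<le> sqrt (K * (1 / \<kappa>) ^ n)" by (rule real_sqrt_le_mono)
      then show ?thesis by (simp add: real_sqrt_mult real_sqrt_power)
    qed
    have "summable (\<lambda>n. w n x)"
    proof (rule summable_comparison_test')
      have "sqrt (1 / \<kappa>) < 1" using \<kappa> by simp
      then show "summable (\<lambda>n. sqrt K * (sqrt (1 / \<kappa>)) ^ n)"
        using \<kappa> by (intro summable_mult summable_geometric) auto
      show "norm (w n x) \<le> sqrt K * (sqrt (1 / \<kappa>)) ^ n" for n by (rule w_le)
    qed
    then have "(\<lambda>n. \<Sum>i<n. w i x) \<longlonglongrightarrow> (\<Sum>i. w i x)" by (rule summable_LIMSEQ)
    moreover have "(\<Sum>i<n. w i x) = low (int n) x - low 0 x" for n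
      unfolding w_def using sum_lessThan_telescope[of "\<lambda>i. low (int i) x" n] by simp
    ultimately have "(\<lambda>n. low (int n) x - low 0 x + low 0 x) \<longlonglongrightarrow> (\<Sum>i. w i x) + low 0 x"
      by (intro tendsto_add tendsto_const) simp
    then have "convergent (\<lambda>n. low (int n) x)" by (auto simp: convergent_def)
    then show ?case unfolding limit_def by (simp add: convergent_LIMSEQ_iff)
  qed
qed

text \<open>Fatou's lemma transfers the decay of increments to \<open>limit\<close>, so the
  truncations converge to it in L^2 and their pairings with \<psi> converge to that of
  \<open>limit\<close>. The same pairings converge to \<open>f \<psi>\<close>.\<close>

lemma limit_represents:
  assumes s: "s > 0" and fin: "energy s < \<infinity>"
  shows "represents limit f"
  unfolding represents_def
proof (intro conjI ballI)
  show "limit \<in> borel_measurable borel" by measurable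
  fix \<psi> :: "'a \<Rightarrow> complex" assume \<psi>: "\<psi> \<in> schwartz"
  note [measurable] = schwartz_measurable[OF \<psi>]
  obtain e where e: "energy s = ennreal e" "e \<ge> 0" using fin by (cases "energy s") auto
  let ?\<rho> = "2 powr (- (2 * s))"
  have \<rho>: "0 < ?\<rho>" "?\<rho> < 1" using s by (auto simp: powr_less_one)
  define P where "P = (LINT x|lborel. norm (\<psi> x) powr 2)"
  have P: "(\<integral>\<^sup>+x. ennreal ((norm (\<psi> x))\<^sup>2) \<partial>lborel) = ennreal P" "P \<ge> 0"
  proof -
    have "(\<integral>\<^sup>+x. ennreal (norm (\<psi> x) powr 2) \<partial>lborel) = ennreal P"
      unfolding P_def using schwartz_powr_integrable[OF \<psi>, of 2] by (intro nn_integral_eq_integral) auto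
    then show "(\<integral>\<^sup>+x. ennreal ((norm (\<psi> x))\<^sup>2) \<partial>lborel) = ennreal P" by (simp add: powr_numeral)
    show "P \<ge> 0" unfolding P_def by (auto intro!: Bochner_Integration.integral_nonneg)
  qed
  have close: "(\<integral>\<^sup>+x. ennreal ((norm (limit x - low (int m) x))\<^sup>2) \<partial>lborel) \<le> ennreal (?\<rho> ^ m * e)" for m
  proof (rule nn_integral_Fatou_le)
    show "AE x in lborel. (\<lambda>n. (norm (low (int n) x - low (int m) x))\<^sup>2) \<longlonglongrightarrow> (norm (limit x - low (int m) x))\<^sup>2"
      using low_tendsto_limit[OF s fin]
      by eventually_elim (intro tendsto_power tendsto_norm tendsto_diff tendsto_const)
    show "\<forall>\<^sub>F n in sequentially. (\<integral>\<^sup>+x. ennreal ((norm (low (int n) x - low (int m) x))\<^sup>2) \<partial>lborel) \<le> ennreal (?\<rho> ^ m * e)"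
      using low_diff_decay[OF s, of m] e
      by (intro eventually_sequentiallyI[of m]) (simp add: ennreal_mult)
  qed measurable
  \<comment> \<open>Integrability of \<open>limit\<close> against \<psi> splits into a bounded
    truncation, treated here, and \<open>limit - low 0\<close>, which is in L^2 by
    \<open>close\<close> with m = 0.\<close>
  have il: "integrable lborel (\<lambda>x. low k x * \<psi> x)" for k
  proof -
    obtain C where "C \<ge> 0" "\<And>x. norm (low k x) \<le> C" using low_bounded by blast
    then show ?thesis
      by (intro Bochner_Integration.integrable_bound[OF integrable_mult_right[OF schwartz_integrable[OF \<psi>], of "of_real C"]])
        (auto simp: norm_mult mult_right_mono)
  qed
  have "(\<integral>\<^sup>+x. ennreal (norm ((limit x - low 0 x) * \<psi> x)) \<partial>lborel) < \<infinity>"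
  proof -
    have "(\<integral>\<^sup>+x. ennreal (norm ((limit x - low 0 x) * \<psi> x)) \<partial>lborel)\<^sup>2
        = (\<integral>\<^sup>+x. ennreal (norm (limit x - low 0 x)) * ennreal (norm (\<psi> x)) \<partial>lborel)\<^sup>2"
      by (simp add: norm_mult ennreal_mult)
    also have "\<dots> \<le> (\<integral>\<^sup>+x. (ennreal (norm (limit x - low 0 x)))\<^sup>2 \<partial>lborel) * (\<integral>\<^sup>+x. (ennreal (norm (\<psi> x)))\<^sup>2 \<partial>lborel)"
      by (rule Cauchy_Schwarz_nn_integral) measurable
    also have "\<dots> \<le> ennreal e * ennreal P"
      using close[of 0] P by (intro mult_mono) (auto simp: ennreal_power)
    also have "\<dots> < \<infinity>" by (simp add: ennreal_mult_less_top)
    finally show ?thesis by (simp add: power_less_top_ennreal)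
  qed
  then have "integrable lborel (\<lambda>x. (limit x - low 0 x) * \<psi> x)"
    by (simp add: integrable_iff_bounded)
  from Bochner_Integration.integrable_add[OF this il[of 0]]
  show iv: "integrable lborel (\<lambda>x. limit x * \<psi> x)" by (simp add: algebra_simps)
  have "(\<lambda>m. (LINT x|lborel. limit x * \<psi> x) - (LINT x|lborel. low (int m) x * \<psi> x)) \<longlonglongrightarrow> 0"
  proof (rule Lim_null_comparison)
    have "(\<lambda>m. sqrt (?\<rho> ^ m * e * P)) \<longlonglongrightarrow> sqrt (0 * e * P)"
      using \<rho> by (intro tendsto_real_sqrt tendsto_mult tendsto_const LIMSEQ_power_zero) auto
    then show "(\<lambda>m. sqrt (?\<rho> ^ m * e * P)) \<longlonglongrightarrow> 0" by simp
    show "\<forall>\<^sub>F m in sequentially. norm ((LINT x|lborel. limit x * \<psi> x) - (LINT x|lborel. low (int m) x * \<psi> x)) \<le> sqrt (?\<rho> ^ m * e * P)"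
    proof (rule always_eventually, rule allI)
      fix m
      have "(LINT x|lborel. limit x * \<psi> x) - (LINT x|lborel. low (int m) x * \<psi> x) = (LINT x|lborel. (limit x - low (int m) x) * \<psi> x)"
        unfolding left_diff_distrib by (rule Bochner_Integration.integral_diff[OF iv il, symmetric])
      then have "ennreal ((norm ((LINT x|lborel. limit x * \<psi> x) - (LINT x|lborel. low (int m) x * \<psi> x)))\<^sup>2)
          \<le> (\<integral>\<^sup>+x. ennreal ((norm (limit x - low (int m) x))\<^sup>2) \<partial>lborel) * (\<integral>\<^sup>+x. ennreal ((norm (\<psi> x))\<^sup>2) \<partial>lborel)"
        using cauchy_schwarz_norm_integral[of "\<lambda>x. limit x - low (int m) x" lborel \<psi>] by simp
      also have "\<dots> \<le> ennreal (?\<rho> ^ m * e) * ennreal P"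
        unfolding P by (intro mult_right_mono close) simp
      also have "\<dots> = ennreal (?\<rho> ^ m * e * P)" using P e by (simp add: ennreal_mult)
      finally have "(norm ((LINT x|lborel. limit x * \<psi> x) - (LINT x|lborel. low (int m) x * \<psi> x)))\<^sup>2 \<le> ?\<rho> ^ m * e * P"
        using P e by simp
      then show "norm ((LINT x|lborel. limit x * \<psi> x) - (LINT x|lborel. low (int m) x * \<psi> x)) \<le> sqrt (?\<rho> ^ m * e * P)"
        by (rule real_le_rsqrt)
    qed
  qed
  from tendsto_diff[OF tendsto_const[of "LINT x|lborel. limit x * \<psi> x"] this]
  have "(\<lambda>m. LINT x|lborel. low (int m) x * \<psi> x) \<longlonglongrightarrow> (LINT x|lborel. limit x * \<psi> x)" by simp
  then show "f \<psi> = (LINT x|lborel. limit x * \<psi> x)"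
    using low_pairing_tendsto[OF \<psi>] LIMSEQ_unique by blast
qed

lemma limit_Lr_bound:
  assumes r: "r > 1" and s: "s > 0" and rs: "1 / r + s / real DIM('a) = 1 / 2" and fin: "energy s < \<infinity>"
    and B: "(SUP k. dist_Lnorm r (lp_piece \<eta> k f)) = ennreal B" "B \<ge> 0"
  shows "(\<integral>\<^sup>+x. ennreal (norm (limit x) powr r) \<partial>lborel) \<le> ennreal (layer_const r s * B powr (r - 2)) * energy s"
proof -
  have "s / real DIM('a) > 0" using s by simp
  then have "1 / r < 1 / 2" using rs by linarith
  \<comment> \<open>\<open>low_Lr_bound\<close> demands a positive bound while \<open>B\<close> may
    be 0, so it is applied with B + 1 / (m + 1). That r > 2 makes the power r - 2 continuous down to
    0 in the limit.\<close>
  then have r2: "r > 2" using r by (simp add: field_simps)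
  have "(\<integral>\<^sup>+x. ennreal (norm (limit x) powr r) \<partial>lborel)
      \<le> ennreal (layer_const r s * (B + 1 / real (Suc m)) powr (r - 2)) * energy s" for m
  proof (rule nn_integral_Fatou_le)
    show "AE x in lborel. (\<lambda>n. norm (low (int n) x) powr r) \<longlonglongrightarrow> norm (limit x) powr r"
      using low_tendsto_limit[OF s fin]
      by eventually_elim (rule tendsto_powr', (intro tendsto_norm tendsto_const | assumption)+, use r in auto)
    have "(SUP k. dist_Lnorm r (lp_piece \<eta> k f)) \<le> ennreal (B + 1 / real (Suc m))" "B + 1 / real (Suc m) > 0"
      unfolding B using B(2) by (auto intro!: ennreal_leI add_nonneg_pos)
    from low_Lr_bound[OF r s rs this]
    show "\<forall>\<^sub>F n in sequentially. (\<integral>\<^sup>+x. ennreal (norm (low (int n) x) powr r) \<partial>lborel)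
        \<le> ennreal (layer_const r s * (B + 1 / real (Suc m)) powr (r - 2)) * energy s"
      by (intro always_eventually allI)
  qed measurable
  moreover have "(\<lambda>m. energy s * ennreal (layer_const r s * (B + 1 / real (Suc m)) powr (r - 2)))
      \<longlonglongrightarrow> energy s * ennreal (layer_const r s * (B + 0) powr (r - 2))"
  proof (intro ennreal_tendsto_cmult tendsto_ennrealI tendsto_mult tendsto_const)
    show "(\<lambda>m. (B + 1 / real (Suc m)) powr (r - 2)) \<longlonglongrightarrow> (B + 0) powr (r - 2)"
      using r2 B(2) by (intro tendsto_powr' tendsto_add tendsto_const LIMSEQ_Suc[OF lim_1_over_n]) auto
  qed (use fin in simp)
  ultimately have "(\<integral>\<^sup>+x. ennreal (norm (limit x) powr r) \<partial>lborel) \<le> energy s * ennreal (layer_const r s * (B + 0) powr (r - 2))"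
    by (intro LIMSEQ_le_const) (auto simp: mult.commute)
  then show ?thesis by (simp add: mult.commute)
qed

text \<open>For the degenerate case of the theorem: the weight is positive off the origin, so zero
  energy forces \<open>F\<close> to vanish almost everywhere.\<close>

lemma represents_zero:
  assumes "energy s = 0"
  shows "represents (\<lambda>_. 0) f"
proof -
  have "AE \<xi> in lborel. ennreal ((norm (F \<xi>))\<^sup>2 * norm \<xi> powr (2 * s)) = 0"
    using assms unfolding energy_def by (subst (asm) nn_integral_0_iff_AE) auto
  then have F0: "AE \<xi> in lborel. F \<xi> = 0"
    using AE_lborel_singleton[of "0::'a"] by eventually_elim (auto simp: ennreal_eq_0_iff mult_le_0_iff powr_eq_0_iff)
  have "f \<psi> = 0" if "\<psi> \<in> schwartz" for \<psi>
    unfolding f_eq[OF that] using F0 by (intro integral_eq_zero_AE) auto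
  then show ?thesis by (simp add: represents_def)
qed

lemma Dpow_0_eq:
  assumes "\<psi> \<in> schwartz"
  shows "Dpow 0 f \<psi> = f \<psi>"
proof -
  note [measurable] = schwartz_measurable[OF inv_fourier_schwartz[OF assms]]
  show ?thesis
    unfolding Dpow_def fourier_multiplier_def F_def[symmetric] f_eq[OF assms]
  proof (rule integral_cong_AE)
    show "AE \<xi> in lborel. complex_of_real (norm \<xi> powr 0) * F \<xi> * inv_fourier \<psi> \<xi> = F \<xi> * inv_fourier \<psi> \<xi>"
      using AE_lborel_singleton[of "0::'a"] by eventually_elim simp
  qed measurable
qed

end

section \<open>Assembling the inequality\<close>

lemma epowr_le:
  assumes "x \<le> ennreal t" "t \<ge> 0" "a > 0"
  shows "epowr x a \<le> ennreal (t powr a)"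
proof -
  obtain y where y: "x = ennreal y" "y \<ge> 0"
    using assms(1) by (cases x) (auto simp: top_unique)
  then have "y \<le> t" using assms by simp
  then show ?thesis using assms y by (auto simp: epowr_def intro!: ennreal_leI powr_mono2)
qed

theorem mainTheorem7:
  fixes r s :: real and \<eta> :: "'a::euclidean_space \<Rightarrow> real"
  assumes "lp_cutoff \<eta>"
    and "1 < r" and "0 \<le> s"
    and "1 / r + s / real DIM('a) = 1 / 2"
  shows "\<exists>C::real. C > 0 \<and> (\<forall>f \<in> (Hdot s :: 'a dist set).
    dist_Lnorm r f \<le>
      ennreal C * epowr (dist_Lnorm 2 (Dpow s f)) (1 - 2 * s / real DIM('a))
        * epowr (SUP k::int. dist_Lnorm r (lp_piece \<eta> k f)) (2 * s / real DIM('a)))"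
proof -
  interpret cutoff \<eta> by unfold_locales (rule assms(1))
  have lp: "lp_function \<eta> f (fourier_fun f)" if "f \<in> Hdot s" for f
  proof (unfold_locales)
    have "\<exists>F. represents F (dist_fourier f)" using that by (simp add: Hdot_def)
    then show "represents (fourier_fun f) (dist_fourier f)"
      unfolding fourier_fun_def by (rule someI_ex)
  qed simp
  show ?thesis
  \<comment> \<open>At s = 0 the denominator of \<open>layer_const\<close> is zero. Then r = 2, the
    exponents are 1 and 0, \<open>Dpow 0 f\<close> agrees with \<open>f\<close> on Schwartz
    functions, and the claim is an equality with constant 1.\<close>
  proof (cases "s = 0")
    case True
    then have r2: "r = 2" using assms(2,4) by (simp add: field_simps)
    have "dist_Lnorm r f \<le> ennreal 1 * epowr (dist_Lnorm 2 (Dpow s f)) (1 - 2 * s / real DIM('a))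
        * epowr (SUP k::int. dist_Lnorm r (lp_piece \<eta> k f)) (2 * s / real DIM('a))"
      if f: "f \<in> Hdot s" for f :: "'a dist"
    proof -
      interpret lp_function \<eta> f "fourier_fun f" by (rule lp[OF f])
      have "represents u (Dpow s f) \<longleftrightarrow> represents u f" for u
        unfolding represents_def using Dpow_0_eq True by auto
      then have eq: "dist_Lnorm 2 (Dpow s f) = dist_Lnorm r f"
        unfolding dist_Lnorm_def r2 by simp
      have "dist_Lnorm 2 (Dpow s f) < \<infinity>" using f by (simp add: Hdot_def)
      then have "epowr (dist_Lnorm 2 (Dpow s f)) 1 = dist_Lnorm 2 (Dpow s f)"
        by (cases "dist_Lnorm 2 (Dpow s f)") (auto simp: epowr_def)
      then show ?thesis using True eq by (simp add: epowr_def[of _ 0])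
    qed
    then show ?thesis by (intro exI[of _ 1]) auto
  next
    case False
    then have s: "s > 0" using assms(3) by simp
    note r = assms(2) and rs = assms(4)
    define \<alpha> where "\<alpha> = 1 - 2 * s / real DIM('a)"
    define \<beta> where "\<beta> = 2 * s / real DIM('a)"
    \<comment> \<open>These are the exponents that the r-th root of A^2 * B^(r - 2)
      produces.\<close>
    have \<alpha>: "\<alpha> = 2 / r" and \<beta>: "\<beta> = (r - 2) * (1 / r)" "\<beta> > 0"
      unfolding \<alpha>_def \<beta>_def using rs r s by (auto simp: field_simps)
    \<comment> \<open>The constant of the L^r estimate times the Plancherel constant relating the
      energy to A^2; \<open>C\<close> is its r-th root.\<close>
    define K where "K = layer_const r s * (2 * pi) ^ DIM('a)"
    have K: "K > 0"
      unfolding K_def using layer_const_pos[OF r s] by simp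
    define C where "C = K powr (1 / r)"
    have C: "C > 0" unfolding C_def using K by simp
    have "dist_Lnorm r f \<le> ennreal C * epowr (dist_Lnorm 2 (Dpow s f)) \<alpha>
        * epowr (SUP k::int. dist_Lnorm r (lp_piece \<eta> k f)) \<beta>" (is "_ \<le> ?R")
      if f: "f \<in> Hdot s" for f :: "'a dist"
    proof -
      interpret lp_function \<eta> f "fourier_fun f" by (rule lp[OF f])
      have "dist_Lnorm 2 (Dpow s f) < \<infinity>" using f by (simp add: Hdot_def)
      then obtain A where A: "dist_Lnorm 2 (Dpow s f) = ennreal A" "A \<ge> 0"
        by (cases "dist_Lnorm 2 (Dpow s f)") auto
      have eA: "energy s \<le> ennreal ((2 * pi) ^ DIM('a) * A\<^sup>2)"
        using energy_le[OF _ A] s by simp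
      have epA: "epowr (ennreal A) \<alpha> = ennreal (A powr \<alpha>)"
        using A \<alpha> r by (simp add: epowr_def)
      show ?thesis
      \<comment> \<open>Treated first because the right side can be 0 * top = 0 when A = 0, so the
        left side must be shown to vanish. Otherwise A > 0.\<close>
      proof (cases "energy s = 0")
        case True
        have "dist_Lnorm r f \<le> Lnorm r (\<lambda>_::'a. 0)"
          unfolding dist_Lnorm_def using represents_zero[OF True] by (intro INF_lower) simp
        also have "\<dots> = 0" using r by (simp add: Lnorm_def epowr_def)
        finally show ?thesis by simp
      next
        case False
        then have A0: "A > 0" using eA A by (cases "A = 0") auto
        show ?thesis
        \<comment> \<open>With A > 0 and C > 0 an infinite supremum makes the right side
          infinite.\<close>
        proof (cases "(SUP k::int. dist_Lnorm r (lp_piece \<eta> k f)) = top")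
          case True
          then have "epowr (SUP k::int. dist_Lnorm r (lp_piece \<eta> k f)) \<beta> = top"
            using \<beta>(2) by (simp add: epowr_def)
          then show ?thesis unfolding A epA using A0 C by (simp add: ennreal_mult_top ennreal_mult_eq_top_iff)
        next
          case False
          then obtain B where B: "(SUP k::int. dist_Lnorm r (lp_piece \<eta> k f)) = ennreal B" "B \<ge> 0"
            by (cases "SUP k::int. dist_Lnorm r (lp_piece \<eta> k f)") auto
          have fin: "energy s < \<infinity>" using eA by (rule order_le_less_trans) simp
          have "(\<integral>\<^sup>+x. ennreal (norm (limit x) powr r) \<partial>lborel) \<le> ennreal (layer_const r s * B powr (r - 2)) * energy s"
            by (rule limit_Lr_bound[OF r s rs fin B])
          also have "\<dots> \<le> ennreal (layer_const r s * B powr (r - 2)) * ennreal ((2 * pi) ^ DIM('a) * A\<^sup>2)"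
            by (intro mult_left_mono eA) simp
          also have "\<dots> = ennreal (K * A\<^sup>2 * B powr (r - 2))"
            unfolding K_def by (subst ennreal_mult''[symmetric]) (auto simp: mult_ac)
          finally have I: "(\<integral>\<^sup>+x. ennreal (norm (limit x) powr r) \<partial>lborel) \<le> ennreal (K * A\<^sup>2 * B powr (r - 2))" .
          have "dist_Lnorm r f \<le> Lnorm r limit"
            unfolding dist_Lnorm_def using limit_represents[OF s fin] by (intro INF_lower) simp
          also have "\<dots> \<le> ennreal ((K * A\<^sup>2 * B powr (r - 2)) powr (1 / r))"
            unfolding Lnorm_def using I K r by (intro epowr_le) auto
          also have "(K * A\<^sup>2 * B powr (r - 2)) powr (1 / r) = C * A powr \<alpha> * B powr \<beta>"
          proof -
            have "(A\<^sup>2) powr (1 / r) = A powr (2 / r)"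
              using A0 powr_powr[of A 2 "1 / r"] by (simp add: powr_numeral)
            then show ?thesis using K A0 by (simp add: powr_mult powr_powr C_def \<alpha> \<beta>)
          qed
          also have "ennreal \<dots> = ennreal C * epowr (ennreal A) \<alpha> * epowr (ennreal B) \<beta>"
            unfolding epA using B \<beta>(2) C by (simp add: epowr_def ennreal_mult)
          finally show ?thesis unfolding A B .
        qed
      qed
    qed
    then show ?thesis using C unfolding \<alpha>_def \<beta>_def by blast
  qed
qed

end
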